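(* Let $p\in(1,\infty)$, let $\varphi\in C^2(B_1)$, and let $u$ be a solution of $$\min\{-\Delta_p u,\;u-\varphi\}=0\qquad\text{in } B_1 .$$ Assume that there is a constant $c_0>0$ such that $$|\nabla\varphi|^{2-p}\,\mathrm{div}\bigl(|\nabla\varphi|^{p-2}\nabla\varphi\bigr)\le -c_0<0\qquad\text{in } \{\nabla\varphi\ne0\}.$$ Then for any free boundary point $x_0\in\partial\{u>\varphi\}\cap B_{1/2}$ there exists $c_1>0$ such that $$\sup_{B_r(x_0)}(u-\varphi)\ge c_1r^2\qquad\text{for all } r\in(0,1/2),$$ where the constant $c_1$ depends only on the modulus of continuity of $D^2\varphi$ and on the constant $c_0$ (with $n$ and $p$ fixed).
   Context: $B_r(x_0)$ is the open ball of radius $r$ centered at $x_0$ in $\mathbb{R}^n$, and $B_r=B_r(0)$. $\Delta_p u=\mathrm{div}(|\nabla u|^{p-2}\nabla u)$ is the $p$-Laplacian. A solution of $\min\{-\Delta_p u,u-\varphi\}=0$ in an open set $\Omega\subset\mathbb{R}^n$ is understood in the usual weak sense: $u$ is continuous, $u\in W^{1,p}_{\mathrm{loc}}(\Omega)$, $u\ge\varphi$ in $\Omega$, $-\Delta_p u\ge 0$ weakly in $\Omega$ (i.e. $\int_\Omega|\nabla u|^{p-2}\nabla u\cdot\nabla\zeta\,dx\ge0$ for all nonnegative $\zeta\in C^1_c(\Omega)$), and $\Delta_p u=0$ weakly in the open set $\{u>\varphi\}$. The free boundary $\partial\{u>\varphi\}$ is the boundary of $\{u>\varphi\}$ relative to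 $\Omega$ (here $\Omega=B_1$). On $\{\nabla\varphi\neq0\}$ one has $|\nabla\varphi|^{2-p}\mathrm{div}(|\nabla\varphi|^{p-2}\nabla\varphi)=\Delta\varphi+(p-2)\dfrac{\langle\nabla\varphi,D^2\varphi\,\nabla\varphi\rangle}{|\nabla\varphi|^2}$. *)

theory Defs
  imports "HOL-Analysis.Analysis"
begin

definition grad :: "('a::euclidean_space \<Rightarrow> real) \<Rightarrow> 'a \<Rightarrow> 'a" where
  "grad f x = (\<Sum>b\<in>Basis. frechet_derivative f (at x) b *\<^sub>R b)"

definition hess :: "('a::euclidean_space \<Rightarrow> real) \<Rightarrow> 'a \<Rightarrow> 'a \<Rightarrow>\<^sub>L 'a" where
  "hess f x = Blinfun (frechet_derivative (grad f) (at x))"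

definition divergence :: "('a::euclidean_space \<Rightarrow> 'a) \<Rightarrow> 'a \<Rightarrow> real" where
  "divergence F x = (\<Sum>b\<in>Basis. frechet_derivative F (at x) b \<bullet> b)"

text \<open>The field \<open>|v|\<^sup>p\<^sup>-\<^sup>2 v\<close>; it vanishes at \<open>v = 0\<close> also for \<open>p < 2\<close>.\<close>

definition p_flux :: "real \<Rightarrow> 'a::euclidean_space \<Rightarrow> 'a" where
  "p_flux p v = norm v powr (p - 2) *\<^sub>R v"

text \<open>The classical (pointwise) p-Laplacian, meant for \<open>C\<^sup>2\<close> functions at points with
  nonvanishing gradient.\<close>

definition p_laplacian :: "real \<Rightarrow> ('a::euclidean_space \<Rightarrow> real) \<Rightarrow> 'a \<Rightarrow> real" where
  "p_laplacian p f = divergence (\<lambda>x. p_flux p (grad f x))"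

text \<open>\<open>C\<^sup>2(\<Omega>)\<close> for open \<open>\<Omega>\<close>. Values outside \<open>\<Omega>\<close> are irrelevant, and nothing is
  assumed up to the boundary.\<close>

definition C2_on :: "'a::euclidean_space set \<Rightarrow> ('a \<Rightarrow> real) \<Rightarrow> bool" where
  "C2_on \<Omega> f \<longleftrightarrow>
     (\<forall>x\<in>\<Omega>. f differentiable (at x)) \<and>
     (\<forall>x\<in>\<Omega>. grad f differentiable (at x)) \<and>
     continuous_on \<Omega> (hess f)"

text \<open>\<open>C\<^sup>1\<^sub>c(\<Omega>)\<close>, each function being extended by \<open>0\<close> to the whole space.\<close>

definition C1c :: "'a::euclidean_space set \<Rightarrow> ('a \<Rightarrow> real) set" where
  "C1c \<Omega> = {\<zeta>. (\<forall>x. \<zeta> differentiable (at x)) \<and> continuous_on UNIV (grad \<zeta>) \<and>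
     compact (closure {x. \<zeta> x \<noteq> 0}) \<and> closure {x. \<zeta> x \<noteq> 0} \<subseteq> \<Omega>}"

definition Lp_loc :: "real \<Rightarrow> 'a::euclidean_space set \<Rightarrow> ('a \<Rightarrow> 'b::euclidean_space) \<Rightarrow> bool" where
  "Lp_loc p \<Omega> f \<longleftrightarrow> f \<in> borel_measurable (lebesgue_on \<Omega>) \<and>
     (\<forall>K. compact K \<longrightarrow> K \<subseteq> \<Omega> \<longrightarrow> set_integrable lebesgue K (\<lambda>x. norm (f x) powr p))"

definition has_weak_gradient ::
    "'a::euclidean_space set \<Rightarrow> ('a \<Rightarrow> real) \<Rightarrow> ('a \<Rightarrow> 'a) \<Rightarrow> bool" where
  "has_weak_gradient \<Omega> u G \<longleftrightarrow> (\<forall>\<zeta>\<in>C1c \<Omega>.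
     (LINT x:\<Omega>|lebesgue. u x *\<^sub>R grad \<zeta> x) = - (LINT x:\<Omega>|lebesgue. \<zeta> x *\<^sub>R G x))"

text \<open>\<open>u \<in> W\<^sup>1\<^sup>,\<^sup>p\<^sub>l\<^sub>o\<^sub>c(\<Omega>)\<close> with weak gradient \<open>G\<close> (which is unique almost everywhere).\<close>

definition W1p_loc ::
    "real \<Rightarrow> 'a::euclidean_space set \<Rightarrow> ('a \<Rightarrow> real) \<Rightarrow> ('a \<Rightarrow> 'a) \<Rightarrow> bool" where
  "W1p_loc p \<Omega> u G \<longleftrightarrow> Lp_loc p \<Omega> u \<and> Lp_loc p \<Omega> G \<and> has_weak_gradient \<Omega> u G"

text \<open>In the next two definitions \<open>G\<close> stands for the weak gradient of \<open>u\<close>.\<close>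

definition weakly_p_superharmonic ::
    "real \<Rightarrow> 'a::euclidean_space set \<Rightarrow> ('a \<Rightarrow> 'a) \<Rightarrow> bool" where
  "weakly_p_superharmonic p \<Omega> G \<longleftrightarrow> (\<forall>\<zeta>\<in>C1c \<Omega>. (\<forall>x. 0 \<le> \<zeta> x) \<longrightarrow>
     0 \<le> (LINT x:\<Omega>|lebesgue. p_flux p (G x) \<bullet> grad \<zeta> x))"

definition weakly_p_harmonic ::
    "real \<Rightarrow> 'a::euclidean_space set \<Rightarrow> ('a \<Rightarrow> 'a) \<Rightarrow> bool" where
  "weakly_p_harmonic p \<Omega> G \<longleftrightarrow> (\<forall>\<zeta>\<in>C1c \<Omega>.
     (LINT x:\<Omega>|lebesgue. p_flux p (G x) \<bullet> grad \<zeta> x) = 0)"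

definition noncontact_set ::
    "'a::euclidean_space set \<Rightarrow> ('a \<Rightarrow> real) \<Rightarrow> ('a \<Rightarrow> real) \<Rightarrow> 'a set" where
  "noncontact_set \<Omega> \<phi> u = {x\<in>\<Omega>. \<phi> x < u x}"

text \<open>Weak solutions of \<open>min {-\<Delta>\<^sub>p u, u - \<phi>} = 0\<close> in \<open>\<Omega>\<close>.\<close>

definition obstacle_solution ::
    "real \<Rightarrow> 'a::euclidean_space set \<Rightarrow> ('a \<Rightarrow> real) \<Rightarrow> ('a \<Rightarrow> real) \<Rightarrow> bool" where
  "obstacle_solution p \<Omega> \<phi> u \<longleftrightarrow>
     continuous_on \<Omega> u \<and> (\<forall>x\<in>\<Omega>. \<phi> x \<le> u x) \<and>
     (\<exists>G. W1p_loc p \<Omega> u G \<and> weakly_p_superharmonic p \<Omega> G \<and>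
          weakly_p_harmonic p (noncontact_set \<Omega> \<phi> u) G)"

definition free_boundary ::
    "'a::euclidean_space set \<Rightarrow> ('a \<Rightarrow> real) \<Rightarrow> ('a \<Rightarrow> real) \<Rightarrow> 'a set" where
  "free_boundary \<Omega> \<phi> u = top_of_set \<Omega> frontier_of noncontact_set \<Omega> \<phi> u"

definition modulus_of_continuity_on ::
    "(real \<Rightarrow> real) \<Rightarrow> 'a::metric_space set \<Rightarrow> ('a \<Rightarrow> 'b::metric_space) \<Rightarrow> bool" where
  "modulus_of_continuity_on \<omega> S F \<longleftrightarrow> (\<omega> \<longlongrightarrow> 0) (at_right 0) \<and>
     (\<forall>x\<in>S. \<forall>y\<in>S. dist (F x) (F y) \<le> \<omega> (dist x y))"

text \<open>The Hessian of a \<open>C\<^sup>2\<close> function on the open unit ball need not be uniformly continuous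
  there, only on smaller concentric balls. Its modulus of continuity is therefore a family,
  \<open>\<omega> \<rho>\<close> being a modulus on the ball of radius \<open>\<rho> < 1\<close>. A constant family is a modulus on the
  whole unit ball, and by the lemma below every \<open>C\<^sup>2\<close> function admits some family.\<close>

definition hess_modulus ::
    "(real \<Rightarrow> real \<Rightarrow> real) \<Rightarrow> ('a::euclidean_space \<Rightarrow> real) \<Rightarrow> bool" where
  "hess_modulus \<omega> f \<longleftrightarrow>
     (\<forall>\<rho>\<in>{0<..<1}. modulus_of_continuity_on (\<omega> \<rho>) (ball 0 \<rho>) (hess f))"

lemma modulus_of_continuity_exists:
  fixes F :: "'a::metric_space \<Rightarrow> 'b::metric_space"
  assumes "compact K" "continuous_on K F"
  shows "\<exists>\<omega>. modulus_of_continuity_on \<omega> K F"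
proof -
  define D where "D t = {dist (F x) (F y) |x y. x \<in> K \<and> y \<in> K \<and> dist x y \<le> t}" for t
  define \<omega> where "\<omega> t = Sup (insert 0 (D t))" for t :: real
  have "bounded (F ` K)"
    using assms compact_continuous_image compact_imp_bounded by blast
  then obtain M where M: "\<And>x y. x \<in> K \<Longrightarrow> y \<in> K \<Longrightarrow> dist (F x) (F y) \<le> M"
    by (metis (full_types) bounded_two_points imageI)
  have bdd: "bdd_above (insert 0 (D t))" for t
    unfolding D_def by (intro bdd_aboveI[of _ "max 0 M"]) (auto simp: M le_max_iff_disj)
  have le: "dist (F x) (F y) \<le> \<omega> (dist x y)" if "x \<in> K" "y \<in> K" for x y
    unfolding \<omega>_def using bdd that by (intro cSup_upper) (auto simp: D_def)
  have nonneg: "0 \<le> \<omega> t" for t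
    unfolding \<omega>_def using bdd by (intro cSup_upper) auto
  have "(\<omega> \<longlongrightarrow> 0) (at_right 0)"
  proof (rule tendstoI)
    fix e :: real assume e: "e > 0"
    obtain d where d: "d > 0" "\<And>x y. x \<in> K \<Longrightarrow> y \<in> K \<Longrightarrow> dist x y < d \<Longrightarrow> dist (F x) (F y) < e/2"
      using compact_uniformly_continuous[OF assms(2,1)] e
      unfolding uniformly_continuous_on_def by (metis half_gt_zero dist_commute)
    have "dist (\<omega> t) 0 < e" if "t < d" for t
    proof -
      have "\<omega> t \<le> e/2"
        unfolding \<omega>_def using that d e
        by (intro cSup_least) (auto simp: D_def intro!: less_imp_le)
      thus ?thesis using nonneg[of t] e by simp
    qed
    thus "\<forall>\<^sub>F t in at_right 0. dist (\<omega> t) 0 < e"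
      using d(1) by (auto simp: eventually_at_right_field)
  qed
  thus ?thesis using le unfolding modulus_of_continuity_on_def by blast
qed

lemma hess_modulus_exists:
  assumes "C2_on (ball 0 1) f"
  shows "\<exists>\<omega>. hess_modulus \<omega> f"
proof -
  have "\<exists>w. modulus_of_continuity_on w (ball 0 \<rho>) (hess f)" if "\<rho> \<in> {0<..<1}" for \<rho> :: real
  proof -
    have "continuous_on (cball 0 \<rho>) (hess f)"
      using assms that unfolding C2_on_def by (auto elim!: continuous_on_subset)
    then obtain w where "modulus_of_continuity_on w (cball 0 \<rho>) (hess f)"
      using modulus_of_continuity_exists compact_cball by blast
    thus ?thesis unfolding modulus_of_continuity_on_def by auto
  qed
  thus ?thesis unfolding hess_modulus_def by metis
qed

end

theory Submission
  imports Defs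
begin

text \<open>The growth follows by comparing \<open>u\<close>, which is p-harmonic in \<open>{u > \<phi>}\<close>, with the paraboloid
  \<open>\<phi> + b|x - y|\<^sup>2\<close> centred at a point \<open>y\<close> of \<open>{u > \<phi>}\<close> close to the free boundary point: if \<open>b\<close> is small, the
  paraboloid is still a strict supersolution, so \<open>u\<close> must exceed it somewhere on each small sphere around \<open>y\<close>.

  The delicate point is that \<open>b\<close> must not depend on the size of \<open>D\<^sup>2\<phi>\<close>, although adding the paraboloid turns the
  direction of the gradient. Far from the critical points of \<open>\<phi>\<close>, measured by
  \<open>D\<^sup>2\<phi>\<close>, the turn is harmless. Near them, moving along an extremal eigenvector of \<open>D\<^sup>2\<phi>\<close> reaches
  points where the gradient of \<open>\<phi>\<close> points almost in the extremal direction, so that the hypothesis at those points is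
  stronger than the inequality wanted for the turned gradient. If \<open>\<nabla>\<phi>\<close> vanishes on an open set, it vanishes
  identically, and then the strong minimum principle leaves no free boundary.\<close>

section \<open>Symmetric matrices and the normalized p-Laplacian\<close>

text \<open>With the Hessian frozen at a point, the hypothesis speaks about one symmetric matrix
  \<open>A\<close> and many directions. Writing \<open>p - 2 = s * a\<close> with a sign
  \<open>s\<close> and \<open>a = |p - 2|\<close>, the operator in direction \<open>v\<close> is
  \<open>tr A + a * lam - a * N v / |v|^2\<close>, so only the defect \<open>N\<close> of
  \<open>v\<close> from the top eigenvector of \<open>s A\<close> matters. No norm of
  \<open>A\<close> may enter the choice of \<open>b\<close>; the trace \<open>T\<close> of the form
  behind \<open>N\<close> takes its place. Either the largest value \<open>tr A + a * lam\<close> is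
  already negative by a fixed amount, or \<open>lam\<close> is bounded below and dominates
  \<open>T\<close>. In the second case \<open>lam * r\<close> is the unit in which all errors are
  measured, so that \<open>b\<close> depends on \<open>n\<close>, \<open>p\<close> and
  \<open>c\<^sub>0\<close> only. The modulus of continuity enters through a radius \<open>r0\<close>
  on which \<open>D^2 phi\<close> oscillates little, and the constant is \<open>b * r0^2\<close>.
  The solution has only a weak gradient, so it cannot be compared with a C2 function at a touching
  point. Comparison rests on monotonicity of the flux, tested with mollified functions; critical
  points of the barrier, where the flux may fail to be differentiable, call for the regularized
  flux.\<close>

definition trace_blinfun :: "('a::euclidean_space \<Rightarrow>\<^sub>L 'a) \<Rightarrow> real" where
  "trace_blinfun A = (\<Sum>b\<in>Basis. A b \<bullet> b)"

definition normalized_pl :: "real \<Rightarrow> ('a::euclidean_space \<Rightarrow>\<^sub>L 'a) \<Rightarrow> 'a \<Rightarrow> real" where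
  "normalized_pl q A v = trace_blinfun A + q * (v \<bullet> A v) / (v \<bullet> v)"

section \<open>Positive semidefinite forms\<close>

lemma psd_cauchy_schwarz:
  fixes S :: "'a::real_vector \<Rightarrow> 'a \<Rightarrow> real"
  assumes "bilinear S" and sym: "\<And>u v. S u v = S v u" and nonneg: "\<And>v. 0 \<le> S v v"
  shows "(S u v)\<^sup>2 \<le> S u u * S v v"
proof -
  have expand: "S (x *\<^sub>R u + y *\<^sub>R v) (x *\<^sub>R u + y *\<^sub>R v) = x\<^sup>2 * S u u + 2 * x * y * S u v + y\<^sup>2 * S v v" for x y
    using assms(1) sym[of v u]
    by (simp add: bilinear_ladd bilinear_radd bilinear_lmul bilinear_rmul power2_eq_square algebra_simps)
  show ?thesis
  proof (cases "S v v = 0")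
    case True
    \<comment> \<open>With \<open>S v v = 0\<close> the quadratic polynomial in \<open>y\<close> is
      affine, and nonnegativity forces its slope to vanish.\<close>
    have "S u v = 0"
    proof (rule ccontr)
      assume ne: "S u v \<noteq> 0"
      have "0 \<le> S u u + 2 * y * S u v" for y
        using nonneg[of "1 *\<^sub>R u + y *\<^sub>R v"] unfolding expand by (simp add: True)
      from this[of "- (S u u + 1) / (2 * S u v)"] ne show False
        by (simp add: divide_simps split: if_splits)
    qed
    then show ?thesis using True by simp
  next
    case False
    then have pos: "S v v > 0" using nonneg[of v] by simp
    have "0 \<le> (S v v)\<^sup>2 * S u u - 2 * S v v * S u v * S u v + (S u v)\<^sup>2 * S v v"
      using nonneg[of "S v v *\<^sub>R u + (- S u v) *\<^sub>R v"] unfolding expand by simp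
    also have "\<dots> = S v v * (S u u * S v v - (S u v)\<^sup>2)"
      by (simp add: power2_eq_square algebra_simps)
    finally show ?thesis using pos by (simp add: zero_le_mult_iff)
  qed
qed

text \<open>The top eigenvalue of a semidefinite form is at most the sum of all eigenvalues. Instead
  of diagonalizing, the double sum over basis vectors is bounded entrywise by
  \<open>|S i j| <= sqrt (S i i) * sqrt (S j j)\<close>, which makes it the square of a single
  sum.\<close>

lemma psd_le_trace:
  fixes S :: "'a::euclidean_space \<Rightarrow> 'a \<Rightarrow> real"
  assumes bl: "bilinear S" and sym: "\<And>u v. S u v = S v u" and nonneg: "\<And>v. 0 \<le> S v v"
  shows "S v v \<le> (\<Sum>b\<in>Basis. S b b) * (v \<bullet> v)"
proof -
  have "S v v = S (\<Sum>b\<in>Basis. (v \<bullet> b) *\<^sub>R b) (\<Sum>b\<in>Basis. (v \<bullet> b) *\<^sub>R b)"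
    by (simp add: euclidean_representation)
  also have "\<dots> = (\<Sum>(i,j)\<in>Basis\<times>Basis. (v \<bullet> i) * ((v \<bullet> j) * S i j))"
    by (subst bilinear_sum[OF bl]) (intro sum.cong refl, auto simp: bilinear_lmul[OF bl] bilinear_rmul[OF bl])
  also have "\<dots> \<le> (\<Sum>(i,j)\<in>Basis\<times>Basis. (\<bar>v \<bullet> i\<bar> * sqrt (S i i)) * (\<bar>v \<bullet> j\<bar> * sqrt (S j j)))"
  proof (intro sum_mono, clarify)
    fix i j :: 'a assume "i \<in> Basis" "j \<in> Basis"
    have "\<bar>S i j\<bar> \<le> sqrt (S i i) * sqrt (S j j)"
      using psd_cauchy_schwarz[OF assms, of i j] real_sqrt_le_mono[of "(S i j)\<^sup>2" "S i i * S j j"]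
      by (simp add: real_sqrt_mult)
    then have "\<bar>v \<bullet> i\<bar> * \<bar>v \<bullet> j\<bar> * \<bar>S i j\<bar> \<le> \<bar>v \<bullet> i\<bar> * \<bar>v \<bullet> j\<bar> * (sqrt (S i i) * sqrt (S j j))"
      by (intro mult_left_mono) auto
    moreover have "(v \<bullet> i) * ((v \<bullet> j) * S i j) \<le> \<bar>v \<bullet> i\<bar> * \<bar>v \<bullet> j\<bar> * \<bar>S i j\<bar>"
      by (metis abs_ge_self abs_mult mult.assoc)
    ultimately show "(v \<bullet> i) * ((v \<bullet> j) * S i j) \<le> \<bar>v \<bullet> i\<bar> * sqrt (S i i) * (\<bar>v \<bullet> j\<bar> * sqrt (S j j))"
      by (simp add: mult_ac)
  qed
  also have "\<dots> = (\<Sum>i\<in>Basis. \<bar>v \<bullet> i\<bar> * sqrt (S i i))\<^sup>2"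
    by (simp add: power2_eq_square sum_product sum.cartesian_product)
  also have "\<dots> \<le> (\<Sum>i\<in>Basis. \<bar>v \<bullet> i\<bar>\<^sup>2) * (\<Sum>i\<in>Basis. (sqrt (S i i))\<^sup>2)"
    by (rule Cauchy_Schwarz_ineq_sum)
  also have "\<dots> = (\<Sum>b\<in>Basis. S b b) * (v \<bullet> v)"
    by (simp add: nonneg euclidean_inner[of v v] power2_eq_square mult.commute)
  finally show ?thesis .
qed

text \<open>The form \<open>N(v) = \<lambda>|v|\<^sup>2 - s\<langle>v, Av\<rangle>\<close>, with \<open>\<lambda>\<close> the top eigenvalue of \<open>sA\<close>,
  is positive semidefinite and invariant under translations along the top eigenvector.\<close>

locale top_eigenvalue =
  fixes A :: "'a::euclidean_space \<Rightarrow>\<^sub>L 'a" and s lam :: real and e :: 'a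
  assumes sym: "\<And>u v. u \<bullet> A v = v \<bullet> A u"
    and s: "s = 1 \<or> s = -1"
    and e: "norm e = 1" "lam = s * (e \<bullet> A e)"
    and top: "\<And>v. s * (v \<bullet> A v) \<le> lam * (v \<bullet> v)"
begin

definition S where "S u v = lam * (u \<bullet> v) - s * (u \<bullet> A v)"
definition N where "N v = S v v"
text \<open>The trace of the form \<open>S\<close>. It bounds \<open>N\<close> on the unit sphere
  and stands in for a norm of \<open>A\<close> in all later estimates.\<close>

definition T where "T = DIM('a) * lam - s * trace_blinfun A"

lemma bilinear_S: "bilinear S"
  unfolding bilinear_def S_def
  by (intro conjI allI linearI)
    (simp_all add: inner_left_distrib inner_right_distrib blinfun.add_right blinfun.scaleR_right algebra_simps)

lemma sym_S: "S u v = S v u"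
  unfolding S_def using sym[of u v] by (simp add: inner_commute)

lemma N_nonneg: "0 \<le> N v"
  using top[of v] by (simp add: N_def S_def)

lemma S_self_nonneg: "0 \<le> S v v"
  using N_nonneg N_def by simp

lemma T_eq: "T = (\<Sum>b\<in>Basis. S b b)"
  unfolding T_def S_def trace_blinfun_def
  by (simp add: sum_subtractf inner_Basis sum_distrib_left[symmetric] inner_commute)

lemma N_le: "N v \<le> T * (v \<bullet> v)"
  unfolding N_def T_eq using psd_le_trace[OF bilinear_S sym_S S_self_nonneg] by simp

lemma T_nonneg: "0 \<le> T"
  unfolding T_eq by (intro sum_nonneg S_self_nonneg)

text \<open>\<open>e\<close> is a null vector of a semidefinite form, and the Cauchy-Schwarz
  inequality puts null vectors into the radical. Both the eigenvector equation and the translation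
  invariance of \<open>N\<close> come from here.\<close>

lemma S_e: "S e v = 0"
proof -
  have "S e e = 0" unfolding S_def using e by (simp add: dot_square_norm)
  then show ?thesis
    using psd_cauchy_schwarz[OF bilinear_S sym_S S_self_nonneg, of e v] by simp
qed

lemma A_e: "A e = (s * lam) *\<^sub>R e"
proof -
  have "(lam *\<^sub>R e - s *\<^sub>R A e) \<bullet> v = 0" for v
    using S_e[of v] sym[of e v] by (simp add: S_def inner_diff_left inner_diff_right inner_commute[of _ v])
  then have "lam *\<^sub>R e = s *\<^sub>R A e"
    using inner_eq_zero_iff[of "lam *\<^sub>R e - s *\<^sub>R A e"] by simp
  then have "s *\<^sub>R lam *\<^sub>R e = (s * s) *\<^sub>R A e" by simp
  then show ?thesis using s by auto
qed

lemma N_shift: "N (v + t *\<^sub>R e) = N v"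
  using S_e[of v] S_e[of e] sym_S[of v e] bilinear_S
  by (simp add: N_def bilinear_ladd bilinear_radd bilinear_lmul bilinear_rmul)

lemma N_scale: "N (t *\<^sub>R v) = t\<^sup>2 * N v"
  using bilinear_S by (simp add: N_def bilinear_lmul bilinear_rmul power2_eq_square)

lemma N_add_le: "N (u + v) \<le> 2 * N u + 2 * N v"
proof -
  have "N (u + v) + N (u - v) = 2 * N u + 2 * N v"
    using bilinear_S sym_S[of u v]
    by (simp add: N_def bilinear_ladd bilinear_radd bilinear_lsub bilinear_rsub)
  then show ?thesis using N_nonneg[of "u - v"] by linarith
qed

text \<open>Polarization gives \<open>N u - N v = S (u - v) (u + v)\<close>; the Cauchy-Schwarz
  inequality for \<open>S\<close>, the bound of \<open>N\<close> by \<open>T\<close> and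
  \<open>|u + v| <= 2\<close> do the rest. The Lipschitz constant on the unit sphere thus involves
  \<open>T\<close> only.\<close>

lemma N_diff_le:
  assumes "norm u = 1" "norm v = 1"
  shows "N u - N v \<le> 2 * T * norm (u - v)"
proof -
  have eq: "N u - N v = S (u - v) (u + v)"
    using bilinear_S sym_S[of u v]
    by (simp add: N_def bilinear_ladd bilinear_radd bilinear_lsub bilinear_rsub)
  have *: "(S (u - v) (u + v))\<^sup>2 \<le> (2 * T * norm (u - v))\<^sup>2"
  proof -
    have "(S (u - v) (u + v))\<^sup>2 \<le> N (u - v) * N (u + v)"
      unfolding N_def using psd_cauchy_schwarz[OF bilinear_S sym_S S_self_nonneg] by blast
    also have "\<dots> \<le> (T * (norm (u - v))\<^sup>2) * (T * 2\<^sup>2)"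
    proof (intro mult_mono)
      show "N (u - v) \<le> T * (norm (u - v))\<^sup>2" using N_le[of "u-v"] by (simp add: dot_square_norm)
      have "norm (u + v) \<le> 2" using norm_triangle_ineq[of u v] assms by simp
      then have "(norm (u + v))\<^sup>2 \<le> 2\<^sup>2" by (intro power_mono) auto
      then show "N (u + v) \<le> T * 2\<^sup>2"
        using N_le[of "u+v"] T_nonneg by (smt (verit) dot_square_norm mult_left_mono)
    qed (use T_nonneg N_nonneg in auto)
    finally show ?thesis by (simp add: power2_eq_square mult_ac)
  qed
  from * have "S (u - v) (u + v) \<le> 2 * T * norm (u - v)"
    by (rule power2_le_imp_le) (use T_nonneg in simp)
  with eq show ?thesis by simp
qed

text \<open>The quadratic term equals \<open>a\<close> times the top eigenvalue minus
  \<open>a\<close> times the normalized defect. For \<open>a >= 0\<close> the operator is therefore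
  largest in the direction \<open>e\<close>, whatever the sign of \<open>q\<close>.\<close>

lemma normalized_pl_eq:
  assumes "v \<noteq> 0" "q = s * a"
  shows "normalized_pl q A v = trace_blinfun A + a * lam - a * (N v / (v \<bullet> v))"
  using assms unfolding normalized_pl_def N_def S_def by (simp add: field_simps)

end

lemma top_eigenvalue_exists:
  fixes A :: "'a::euclidean_space \<Rightarrow>\<^sub>L 'a"
  assumes sym: "\<And>u v. u \<bullet> A v = v \<bullet> A u" and s: "s = 1 \<or> s = -1"
  shows "\<exists>lam e. top_eigenvalue A s lam e"
proof -
  have "continuous_on (sphere 0 1) (\<lambda>v. s * (v \<bullet> A v))"
    by (intro continuous_intros)
  moreover have "sphere (0::'a) 1 \<noteq> {}"
    using vector_choose_size[of 1] by force
  ultimately have "\<exists>e\<in>sphere 0 1. \<forall>v\<in>sphere 0 1. s * (v \<bullet> A v) \<le> s * (e \<bullet> A e)"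
    by (intro continuous_attains_sup compact_sphere)
  then obtain e where e: "e \<in> sphere 0 1" and max: "\<And>v. v \<in> sphere 0 1 \<Longrightarrow> s * (v \<bullet> A v) \<le> s * (e \<bullet> A e)"
    by blast
  have "s * (v \<bullet> A v) \<le> (s * (e \<bullet> A e)) * (v \<bullet> v)" for v
  proof (cases "v = 0")
    case False
    have "s * ((v /\<^sub>R norm v) \<bullet> A (v /\<^sub>R norm v)) \<le> s * (e \<bullet> A e)"
      using False by (intro max) auto
    then have "s * (v \<bullet> A v) / (norm v)\<^sup>2 \<le> s * (e \<bullet> A e)"
      by (simp add: blinfun.scaleR_right power2_eq_square divide_inverse mult_ac)
    then show ?thesis using False by (simp add: dot_square_norm divide_le_eq)
  qed simp
  then have "top_eigenvalue A s (s * (e \<bullet> A e)) e"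
    using assms e by unfold_locales auto
  then show ?thesis by blast
qed


lemma normalized_pl_dichotomy:
  fixes p c :: real
  assumes p: "1 < p" and c: "0 < c"
  obtains \<gamma> \<kappa> C :: real where "\<gamma> > 0" "\<kappa> > 0" "C > 0"
    "\<And>(A :: 'a::euclidean_space \<Rightarrow>\<^sub>L 'a) s lam e v. top_eigenvalue A s lam e \<Longrightarrow> p - 2 = s * \<bar>p - 2\<bar> \<Longrightarrow>
       v \<noteq> 0 \<Longrightarrow> normalized_pl (p - 2) A v \<le> - c \<Longrightarrow>
       (trace_blinfun A \<le> - \<gamma> \<and> (\<forall>w. w \<noteq> 0 \<longrightarrow> normalized_pl (p - 2) A w \<le> - \<gamma>)) \<or>
       (\<kappa> \<le> lam \<and> top_eigenvalue.T A s lam \<le> C * lam)"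
proof -
  define n where "n = real DIM('a)"
  define q where "q = p - 2"
  define a where "a = \<bar>q\<bar>"
  have n: "n \<ge> 1" unfolding n_def using DIM_positive[where 'a='a] by linarith
  then have nq: "n + q > 0" using p by (simp add: q_def)
  \<comment> \<open>The threshold that separates the alternatives for \<open>q > 0\<close>. If
    \<open>tr A + q * lam > - \<gamma>0\<close>, then \<open>q * T > c - \<gamma>0\<close>, and
    \<open>(1 + q) * \<gamma>0 = c / 2\<close> turns this into \<open>2 * \<gamma>0 <= T\<close>, so
    that \<open>T - \<gamma>0\<close> is at least both \<open>T / 2\<close> and
    \<open>\<gamma>0\<close>.\<close>
  define \<gamma>0 where "\<gamma>0 = c / 2 / (1 + q)"
  have q1: "1 + q > 0" using p by (simp add: q_def)
  have "t * (c / 2 / t) = c / 2" if "t > 0" for t :: real using that by simp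
  from this[OF q1] have \<gamma>0: "\<gamma>0 > 0" "(1 + q) * \<gamma>0 = c / 2" using q1 c unfolding \<gamma>0_def by auto
  define \<gamma> where "\<gamma> = min \<gamma>0 (n * \<gamma>0 / (n + q))"
  define \<kappa> where "\<kappa> = min (\<gamma>0 / (n + q)) (c / (n + q))"
  define C where "C = max (2 * (n + q)) ((n + q) / (1 + q))"
  have pos: "\<gamma> > 0" "\<kappa> > 0" "C > 0"
    using \<gamma>0 nq n c by (auto simp: \<gamma>_def \<kappa>_def C_def less_max_iff_disj)
  show ?thesis
  proof (rule that[OF pos])
    fix A :: "'a \<Rightarrow>\<^sub>L 'a" and s lam and e v :: 'a
    assume te: "top_eigenvalue A s lam e" and qs: "p - 2 = s * \<bar>p - 2\<bar>" and v: "v \<noteq> 0"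
      and known: "normalized_pl (p - 2) A v \<le> - c"
    interpret top_eigenvalue A s lam e by fact
    have q: "q = s * a" using qs by (simp add: q_def a_def)
    have a0: "a \<ge> 0" by (simp add: a_def)
    have eq: "normalized_pl q A w = trace_blinfun A + a * lam - a * (N w / (w \<bullet> w))" if "w \<noteq> 0" for w
      using normalized_pl_eq[OF that q] .
    have NT: "N v / (v \<bullet> v) \<le> T" using N_le[of v] v by (simp add: divide_le_eq)
    have kn: "trace_blinfun A + a * lam - a * T \<le> - c"
      using known eq[OF v] mult_left_mono[OF NT a0] by (simp add: q_def)
    have up: "normalized_pl q A w \<le> trace_blinfun A + a * lam" if "w \<noteq> 0" for w
      using eq[OF that] a0 N_nonneg[of w] by simp
    have Teq: "T = n * lam - s * trace_blinfun A" by (simp add: T_def n_def)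
    have "(trace_blinfun A \<le> - \<gamma> \<and> (\<forall>w. w \<noteq> 0 \<longrightarrow> normalized_pl q A w \<le> - \<gamma>)) \<or> (\<kappa> \<le> lam \<and> T \<le> C * lam)"
    proof (cases "q < 0")
      case True
      then have a: "a = - q" by (simp add: a_def)
      have s1: "s = -1" using s q a0 True by force
      have tr: "trace_blinfun A = T - n * lam" using Teq s1 by simp
      \<comment> \<open>Here \<open>T = n * lam + tr A\<close>, and eliminating the trace leaves
        positive coefficients on both sides because \<open>1 + q = p - 1 > 0\<close>. One inequality
        then bounds \<open>lam\<close> below and \<open>T\<close> by \<open>lam\<close>.\<close>
      have *: "(1 + q) * T + c \<le> (n + q) * lam"
        using kn unfolding tr a by (simp add: algebra_simps)
      have "c \<le> (n + q) * lam" using * mult_nonneg_nonneg[of "1 + q" T] T_nonneg q1 by linarith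
      then have "c / (n + q) \<le> lam" using nq by (simp add: divide_le_eq mult.commute)
      then have "\<kappa> \<le> lam" unfolding \<kappa>_def by linarith
      moreover have "T \<le> C * lam"
      proof -
        have "T \<le> (n + q) / (1 + q) * lam" using * q1 c by (simp add: field_simps)
        also have "\<dots> \<le> C * lam" using \<open>\<kappa> \<le> lam\<close> pos by (intro mult_right_mono) (auto simp: C_def)
        finally show ?thesis .
      qed
      ultimately show ?thesis by simp
    next
      case False
      have a: "a = q" using False by (simp add: a_def)
      show ?thesis
      proof (cases "q = 0")
        case True
        then have "trace_blinfun A \<le> - c" using kn a by simp
        moreover have "\<gamma> \<le> c" unfolding \<gamma>_def \<gamma>0_def using True c by simp
        ultimately show ?thesis using up a True by fastforce
      next
        case q0: False
        have s1: "s = 1" using s q a0 False q0 by auto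
        have tr: "trace_blinfun A = n * lam - T" using Teq s1 by simp
        show ?thesis
        proof (cases "trace_blinfun A + q * lam \<le> - \<gamma>0")
          case True
          have "trace_blinfun A \<le> - \<gamma>"
          proof (cases "lam \<ge> 0")
            case True2: True
            then have "q * lam \<ge> 0" using False by simp
            then show ?thesis using True by (simp add: \<gamma>_def)
          next
            case False2: False
            \<comment> \<open>For \<open>lam < 0\<close> the bound on \<open>tr A + q * lam\<close>
              might come from \<open>q * lam\<close> alone; adding \<open>n\<close> times it to
              \<open>q * tr A <= q * n * lam\<close> removes \<open>lam\<close>.\<close>
            have "q * trace_blinfun A \<le> q * (n * lam)"
              using False T_nonneg tr by (intro mult_left_mono) auto
            moreover have "n * trace_blinfun A + n * (q * lam) \<le> - (n * \<gamma>0)"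
              using mult_left_mono[OF True, of n] n by (simp add: algebra_simps)
            ultimately have "(n + q) * trace_blinfun A \<le> - (n * \<gamma>0)"
              by (simp add: algebra_simps)
            then have "trace_blinfun A \<le> - (n * \<gamma>0 / (n + q))"
              using nq by (simp add: field_simps)
            then show ?thesis by (simp add: \<gamma>_def)
          qed
          moreover have "normalized_pl q A w \<le> - \<gamma>" if "w \<noteq> 0" for w
            using up[OF that] True a by (simp add: \<gamma>_def)
          ultimately show ?thesis by simp
        next
          case big: False
          have 1: "(n + q) * lam > T - \<gamma>0" using big tr by (simp add: algebra_simps)
          have 2: "q * T > c - \<gamma>0" using big kn a by simp
          have "2 * \<gamma>0 \<le> T"
          proof (rule ccontr)
            assume "\<not> ?thesis"
            then have "q * T \<le> q * (2 * \<gamma>0)" using False by (intro mult_left_mono) auto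
            moreover have "2 * \<gamma>0 + 2 * (q * \<gamma>0) = c" using \<gamma>0(2) by (simp add: algebra_simps)
            ultimately show False using 2 \<gamma>0(1) by linarith
          qed
          then have "T / 2 \<le> (n + q) * lam" "\<gamma>0 \<le> (n + q) * lam" using 1 by linarith+
          then have "T \<le> 2 * (n + q) * lam" "\<gamma>0 / (n + q) \<le> lam"
            using nq by (auto simp: field_simps)
          then have "\<kappa> \<le> lam" unfolding \<kappa>_def by linarith
          moreover have "T \<le> C * lam"
          proof -
            have "2 * (n + q) * lam \<le> C * lam" using \<open>\<kappa> \<le> lam\<close> pos by (intro mult_right_mono) (auto simp: C_def)
            then show ?thesis using \<open>T \<le> 2 * (n + q) * lam\<close> by linarith
          qed
          ultimately show ?thesis by simp
        qed
      qed
    qed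
    then show "(trace_blinfun A \<le> - \<gamma> \<and> (\<forall>w. w \<noteq> 0 \<longrightarrow> normalized_pl (p - 2) A w \<le> - \<gamma>)) \<or> (\<kappa> \<le> lam \<and> T \<le> C * lam)"
      by (simp add: q_def)
  qed
qed

section \<open>Stability of the inequality when the gradient is turned\<close>

lemma unit_vector_diff_le:
  fixes x y :: "'a::real_normed_vector"
  assumes "x \<noteq> 0" "y \<noteq> 0"
  shows "norm (x /\<^sub>R norm x - y /\<^sub>R norm y) \<le> 2 * norm (x - y) / norm x"
proof -
  have "x /\<^sub>R norm x - y /\<^sub>R norm y = (x - y) /\<^sub>R norm x + (inverse (norm x) - inverse (norm y)) *\<^sub>R y"
    by (simp add: algebra_simps)
  also have "norm \<dots> \<le> norm (x - y) / norm x + \<bar>norm y - norm x\<bar> / norm x"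
    using assms by (intro order_trans[OF norm_triangle_ineq] add_mono)
      (auto simp: divide_inverse inverse_diff_inverse abs_mult)
  also have "\<dots> \<le> norm (x - y) / norm x + norm (x - y) / norm x"
    using norm_triangle_ineq3[of y x] by (intro add_left_mono divide_right_mono) (auto simp: norm_minus_commute)
  finally show ?thesis by simp
qed

text \<open>\<open>P h\<close> models the gradient of the obstacle at displacement \<open>h\<close>,
  \<open>A\<close> its frozen Hessian and \<open>2 * b * z\<close> the gradient of the added
  paraboloid. Either \<open>P 0\<close> is large compared with \<open>b * r\<close> and
  \<open>T * b * r\<close>, and turning it costs little; or it is small compared with
  \<open>lam * r\<close>, and the displacement \<open>r *\<^sub>R e\<close> reaches a gradient that
  points nearly along \<open>e\<close>, where the hypothesis says most. Comparability of
  \<open>T\<close> with \<open>lam\<close> is what makes the two ranges exhaust all cases.\<close>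

lemma (in top_eigenvalue) normalized_pl_perturbation:
  assumes q: "q = s * a" and a: "0 \<le> a" and c: "0 < c" and r: "0 < r" and b: "0 < b"
    and lam: "\<kappa> \<le> lam" "0 < \<kappa>" "T \<le> C * lam"
    and K: "16 * a \<le> K * c" "0 \<le> K"
    and b1: "(2 / \<kappa> + K * C) * b \<le> 1 / 16" and b2: "b \<le> \<kappa> / 16" and b3: "72 * C * b\<^sup>2 / \<kappa> * a \<le> c / 2"
    and z: "norm z \<le> r"
    and lin: "\<And>h. norm h \<le> r \<Longrightarrow> norm (P h - P 0 - A h) \<le> b * r"
    and known: "\<And>h. norm h \<le> r \<Longrightarrow> P h \<noteq> 0 \<Longrightarrow> normalized_pl q A (P h) \<le> - c"
  shows "(P 0 + (2 * b) *\<^sub>R z \<noteq> 0 \<longrightarrow> normalized_pl q A (P 0 + (2 * b) *\<^sub>R z) \<le> - c / 2)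
     \<and> (P 0 + (2 * b) *\<^sub>R z = 0 \<longrightarrow> trace_blinfun A \<le> - c / 2)"
proof -
  define g where "g = P 0"
  define g' where "g' = g + (2 * b) *\<^sub>R z"
  have gg': "norm (g - g') \<le> 2 * b * r"
    using mult_left_mono[OF z, of b] b by (simp add: g'_def)
  have lam0: "lam > 0" using lam by linarith
  have C0: "C \<ge> 0" using T_nonneg lam lam0 by (smt (verit) mult_neg_pos)
  \<comment> \<open>In the threshold, the summand 2 keeps \<open>g'\<close> away from 0, since
    \<open>|g - g'| <= 2 * b * r\<close>. The summand \<open>K * T\<close> absorbs the change of
    \<open>N\<close> on the unit sphere, and \<open>16 * a <= K * c\<close> limits its effect to
    \<open>c / 2\<close>.\<close>
  show ?thesis
  proof (cases "(2 + K * T) * b * r < norm g")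
    case True
    have gpos: "norm g > 2 * b * r"
    proof -
      have "0 \<le> (K * T) * (b * r)" using b r K T_nonneg by (intro mult_nonneg_nonneg) auto
      then show ?thesis using True by (simp add: algebra_simps)
    qed
    then have g0: "g \<noteq> 0" using b r by (auto simp: mult_less_0_iff)
    have g'0: "g' \<noteq> 0" using gpos gg' by auto
    have "normalized_pl q A g \<le> - c" using known[of 0] r g0 by (simp add: g_def)
    then have 1: "trace_blinfun A + a * lam - a * (N g / (g \<bullet> g)) \<le> - c"
      using normalized_pl_eq[OF g0 q] by simp
    have "N (g /\<^sub>R norm g) - N (g' /\<^sub>R norm g') \<le> 2 * T * norm (g /\<^sub>R norm g - g' /\<^sub>R norm g')"
      using g0 g'0 by (intro N_diff_le) auto
    also have "\<dots> \<le> 2 * T * (2 * norm (g - g') / norm g)"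
      using unit_vector_diff_le[OF g0 g'0] T_nonneg by (intro mult_left_mono) auto
    also have "\<dots> \<le> 2 * T * (2 * (2 * b * r) / norm g)"
      using gg' T_nonneg by (intro mult_left_mono divide_right_mono) auto
    finally have 2: "N g / (g \<bullet> g) - N g' / (g' \<bullet> g') \<le> 8 * T * (b * r) / norm g"
      by (simp add: N_scale power_inverse dot_square_norm divide_inverse mult_ac)
    have "16 * a * (T * (b * r)) \<le> K * c * (T * (b * r))"
      using K T_nonneg b r by (intro mult_right_mono) auto
    also have "\<dots> = c * (K * T * b * r)" by simp
    also have "\<dots> \<le> c * norm g"
      using True c b r by (intro mult_left_mono) (auto simp: algebra_simps, smt (verit) mult_pos_pos)
    finally have "a * (8 * T * (b * r) / norm g) \<le> c / 2"
      using g0 by (simp add: field_simps)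
    with mult_left_mono[OF 2 a] have "a * (N g / (g \<bullet> g)) - a * (N g' / (g' \<bullet> g')) \<le> c / 2"
      unfolding right_diff_distrib by linarith
    with 1 have "normalized_pl q A g' \<le> - c / 2"
      using normalized_pl_eq[OF g'0 q] by linarith
    then show ?thesis using g'0 by (simp add: g'_def g_def)
  next
    case False
    \<comment> \<open>Both summands are at most multiples of \<open>lam\<close>:
      \<open>2 <= 2 / \<kappa> * lam\<close> and \<open>T <= C * lam\<close>. The threshold for
      \<open>|g|\<close> is thus a small fraction of \<open>lam * r\<close>.\<close>
    have "(2 + K * T) * b \<le> lam / 16"
    proof -
      have "2 \<le> 2 / \<kappa> * lam" using lam by (simp add: field_simps)
      moreover have "K * T \<le> K * (C * lam)" using lam K by (intro mult_left_mono)
      ultimately have "(2 + K * T) * b \<le> (2 / \<kappa> * lam + K * (C * lam)) * b"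
        using b by (intro mult_right_mono) auto
      also have "\<dots> = lam * ((2 / \<kappa> + K * C) * b)" by (simp add: algebra_simps)
      also have "\<dots> \<le> lam * (1 / 16)" using b1 lam0 by (intro mult_left_mono) auto
      finally show ?thesis by simp
    qed
    then have "(2 + K * T) * b * r \<le> lam / 16 * r" using r by (intro mult_right_mono) auto
    then have ng: "norm g \<le> lam * r / 16" using False by simp
    have br: "2 * b * r \<le> lam * r / 8" using b2 lam r by simp
    have br1: "b * r \<le> lam * r / 16" using b2 lam r by simp
    have ng': "norm g' \<le> 3 * (lam * r) / 16"
      using norm_triangle_ineq4[of g "g - g'"] gg' ng br by simp
    \<comment> \<open>Moving by \<open>r\<close> along the top eigenvector adds a multiple of
      \<open>e\<close> of length \<open>lam * r\<close> to the gradient. It dominates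
      \<open>g\<close> and the linearization error, yet leaves \<open>N\<close> unchanged.\<close>
    define h where "h = r *\<^sub>R e"
    define v where "v = P h"
    define err where "err = v - g - A h"
    have nh: "norm h \<le> r" using r e by (simp add: h_def)
    have nerr: "norm err \<le> b * r" using lin[OF nh] by (simp add: err_def v_def g_def)
    have v_eq: "v = (g + err) + (r * s * lam) *\<^sub>R e"
      by (simp add: err_def h_def blinfun.scaleR_right A_e)
    have "norm ((r * s * lam) *\<^sub>R e) = lam * r" using e s r lam0 by (auto simp: abs_mult)
    moreover have "norm ((r * s * lam) *\<^sub>R e) \<le> norm v + norm (g + err)"
      unfolding v_eq by (metis add.commute add_diff_cancel_left' norm_triangle_ineq4)
    ultimately have nv: "7 * (lam * r) / 8 \<le> norm v"
      using norm_triangle_ineq[of g err] ng nerr br1 by argo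
    then have v0: "v \<noteq> 0" using lam0 r by (auto simp: mult_le_0_iff)
    have vv: "(lam * r)\<^sup>2 / 2 \<le> v \<bullet> v"
    proof -
      have "(7 * (lam * r) / 8)\<^sup>2 \<le> (norm v)\<^sup>2" using nv lam0 r by (intro power_mono) auto
      moreover have "(7 * (lam * r) / 8)\<^sup>2 = 49/64 * (lam * r)\<^sup>2"
        by (simp add: power2_eq_square)
      ultimately have "49/64 * (lam * r)\<^sup>2 \<le> v \<bullet> v" by (simp add: dot_square_norm)
      then show ?thesis using zero_le_power2[of "lam * r"] by argo
    qed
    \<comment> \<open>By translation invariance \<open>N v = N (g + err)\<close>. Passing from
      \<open>g + err\<close> to \<open>g'\<close> costs a factor 2, which is won back below because
      \<open>2 * |g'|^2 <= |v|^2\<close>; the remainder \<open>err + (g - g')\<close> has norm at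
      most \<open>3 * b * r\<close>.\<close>
    have Nv: "N v \<le> 2 * N g' + 18 * T * (b * r)\<^sup>2"
    proof -
      have "N v = N (g' + (err + (g - g')))" using N_shift[of "g + err"] v_eq by (simp add: algebra_simps)
      also have "\<dots> \<le> 2 * N g' + 2 * N (err + (g - g'))" by (rule N_add_le)
      also have "N (err + (g - g')) \<le> T * (3 * (b * r))\<^sup>2"
      proof -
        have "norm (err + (g - g')) \<le> 3 * (b * r)"
          using norm_triangle_ineq[of err "g - g'"] nerr gg' by simp
        then have "(norm (err + (g - g')))\<^sup>2 \<le> (3 * (b * r))\<^sup>2" by (intro power_mono) auto
        then show ?thesis using N_le[of "err + (g - g')"] T_nonneg
          by (smt (verit) dot_square_norm mult_left_mono)
      qed
      finally show ?thesis by (simp add: power_mult_distrib)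
    qed
    have "18 * T * (b * r)\<^sup>2 / (v \<bullet> v) \<le> 18 * T * (b * r)\<^sup>2 / ((lam * r)\<^sup>2 / 2)"
      using vv lam0 r T_nonneg v0 by (intro divide_left_mono) (auto simp: mult_pos_pos)
    also have "\<dots> = 36 * b\<^sup>2 * T / lam\<^sup>2" using r lam0 by (simp add: field_simps power_mult_distrib)
    also have "\<dots> \<le> 36 * b\<^sup>2 * (C * lam) / lam\<^sup>2"
      using lam by (intro divide_right_mono mult_left_mono) auto
    also have "\<dots> = 36 * C * b\<^sup>2 / lam" using lam0 by (simp add: power2_eq_square)
    also have "\<dots> \<le> 72 * C * b\<^sup>2 / \<kappa>"
      using lam C0 by (intro frac_le) auto
    finally have 18: "18 * T * (b * r)\<^sup>2 / (v \<bullet> v) \<le> 72 * C * b\<^sup>2 / \<kappa>" .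
    have Nv': "N v / (v \<bullet> v) \<le> 2 * N g' / (v \<bullet> v) + 72 * C * b\<^sup>2 / \<kappa>"
      using divide_right_mono[OF Nv, of "v \<bullet> v"] 18 by (simp add: add_divide_distrib)
    have "normalized_pl q A v \<le> - c" using known[OF nh] v0 by (simp add: v_def)
    then have "trace_blinfun A + a * lam \<le> - c + a * (N v / (v \<bullet> v))"
      using normalized_pl_eq[OF v0 q] by simp
    also have "\<dots> \<le> - c + a * (2 * N g' / (v \<bullet> v) + 72 * C * b\<^sup>2 / \<kappa>)"
      using Nv' a by (intro add_left_mono mult_left_mono)
    also have "\<dots> \<le> - c / 2 + a * (2 * N g' / (v \<bullet> v))"
      using b3 by (simp add: algebra_simps)
    finally have main: "trace_blinfun A + a * lam \<le> - c / 2 + a * (2 * N g' / (v \<bullet> v))" .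
    show ?thesis
    proof (cases "g' = 0")
      case True
      \<comment> \<open>Without a direction \<open>g'\<close> the defect is 0, and dropping
        \<open>a * lam \<ge> 0\<close> leaves the trace alone.\<close>
      then have "N g' = 0" by (metis N_scale mult_zero_left power_zero_numeral scaleR_zero_left)
      moreover have "a * lam \<ge> 0" using a lam0 by simp
      ultimately have "trace_blinfun A \<le> - c / 2" using main by simp
      then show ?thesis using True by (simp add: g'_def g_def)
    next
      case g'0: False
      have "2 * (g' \<bullet> g') \<le> v \<bullet> v"
      proof -
        have "(norm g')\<^sup>2 \<le> (3 * (lam * r) / 16)\<^sup>2" using ng' by (intro power_mono) auto
        then have "g' \<bullet> g' \<le> 9 / 256 * (lam * r)\<^sup>2" by (simp add: dot_square_norm power2_eq_square)
        then show ?thesis using vv zero_le_power2[of "lam * r"] by argo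
      qed
      then have "2 * N g' / (v \<bullet> v) \<le> 2 * N g' / (2 * (g' \<bullet> g'))"
        using N_nonneg[of g'] g'0 v0 by (intro divide_left_mono) (auto simp: mult_pos_pos)
      then have "a * (2 * N g' / (v \<bullet> v)) \<le> a * (N g' / (g' \<bullet> g'))"
        using a by (intro mult_left_mono) auto
      then have "normalized_pl q A g' \<le> - c / 2"
        using main normalized_pl_eq[OF g'0 q] by simp
      then show ?thesis using g'0 by (simp add: g'_def g_def)
    qed
  qed
qed

text \<open>\<open>b\<close> is fixed before matrix, gradient and radius are known. The Hessian of
  \<open>b * |x - y|^2\<close> is \<open>2 * b\<close> times the identity; it contributes the
  summands \<open>2 * b * (DIM('a) + (p - 2))\<close> and \<open>2 * b * DIM('a)\<close>, so the
  conclusion is that obstacle plus paraboloid is a strict supersolution at the point. One nonzero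
  \<open>P h\<close> gives access to the dichotomy.\<close>

lemma normalized_pl_stable:
  fixes p c :: real
  assumes p: "1 < p" and c: "0 < c"
  obtains b :: real where "0 < b"
    "\<And>(A :: 'a::euclidean_space \<Rightarrow>\<^sub>L 'a) P z r. \<lbrakk>\<And>u v. u \<bullet> blinfun_apply A v = v \<bullet> blinfun_apply A u; 0 < r; norm z \<le> r;
       \<And>h. norm h \<le> r \<Longrightarrow> norm (P h - P 0 - blinfun_apply A h) \<le> b * r;
       \<And>h. norm h \<le> r \<Longrightarrow> P h \<noteq> 0 \<Longrightarrow> normalized_pl (p - 2) A (P h) \<le> - c;
       \<exists>h. norm h \<le> r \<and> P h \<noteq> 0\<rbrakk> \<Longrightarrow>
      (P 0 + (2 * b) *\<^sub>R z \<noteq> 0 \<longrightarrow> normalized_pl (p - 2) A (P 0 + (2 * b) *\<^sub>R z) + 2 * b * (DIM('a) + (p - 2)) < 0)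
     \<and> (P 0 + (2 * b) *\<^sub>R z = 0 \<longrightarrow> trace_blinfun A + 2 * b * DIM('a) < 0)"
proof -
  define n where "n = real DIM('a)"
  have n: "n \<ge> 1" unfolding n_def using DIM_positive[where 'a='a] by linarith
  obtain \<gamma> \<kappa> C :: real where pos: "\<gamma> > 0" "\<kappa> > 0" "C > 0"
    and dich: "\<And>(A :: 'a::euclidean_space \<Rightarrow>\<^sub>L 'a) s lam e v. top_eigenvalue A s lam e \<Longrightarrow> p - 2 = s * \<bar>p - 2\<bar> \<Longrightarrow>
       v \<noteq> 0 \<Longrightarrow> normalized_pl (p - 2) A v \<le> - c \<Longrightarrow>
       (trace_blinfun A \<le> - \<gamma> \<and> (\<forall>w. w \<noteq> 0 \<longrightarrow> normalized_pl (p - 2) A w \<le> - \<gamma>)) \<or>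
       (\<kappa> \<le> lam \<and> top_eigenvalue.T A s lam \<le> C * lam)"
    using normalized_pl_dichotomy[OF p c, where 'a='a] by blast
  define a where "a = \<bar>p - 2\<bar>"
  define K where "K = 16 * a / c"
  define \<gamma>' where "\<gamma>' = min \<gamma> (c / 2)"
  have "\<gamma>' > 0" using pos c by (simp add: \<gamma>'_def)
  have ev: "\<forall>\<^sub>F b in at_right (0::real). f b < B" if "(f \<longlongrightarrow> 0) (at_right 0)" "B > 0" for f :: "real \<Rightarrow> real" and B
    using order_tendstoD(2)[OF that] .
  have "\<forall>\<^sub>F b in at_right (0::real). 0 < b \<and> (2 / \<kappa> + K * C) * b < 1 / 16 \<and> b < \<kappa> / 16 \<and> 72 * C * b\<^sup>2 / \<kappa> * a < c / 2
    \<and> 2 * b * (n + (p - 2)) < \<gamma>' \<and> 2 * b * n < \<gamma>'"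
    using pos c \<open>\<gamma>' > 0\<close> by (intro eventually_conj eventually_at_right_less ev) (auto intro!: tendsto_eq_intros)
  then have "\<exists>b. 0 < b \<and> (2 / \<kappa> + K * C) * b < 1 / 16 \<and> b < \<kappa> / 16 \<and> 72 * C * b\<^sup>2 / \<kappa> * a < c / 2
    \<and> 2 * b * (n + (p - 2)) < \<gamma>' \<and> 2 * b * n < \<gamma>'"
    using eventually_happens trivial_limit_at_right_real by blast
  then obtain b where b: "0 < b" "(2 / \<kappa> + K * C) * b \<le> 1 / 16" "b \<le> \<kappa> / 16" "72 * C * b\<^sup>2 / \<kappa> * a \<le> c / 2"
    and bg: "2 * b * (n + (p - 2)) < \<gamma>'" "2 * b * n < \<gamma>'"
    by (metis less_imp_le)
  show ?thesis
  proof (rule that[OF b(1)])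
    fix A :: "'a \<Rightarrow>\<^sub>L 'a" and P :: "'a \<Rightarrow> 'a" and z :: 'a and r :: real
    assume sym: "\<And>u v. u \<bullet> A v = v \<bullet> A u" and r: "0 < r" and z: "norm z \<le> r"
      and lin: "\<And>h. norm h \<le> r \<Longrightarrow> norm (P h - P 0 - A h) \<le> b * r"
      and known: "\<And>h. norm h \<le> r \<Longrightarrow> P h \<noteq> 0 \<Longrightarrow> normalized_pl (p - 2) A (P h) \<le> - c"
      and ex: "\<exists>h. norm h \<le> r \<and> P h \<noteq> 0"
    define s :: real where "s = (if p - 2 < 0 then -1 else 1)"
    have s: "s = 1 \<or> s = -1" and qs: "p - 2 = s * \<bar>p - 2\<bar>" by (auto simp: s_def)
    obtain lam e where te: "top_eigenvalue A s lam e"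
      using top_eigenvalue_exists[OF sym s] by blast
    interpret top_eigenvalue A s lam e by fact
    obtain h where h: "norm h \<le> r" "P h \<noteq> 0" using ex by blast
    let ?v = "P 0 + (2 * b) *\<^sub>R z"
    have "(?v \<noteq> 0 \<longrightarrow> normalized_pl (p - 2) A ?v \<le> - \<gamma>') \<and> (?v = 0 \<longrightarrow> trace_blinfun A \<le> - \<gamma>')"
      using dich[OF te qs h(2) known[OF h]]
    proof
      assume "trace_blinfun A \<le> - \<gamma> \<and> (\<forall>w. w \<noteq> 0 \<longrightarrow> normalized_pl (p - 2) A w \<le> - \<gamma>)"
      then show ?thesis by (fastforce simp: \<gamma>'_def min_def)
    next
      assume *: "\<kappa> \<le> lam \<and> T \<le> C * lam"
      have "(?v \<noteq> 0 \<longrightarrow> normalized_pl (p - 2) A ?v \<le> - c / 2) \<and> (?v = 0 \<longrightarrow> trace_blinfun A \<le> - c / 2)"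
        by (rule normalized_pl_perturbation[where a=a and \<kappa>=\<kappa> and C=C and K=K and r=r])
          (use qs c r b * pos z lin known in \<open>auto simp: a_def K_def\<close>)
      then show ?thesis by (fastforce simp: \<gamma>'_def min_def)
    qed
    then show "(?v \<noteq> 0 \<longrightarrow> normalized_pl (p - 2) A ?v + 2 * b * (DIM('a) + (p - 2)) < 0)
     \<and> (?v = 0 \<longrightarrow> trace_blinfun A + 2 * b * DIM('a) < 0)"
      using bg by (fastforce simp: n_def)
  qed
qed

section \<open>Gradients and Hessians\<close>

lemma grad_inner:
  fixes f :: "'a::euclidean_space \<Rightarrow> real"
  assumes "f differentiable (at x)"
  shows "frechet_derivative f (at x) h = grad f x \<bullet> h"
proof -
  interpret linear "frechet_derivative f (at x)"
    using assms by (rule linear_frechet_derivative)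
  have "frechet_derivative f (at x) h = frechet_derivative f (at x) (\<Sum>b\<in>Basis. (h \<bullet> b) *\<^sub>R b)"
    by (simp add: euclidean_representation)
  also have "\<dots> = grad f x \<bullet> h"
    by (simp add: sum scale grad_def inner_sum_left inner_commute[of h] mult.commute)
  finally show ?thesis .
qed

lemma has_derivative_grad:
  fixes f :: "'a::euclidean_space \<Rightarrow> real"
  assumes "f differentiable (at x)"
  shows "(f has_derivative (\<lambda>h. grad f x \<bullet> h)) (at x)"
  using assms grad_inner[OF assms] by (metis (no_types, lifting) ext frechet_derivative_works)

lemma grad_unique:
  fixes f :: "'a::euclidean_space \<Rightarrow> real"
  assumes "(f has_derivative (\<lambda>h. v \<bullet> h)) (at x)"
  shows "f differentiable (at x)" "grad f x = v"
proof -
  have "frechet_derivative f (at x) = (\<lambda>h. v \<bullet> h)"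
    using assms by (metis frechet_derivative_at)
  then show "grad f x = v"
    by (simp add: grad_def euclidean_representation)
  show "f differentiable (at x)" using assms by (auto simp: differentiable_def)
qed

lemma grad_eqI_open:
  fixes f g :: "'a::euclidean_space \<Rightarrow> real"
  assumes "open S" "x \<in> S" "\<And>y. y \<in> S \<Longrightarrow> f y = g y" "g differentiable (at x)"
  shows "f differentiable (at x)" "grad f x = grad g x"
proof -
  have "(f has_derivative (\<lambda>h. grad g x \<bullet> h)) (at x)"
    using has_derivative_transform_within_open[OF has_derivative_grad[OF assms(4)] assms(1,2)] assms(3) by metis
  then show "f differentiable (at x)" "grad f x = grad g x"
    using grad_unique by blast+
qed

lemma hess_has_derivative:
  fixes f :: "'a::euclidean_space \<Rightarrow> real"
  assumes "grad f differentiable (at x)"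
  shows "(grad f has_derivative hess f x) (at x)"
  using assms frechet_derivative_works[of "grad f" "at x"]
  unfolding hess_def by (metis bounded_linear_Blinfun_apply has_derivative_bounded_linear)

lemma hess_unique:
  fixes f :: "'a::euclidean_space \<Rightarrow> real"
  assumes "(grad f has_derivative blinfun_apply A) (at x)"
  shows "hess f x = A"
  using frechet_derivative_at[OF assms] unfolding hess_def by (metis blinfun_apply_inverse)

text \<open>The mean value theorem in direction \<open>u\<close> reduces the second difference to a
  difference of two gradients near \<open>x\<close>, and both are expanded at \<open>x\<close>.
  Differentiability of the gradient at that single point is enough, and since the second difference
  is symmetric in \<open>u\<close> and \<open>v\<close>, so is the Hessian.\<close>

lemma second_difference_approximation:
  fixes f :: "'a::euclidean_space \<Rightarrow> real"
  assumes d1: "0 < d1" "\<And>y. y \<in> ball x d1 \<Longrightarrow> f differentiable (at y)"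
    and d2: "grad f differentiable (at x)"
    and e: "0 < e"
  obtains d where "0 < d" "\<And>t. 0 < t \<Longrightarrow> t < d \<Longrightarrow>
    \<bar>f (x + t *\<^sub>R u + t *\<^sub>R v) - f (x + t *\<^sub>R u) - f (x + t *\<^sub>R v) + f x - t\<^sup>2 * (u \<bullet> hess f x v)\<bar> \<le> e * t\<^sup>2"
proof -
  define A where "A = hess f x"
  define M where "M = norm u + norm v + 1"
  have M: "M \<ge> 1" "norm u \<le> M" "norm u + norm v \<le> M" by (auto simp: M_def)
  \<comment> \<open>Two remainders of size \<open>e' * (t * M)\<close>, paired with a vector of norm
    at most \<open>M\<close>, add up to \<open>2 / 3 * e * t\<close>.\<close>
  define e' where "e' = e / (3 * M * M)"
  have e': "e' > 0" using e M by (simp add: e'_def)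
  obtain d3 where d3: "d3 > 0" "\<And>y. norm (y - x) < d3 \<Longrightarrow> norm (grad f y - grad f x - A (y - x)) \<le> e' * norm (y - x)"
    using hess_has_derivative[OF d2] e' unfolding A_def has_derivative_at_alt by blast
  define d where "d = min d1 d3 / (2 * M)"
  show ?thesis
  proof
    show "0 < d" using d1 d3 M by (simp add: d_def)
    fix t :: real assume t: "0 < t" "t < d"
    have tM: "t * M < min d1 d3"
    proof -
      have "t * (2 * M) < min d1 d3" using t M by (simp add: d_def less_divide_eq)
      moreover have "0 < t * M" using t M by simp
      ultimately show ?thesis by linarith
    qed
    have nrm: "norm (s *\<^sub>R u + r *\<^sub>R v) \<le> t * M" if "0 \<le> s" "s \<le> t" "0 \<le> r" "r \<le> t" for s r
    proof -
      have "norm (s *\<^sub>R u + r *\<^sub>R v) \<le> s * norm u + r * norm v"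
        using norm_triangle_ineq[of "s *\<^sub>R u" "r *\<^sub>R v"] that by simp
      also have "\<dots> \<le> t * norm u + t * norm v" using that by (intro add_mono mult_right_mono) auto
      also have "\<dots> \<le> t * M" using t M(3) by (simp add: distrib_left[symmetric])
      finally show ?thesis .
    qed
    define F where "F s = f (x + s *\<^sub>R u + t *\<^sub>R v) - f (x + s *\<^sub>R u)" for s
    define F' where "F' s = (grad f (x + s *\<^sub>R u + t *\<^sub>R v) - grad f (x + s *\<^sub>R u)) \<bullet> u" for s
    have D: "((\<lambda>s. f (x + s *\<^sub>R u + w)) has_real_derivative grad f (x + s *\<^sub>R u + w) \<bullet> u) (at s)"
      if "x + s *\<^sub>R u + w \<in> ball x d1" for s w
    proof -
      have "((\<lambda>s. x + s *\<^sub>R u + w) has_derivative (\<lambda>h. h *\<^sub>R u)) (at s)"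
        by (auto intro!: derivative_eq_intros)
      from has_derivative_compose[OF this has_derivative_grad[OF d1(2)[OF that]]]
      show ?thesis unfolding has_field_derivative_def
        by (rule has_derivative_eq_rhs) (simp add: fun_eq_iff)
    qed
    have "(F has_real_derivative F' s) (at s)" if "0 \<le> s" "s \<le> t" for s
    proof -
      have "x + s *\<^sub>R u + t *\<^sub>R v \<in> ball x d1" "x + s *\<^sub>R u + 0 \<in> ball x d1"
        using nrm[of s t] nrm[of s 0] that t tM by (auto simp: dist_norm norm_minus_commute algebra_simps)
      from DERIV_diff[OF D[OF this(1)] D[OF this(2)]] show ?thesis
        unfolding F_def F'_def by (simp add: inner_diff_left)
    qed
    then obtain s where s: "0 < s" "s < t" "F t - F 0 = t * F' s"
      using MVT2[of 0 t F F'] t by auto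
    define R where "R y = grad f y - grad f x - A (y - x)" for y
    have R: "norm (R (x + s *\<^sub>R u + r *\<^sub>R v)) \<le> e' * (t * M)" if "0 \<le> r" "r \<le> t" for r
    proof -
      have "norm (R (x + s *\<^sub>R u + r *\<^sub>R v)) \<le> e' * norm (s *\<^sub>R u + r *\<^sub>R v)"
        using d3(2)[of "x + s *\<^sub>R u + r *\<^sub>R v"] nrm[of s r] that s tM by (simp add: R_def algebra_simps)
      also have "\<dots> \<le> e' * (t * M)" using nrm[of s r] that s e' by (intro mult_left_mono) auto
      finally show ?thesis .
    qed
    have "F' s = (R (x + s *\<^sub>R u + t *\<^sub>R v) - R (x + s *\<^sub>R u + 0 *\<^sub>R v) + t *\<^sub>R A v) \<bullet> u"
      unfolding F'_def R_def by (simp add: blinfun.add_right blinfun.diff_right blinfun.scaleR_right algebra_simps)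
    then have eq: "F' s - t * (u \<bullet> A v) = (R (x + s *\<^sub>R u + t *\<^sub>R v) - R (x + s *\<^sub>R u + 0 *\<^sub>R v)) \<bullet> u"
      by (simp add: inner_add_right inner_commute)
    have "\<bar>F' s - t * (u \<bullet> A v)\<bar> \<le> (e' * (t * M) + e' * (t * M)) * M"
      unfolding eq using R[of t] R[of 0] t M e'
      by (intro order_trans[OF Cauchy_Schwarz_ineq2] mult_mono order_trans[OF norm_triangle_ineq4] add_mono) auto
    also have "\<dots> \<le> e * t" using e M t by (simp add: e'_def)
    finally have "t * \<bar>F' s - t * (u \<bullet> A v)\<bar> \<le> t * (e * t)" using t by (intro mult_left_mono) auto
    then have "\<bar>t * F' s - t * (t * (u \<bullet> A v))\<bar> \<le> t * (e * t)"
      using t by (simp add: abs_mult right_diff_distrib[symmetric])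
    moreover have "f (x + t *\<^sub>R u + t *\<^sub>R v) - f (x + t *\<^sub>R u) - f (x + t *\<^sub>R v) + f x = t * F' s"
      using s(3) by (simp add: F_def)
    ultimately show "\<bar>f (x + t *\<^sub>R u + t *\<^sub>R v) - f (x + t *\<^sub>R u) - f (x + t *\<^sub>R v) + f x - t\<^sup>2 * (u \<bullet> hess f x v)\<bar> \<le> e * t\<^sup>2"
      by (simp add: A_def power2_eq_square mult_ac)
  qed
qed

lemma hess_symmetric:
  fixes f :: "'a::euclidean_space \<Rightarrow> real"
  assumes "open S" "x \<in> S" "\<And>y. y \<in> S \<Longrightarrow> f differentiable (at y)" "grad f differentiable (at x)"
  shows "u \<bullet> hess f x v = v \<bullet> hess f x u"
proof -
  obtain d1 where d1: "d1 > 0" "ball x d1 \<subseteq> S" using assms(1,2) openE by blast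
  have "\<bar>u \<bullet> hess f x v - v \<bullet> hess f x u\<bar> \<le> 2 * e" if e: "e > 0" for e
  proof -
    obtain d where d: "0 < d" "\<And>t. 0 < t \<Longrightarrow> t < d \<Longrightarrow>
      \<bar>f (x + t *\<^sub>R u + t *\<^sub>R v) - f (x + t *\<^sub>R u) - f (x + t *\<^sub>R v) + f x - t\<^sup>2 * (u \<bullet> hess f x v)\<bar> \<le> e * t\<^sup>2"
      using second_difference_approximation[of d1 x f e u v] d1 assms e by blast
    obtain d' where d': "0 < d'" "\<And>t. 0 < t \<Longrightarrow> t < d' \<Longrightarrow>
      \<bar>f (x + t *\<^sub>R v + t *\<^sub>R u) - f (x + t *\<^sub>R v) - f (x + t *\<^sub>R u) + f x - t\<^sup>2 * (v \<bullet> hess f x u)\<bar> \<le> e * t\<^sup>2"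
      using second_difference_approximation[of d1 x f e v u] d1 assms e by blast
    define t where "t = min d d' / 2"
    have t: "0 < t" "t < d" "t < d'" using d d' by (auto simp: t_def)
    have "\<bar>t\<^sup>2 * (u \<bullet> hess f x v) - t\<^sup>2 * (v \<bullet> hess f x u)\<bar> \<le> 2 * (e * t\<^sup>2)"
      using d(2)[OF t(1,2)] d'(2)[OF t(1,3)] by (simp add: add_ac)
    then have "t\<^sup>2 * \<bar>u \<bullet> hess f x v - v \<bullet> hess f x u\<bar> \<le> t\<^sup>2 * (2 * e)"
      by (simp add: right_diff_distrib[symmetric] abs_mult mult_ac)
    then show ?thesis using t by simp
  qed
  \<comment> \<open>With \<open>e\<close> a quarter of the discrepancy, the discrepancy is at most
    half of itself.\<close>
  from this[of "\<bar>u \<bullet> hess f x v - v \<bullet> hess f x u\<bar> / 4"] show ?thesis by force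
qed

text \<open>At \<open>\<delta> = 0\<close> this is the flux of the p-Laplacian; \<open>\<delta> > 0\<close> regularizes it at critical points.\<close>

definition reg_flux :: "real \<Rightarrow> real \<Rightarrow> 'a::euclidean_space \<Rightarrow> 'a" where
  "reg_flux q \<delta> v = (v \<bullet> v + \<delta>) powr (q / 2) *\<^sub>R v"

lemma p_flux_eq_reg_flux: "p_flux p v = reg_flux (p - 2) 0 v"
  by (cases "v = 0") (auto simp: p_flux_def reg_flux_def norm_eq_sqrt_inner powr_half_sqrt[symmetric] powr_powr mult.commute)

section \<open>Derivative and divergence of the regularized flux\<close>

lemma reg_flux_has_derivative:
  assumes "v \<bullet> v + \<delta> > 0"
  shows "(reg_flux q \<delta> has_derivative (\<lambda>h. (v \<bullet> v + \<delta>) powr (q / 2) *\<^sub>R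
     (h + (q * (v \<bullet> h) / (v \<bullet> v + \<delta>)) *\<^sub>R v))) (at v)"
proof -
  have "((\<lambda>v. v \<bullet> v + \<delta>) has_derivative (\<lambda>h. 2 * (v \<bullet> h))) (at v)"
    by (auto intro!: derivative_eq_intros simp: inner_commute)
  moreover have "((\<lambda>t. t powr (q / 2)) has_derivative (\<lambda>h. h * (q / 2 * (v \<bullet> v + \<delta>) powr (q / 2 - 1)))) (at (v \<bullet> v + \<delta>))"
    using has_real_derivative_powr[OF assms, of "q / 2"] unfolding has_field_derivative_def
    by (rule has_derivative_eq_rhs) (simp add: fun_eq_iff)
  ultimately have "((\<lambda>v. (v \<bullet> v + \<delta>) powr (q / 2)) has_derivative
     (\<lambda>h. 2 * (v \<bullet> h) * (q / 2 * (v \<bullet> v + \<delta>) powr (q / 2 - 1)))) (at v)"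
    by (rule has_derivative_compose)
  note D = has_derivative_scaleR[OF this has_derivative_ident]
  have "2 * t * (q / 2 * X powr (q / 2 - 1)) = X powr (q / 2) * (q * t / X)" if "X > 0" for t X :: real
    using that by (simp add: powr_diff)
  from D this[OF assms] show ?thesis
    unfolding reg_flux_def by (simp add: scaleR_add_right)
qed

lemma divergence_reg_flux:
  fixes f :: "'a::euclidean_space \<Rightarrow> real"
  assumes "grad f differentiable (at x)" "grad f x \<bullet> grad f x + \<delta> > 0"
  shows "((\<lambda>y. reg_flux q \<delta> (grad f y)) has_derivative (\<lambda>h. (grad f x \<bullet> grad f x + \<delta>) powr (q / 2) *\<^sub>R
     (hess f x h + (q * (grad f x \<bullet> hess f x h) / (grad f x \<bullet> grad f x + \<delta>)) *\<^sub>R grad f x))) (at x)"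
    and "(\<Sum>b\<in>Basis. ((grad f x \<bullet> grad f x + \<delta>) powr (q / 2) *\<^sub>R
     (hess f x b + (q * (grad f x \<bullet> hess f x b) / (grad f x \<bullet> grad f x + \<delta>)) *\<^sub>R grad f x)) \<bullet> b) =
     (grad f x \<bullet> grad f x + \<delta>) powr (q / 2) *
     (trace_blinfun (hess f x) + q * (grad f x \<bullet> hess f x (grad f x)) / (grad f x \<bullet> grad f x + \<delta>))"
proof -
  show "((\<lambda>y. reg_flux q \<delta> (grad f y)) has_derivative (\<lambda>h. (grad f x \<bullet> grad f x + \<delta>) powr (q / 2) *\<^sub>R
     (hess f x h + (q * (grad f x \<bullet> hess f x h) / (grad f x \<bullet> grad f x + \<delta>)) *\<^sub>R grad f x))) (at x)"
    by (rule has_derivative_compose[OF hess_has_derivative[OF assms(1)] reg_flux_has_derivative[OF assms(2)]])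
  let ?g = "grad f x" and ?A = "hess f x"
  have "?g \<bullet> ?A ?g = ?g \<bullet> ?A (\<Sum>b\<in>Basis. (?g \<bullet> b) *\<^sub>R b)" by (simp add: euclidean_representation)
  also have "\<dots> = (\<Sum>b\<in>Basis. (?g \<bullet> b) * (?g \<bullet> ?A b))"
    by (simp add: blinfun.sum_right blinfun.scaleR_right inner_sum_right)
  finally have *: "?g \<bullet> ?A ?g = (\<Sum>b\<in>Basis. (?g \<bullet> b) * (?g \<bullet> ?A b))" .
  show "(\<Sum>b\<in>Basis. ((?g \<bullet> ?g + \<delta>) powr (q / 2) *\<^sub>R (?A b + (q * (?g \<bullet> ?A b) / (?g \<bullet> ?g + \<delta>)) *\<^sub>R ?g)) \<bullet> b) =
     (?g \<bullet> ?g + \<delta>) powr (q / 2) * (trace_blinfun ?A + q * (?g \<bullet> ?A ?g) / (?g \<bullet> ?g + \<delta>))"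
    unfolding * trace_blinfun_def
    by (simp add: inner_add_left sum.distrib distrib_left sum_distrib_left sum_distrib_right sum_divide_distrib mult_ac)
qed

text \<open>Away from critical points the regularization parameter may be 0, so the divergence
  formula applies to the flux itself. This translates the hypothesis on the obstacle into the
  algebraic operator \<open>normalized_pl\<close>.\<close>

lemma p_laplacian_eq:
  fixes f :: "'a::euclidean_space \<Rightarrow> real"
  assumes "grad f differentiable (at x)" "grad f x \<noteq> 0"
  shows "norm (grad f x) powr (2 - p) * p_laplacian p f x = normalized_pl (p - 2) (hess f x) (grad f x)"
proof -
  have pos: "grad f x \<bullet> grad f x + 0 > 0" using assms by simp
  have "(\<lambda>y. p_flux p (grad f y)) = (\<lambda>y. reg_flux (p - 2) 0 (grad f y))"
    by (simp add: p_flux_eq_reg_flux)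
  then have "p_laplacian p f x = (grad f x \<bullet> grad f x) powr ((p - 2) / 2) * normalized_pl (p - 2) (hess f x) (grad f x)"
    unfolding p_laplacian_def divergence_def
    using frechet_derivative_at[OF divergence_reg_flux(1)[OF assms(1) pos, of "p-2"], symmetric]
      divergence_reg_flux(2)[OF assms(1) pos, of "p-2"]
    by (simp add: normalized_pl_def)
  moreover have "norm (grad f x) powr (2 - p) * (grad f x \<bullet> grad f x) powr ((p - 2) / 2) = 1"
    using assms(2) by (simp add: norm_eq_sqrt_inner powr_half_sqrt[symmetric] powr_powr powr_add[symmetric] algebra_simps diff_divide_distrib)
  ultimately show ?thesis by (simp add: mult.assoc[symmetric])
qed

section \<open>Weak supersolutions of class C2\<close>

lemma C1cD:
  assumes "\<zeta> \<in> C1c \<Omega>"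
  shows "\<zeta> differentiable (at x)" "continuous_on UNIV (grad \<zeta>)" "compact (closure {x. \<zeta> x \<noteq> 0})"
    "closure {x. \<zeta> x \<noteq> 0} \<subseteq> \<Omega>" "continuous_on UNIV \<zeta>"
proof -
  show "\<zeta> differentiable (at x)" "continuous_on UNIV (grad \<zeta>)" "compact (closure {x. \<zeta> x \<noteq> 0})"
    "closure {x. \<zeta> x \<noteq> 0} \<subseteq> \<Omega>"
    using assms by (auto simp: C1c_def)
  have "isCont \<zeta> y" for y
    using assms by (auto simp: C1c_def intro: differentiable_imp_continuous_within)
  then show "continuous_on UNIV \<zeta>" by (simp add: continuous_at_imp_continuous_on)
qed

lemma C1c_grad_eq_0:
  assumes "\<zeta> \<in> C1c \<Omega>" "x \<notin> closure {x. \<zeta> x \<noteq> 0}"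
  shows "\<zeta> x = 0" "grad \<zeta> x = 0"
proof -
  define K where "K = closure {x. \<zeta> x \<noteq> 0}"
  have Z: "\<zeta> y = 0" if "y \<in> - K" for y
    using that closure_subset[of "{x. \<zeta> x \<noteq> 0}"] unfolding K_def by auto
  have x: "x \<in> - K" using assms(2) by (simp add: K_def)
  then show "\<zeta> x = 0" using Z by simp
  have "open (- K)" by (simp add: K_def open_Compl)
  then have "grad \<zeta> x = grad (\<lambda>_. 0) x"
    using x Z by (rule grad_eqI_open(2)) auto
  also have "grad (\<lambda>_. 0 :: real) x = 0"
    by (rule grad_unique) simp
  finally show "grad \<zeta> x = 0" .
qed

text \<open>\<open>U\<close> and the complement of \<open>E\<close> are open and cover the space, so
  the two local descriptions glue. Test functions can thus be built from functions that are
  differentiable only near their support.\<close>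

lemma C1c_I:
  fixes f :: "'a::euclidean_space \<Rightarrow> real"
  assumes "open U" "compact E" "E \<subseteq> U" "E \<subseteq> \<Omega>"
    and diff: "\<And>x. x \<in> U \<Longrightarrow> f differentiable (at x)" and cont: "continuous_on U (grad f)"
    and zero: "\<And>x. x \<notin> E \<Longrightarrow> f x = 0"
  shows "f \<in> C1c \<Omega>"
proof -
  have op: "open (- E)" using assms(2) by (simp add: compact_imp_closed open_Compl)
  have "f differentiable (at x) \<and> grad f x = grad (\<lambda>_. 0) x" if "x \<in> - E" for x
    using grad_eqI_open[OF op that, of f "\<lambda>_. 0"] zero by auto
  moreover have "grad (\<lambda>_. 0 :: real) x = 0" for x :: 'a
    by (rule grad_unique) simp
  ultimately have out: "f differentiable (at x)" "grad f x = 0" if "x \<in> - E" for x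
    using that by auto
  have "continuous_on (- E) (grad f)"
    using out(2) by (subst continuous_on_cong[OF refl, of _ _ "\<lambda>_. 0"]) auto
  then have "continuous_on (U \<union> - E) (grad f)"
    using cont assms(1) op by (intro continuous_on_open_Un)
  moreover have "U \<union> - E = UNIV" using assms(3) by blast
  moreover have sub: "closure {x. f x \<noteq> 0} \<subseteq> E"
    using zero assms(2) by (intro closure_minimal) (auto simp: compact_imp_closed)
  moreover have "compact (closure {x. f x \<noteq> 0})"
    using compact_Int_closed[OF assms(2) closed_closure[of "{x. f x \<noteq> 0}"]] sub by (simp add: inf_absorb2)
  moreover have "f differentiable (at x)" for x
    using diff out(1) assms(3) by blast
  ultimately show ?thesis using assms(4) by (auto simp: C1c_def)
qed

lemma C1c_mono: "\<zeta> \<in> C1c \<Omega> \<Longrightarrow> \<Omega> \<subseteq> \<Omega>' \<Longrightarrow> \<zeta> \<in> C1c \<Omega>'"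
  by (auto simp: C1c_def)

section \<open>Integration by parts for test functions\<close>

lemma lborel_integral_translate:
  fixes f :: "'a::euclidean_space \<Rightarrow> 'b::euclidean_space"
  assumes "f \<in> borel_measurable borel"
  shows "(LINT x|lborel. f (x + c)) = (LINT x|lborel. f x)"
    and "integrable lborel (\<lambda>x. f (x + c)) \<longleftrightarrow> integrable lborel f"
  using integral_distr[of "(+) c" lborel borel f] integrable_distr_eq[of "(+) c" lborel borel f] assms
  by (simp_all add: lborel_distr_plus add.commute)

lemma integrable_compact_support:
  fixes f :: "'a::euclidean_space \<Rightarrow> 'b::euclidean_space"
  assumes "compact E" "continuous_on E f" "\<And>x. x \<notin> E \<Longrightarrow> f x = 0"
  shows "integrable lborel f"
proof -
  have "integrable lborel (\<lambda>x. indicator E x *\<^sub>R f x)"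
    using borel_integrable_compact[OF assms(1,2)] .
  moreover have "(\<lambda>x. indicator E x *\<^sub>R f x) = f"
    using assms(3) by (auto simp: fun_eq_iff indicator_def)
  ultimately show ?thesis by simp
qed

text \<open>Difference quotients have integral 0 by translation invariance, and they converge to the
  directional derivative under a common bound given by the Lipschitz constant.\<close>

lemma integral_grad_eq_0:
  fixes f :: "'a::euclidean_space \<Rightarrow> real"
  assumes f: "f \<in> C1c UNIV"
  shows "(LINT x|lborel. grad f x \<bullet> e) = 0"
proof -
  define K where "K = closure {x. f x \<noteq> 0}"
  \<comment> \<open>The steps \<open>d k *\<^sub>R e\<close> are no longer than
    \<open>norm e\<close>, so this enlargement of the support contains the supports of all
    difference quotients.\<close>
  define K1 where "K1 = {x + y |x y. x \<in> K \<and> y \<in> cball 0 (norm e)}"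
  have K: "compact K" using C1cD(3)[OF f] by (simp add: K_def)
  have K1: "compact K1" unfolding K1_def using compact_sums[OF K compact_cball] .
  have f0: "f x = 0" if "x \<notin> K" for x by (rule C1c_grad_eq_0[OF f that[unfolded K_def]])
  have g0: "grad f x = 0" if "x \<notin> K" for x by (rule C1c_grad_eq_0[OF f that[unfolded K_def]])
  have contf: "continuous_on UNIV f" and contg: "continuous_on UNIV (grad f)"
    by (rule C1cD[OF f])+
  have [measurable]: "f \<in> borel_measurable borel" "grad f \<in> borel_measurable borel"
    using contf contg by (auto intro: borel_measurable_continuous_onI)
  have "bounded (grad f ` K)"
    using K contg by (intro compact_imp_bounded compact_continuous_image) (auto elim: continuous_on_subset)
  then obtain B where B: "B > 0" "\<And>x. x \<in> K \<Longrightarrow> norm (grad f x) \<le> B"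
    unfolding bounded_pos by auto
  have B': "norm (grad f x) \<le> B" for x using B g0[of x] by (cases "x \<in> K") auto
  have lip: "norm (f x - f y) \<le> B * norm (x - y)" for x y
  proof (rule differentiable_bound[of UNIV f "\<lambda>x h. grad f x \<bullet> h"])
    show "onorm (\<lambda>h. grad f x \<bullet> h) \<le> B" for x
      using B' by (intro onorm_le) (auto intro!: order_trans[OF Cauchy_Schwarz_ineq2] mult_right_mono)
  qed (use C1cD(1)[OF f] in \<open>auto intro: has_derivative_grad\<close>)
  define d where "d = (\<lambda>k. 1 / real (Suc k))"
  define s where "s k x = (f (x + d k *\<^sub>R e) - f x) / d k" for k x
  have d: "0 < d k" "d k \<le> 1" for k by (auto simp: d_def)
  have "integrable lborel f" using K f0 contf by (intro integrable_compact_support[of K]) (auto elim: continuous_on_subset)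
  then have int0: "(LINT x|lborel. s k x) = 0" for k
    unfolding s_def using lborel_integral_translate[of f "d k *\<^sub>R e"] by simp
  have "(\<lambda>k. LINT x|lborel. s k x) \<longlonglongrightarrow> (LINT x|lborel. grad f x \<bullet> e)"
  proof (rule integral_dominated_convergence[where w = "\<lambda>x. indicator K1 x *\<^sub>R (B * norm e)"])
    show "integrable lborel (\<lambda>x. indicator K1 x *\<^sub>R (B * norm e))"
      using K1 by (intro borel_integrable_compact) auto
    show "AE x in lborel. (\<lambda>k. s k x) \<longlonglongrightarrow> grad f x \<bullet> e"
    proof (intro AE_I2)
      fix x
      have "((\<lambda>t. f (x + t *\<^sub>R e)) has_real_derivative grad f x \<bullet> e) (at 0)"
      proof -
        have 1: "((\<lambda>t. x + t *\<^sub>R e) has_derivative (\<lambda>h. h *\<^sub>R e)) (at 0)"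
          by (auto intro!: derivative_eq_intros)
        have 2: "(f has_derivative (\<lambda>h. grad f x \<bullet> h)) (at (x + 0 *\<^sub>R e))"
          using C1cD(1)[OF f, of x] has_derivative_grad by simp
        from has_derivative_compose[OF 1 2] show ?thesis
          unfolding has_field_derivative_def by (rule has_derivative_eq_rhs) (simp add: fun_eq_iff)
      qed
      then have "(\<lambda>t. (f (x + t *\<^sub>R e) - f x) / t) \<midarrow>0\<rightarrow> grad f x \<bullet> e"
        by (simp add: DERIV_def)
      moreover have "filterlim d (at 0) sequentially"
        unfolding filterlim_at using d LIMSEQ_inverse_real_of_nat
        by (auto simp: d_def inverse_eq_divide less_imp_neq)
      ultimately show "(\<lambda>k. s k x) \<longlonglongrightarrow> grad f x \<bullet> e"
        unfolding s_def by (rule filterlim_compose)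
    qed
    show "AE x in lborel. norm (s k x) \<le> indicator K1 x *\<^sub>R (B * norm e)" for k
    proof (intro AE_I2)
      fix x
      show "norm (s k x) \<le> indicator K1 x *\<^sub>R (B * norm e)"
      proof (cases "x \<in> K1")
        case True
        have "norm (s k x) \<le> B * norm (d k *\<^sub>R e) / d k"
          unfolding s_def using lip[of "x + d k *\<^sub>R e" x] d[of k] by (simp add: divide_le_eq mult_ac)
        then show ?thesis using True d[of k] by simp
      next
        case False
        have "x \<notin> K" using False by (auto simp: K1_def intro!: exI[of _ x] exI[of _ 0])
        moreover have "x + d k *\<^sub>R e \<notin> K"
        proof
          assume "x + d k *\<^sub>R e \<in> K"
          moreover have "- (d k *\<^sub>R e) \<in> cball 0 (norm e)"
            using d[of k] by (simp add: mult_left_le_one_le)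
          ultimately have "x + d k *\<^sub>R e + - (d k *\<^sub>R e) \<in> K1" unfolding K1_def by blast
          then show False using False by simp
        qed
        ultimately show ?thesis using f0 False by (simp add: s_def)
      qed
    qed
  qed (auto simp: s_def)
  then show ?thesis using int0 by (simp add: LIMSEQ_const_iff)
qed

lemma grad_eq_sum:
  assumes "(f has_derivative f') (at x)"
  shows "grad f x = (\<Sum>b\<in>Basis. f' b *\<^sub>R b)"
  using frechet_derivative_at[OF assms] by (simp add: grad_def)

text \<open>In each basis direction the product \<open>\<zeta> * (F \<bullet> b)\<close> is itself a
  test function, although \<open>F\<close> is C1 only on \<open>D\<close>; its partial derivative
  has integral 0, and the product rule splits it into the two sides.\<close>

lemma integral_by_parts:
  fixes F :: "'a::euclidean_space \<Rightarrow> 'a"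
  assumes "open D" and F: "\<And>x. x \<in> D \<Longrightarrow> (F has_derivative F' x) (at x)"
    and contF': "\<And>b. b \<in> Basis \<Longrightarrow> continuous_on D (\<lambda>x. F' x b)"
    and \<zeta>: "\<zeta> \<in> C1c D"
  shows "(LINT x|lborel. F x \<bullet> grad \<zeta> x) = - (LINT x|lborel. \<zeta> x * (\<Sum>b\<in>Basis. F' x b \<bullet> b))"
proof -
  define E where "E = closure {x. \<zeta> x \<noteq> 0}"
  have E: "compact E" "E \<subseteq> D" using C1cD(3,4)[OF \<zeta>] by (simp_all add: E_def)
  have zero: "\<zeta> x = 0" "grad \<zeta> x = 0" if "x \<notin> E" for x
    by (rule C1c_grad_eq_0[OF \<zeta> that[unfolded E_def]])+
  have contF: "continuous_on D F"
    using F by (meson continuous_at_imp_continuous_on has_derivative_continuous)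
  have cont\<zeta>: "continuous_on S \<zeta>" "continuous_on S (grad \<zeta>)" for S
    using C1cD(2,5)[OF \<zeta>] continuous_on_subset by blast+
  have int1: "integrable lborel (\<lambda>x. (F x \<bullet> b) * (grad \<zeta> x \<bullet> b))" for b
    using E zero by (intro integrable_compact_support[of E])
      (auto intro!: continuous_intros cont\<zeta> continuous_on_subset[OF contF])
  have int2: "integrable lborel (\<lambda>x. \<zeta> x * (F' x b \<bullet> b))" if "b \<in> Basis" for b
    using E zero that by (intro integrable_compact_support[of E])
      (auto intro!: continuous_intros cont\<zeta> continuous_on_subset[OF contF'])
  have parts: "(LINT x|lborel. (F x \<bullet> b) * (grad \<zeta> x \<bullet> b)) = - (LINT x|lborel. \<zeta> x * (F' x b \<bullet> b))"
    if b: "b \<in> Basis" for b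
  proof -
    define g where "g x = \<zeta> x * (F x \<bullet> b)" for x
    have g': "(g has_derivative (\<lambda>h. \<zeta> x * (F' x h \<bullet> b) + (grad \<zeta> x \<bullet> h) * (F x \<bullet> b))) (at x)" if "x \<in> D" for x
      unfolding g_def using F[OF that] C1cD(1)[OF \<zeta>]
      by (intro has_derivative_mult has_derivative_grad has_derivative_inner_left) auto
    have gg: "grad g x = (\<Sum>i\<in>Basis. (\<zeta> x * (F' x i \<bullet> b) + (grad \<zeta> x \<bullet> i) * (F x \<bullet> b)) *\<^sub>R i)" if "x \<in> D" for x
      using grad_eq_sum[OF g'[OF that]] .
    have "continuous_on D (grad g)"
      by (subst continuous_on_cong[OF refl gg]) (auto intro!: continuous_intros cont\<zeta> contF contF')
    then have "g \<in> C1c UNIV"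
      using E g' zero assms(1) by (intro C1c_I[of D E]) (auto simp: differentiable_def g_def)
    then have "0 = (LINT x|lborel. grad g x \<bullet> b)" by (simp add: integral_grad_eq_0)
    also have "\<dots> = (LINT x|lborel. \<zeta> x * (F' x b \<bullet> b) + (F x \<bullet> b) * (grad \<zeta> x \<bullet> b))"
    proof (rule Bochner_Integration.integral_cong[OF refl])
      fix x
      show "grad g x \<bullet> b = \<zeta> x * (F' x b \<bullet> b) + (F x \<bullet> b) * (grad \<zeta> x \<bullet> b)"
      proof (cases "x \<in> E")
        case True
        then show ?thesis using gg[of x] b E
          by (simp add: subset_iff inner_sum_left inner_Basis mult.commute if_distrib sum.If_cases cong: if_cong)
      next
        case False
        have "g y = 0" if "y \<in> - E" for y using zero that by (simp add: g_def)
        then have "grad g x = grad (\<lambda>_. 0) x"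
          using E False by (intro grad_eqI_open(2)[of "- E"]) (auto simp: compact_imp_closed open_Compl)
        also have "\<dots> = 0" by (rule grad_unique) simp
        finally show ?thesis using zero[OF False] by simp
      qed
    qed
    also have "\<dots> = (LINT x|lborel. \<zeta> x * (F' x b \<bullet> b)) + (LINT x|lborel. (F x \<bullet> b) * (grad \<zeta> x \<bullet> b))"
      using int1 int2[OF b] by simp
    finally show ?thesis by simp
  qed
  have "F x \<bullet> grad \<zeta> x = (\<Sum>b\<in>Basis. (F x \<bullet> b) * (grad \<zeta> x \<bullet> b))" for x
    by (rule euclidean_inner)
  then have "(LINT x|lborel. F x \<bullet> grad \<zeta> x) = (\<Sum>b\<in>Basis. LINT x|lborel. (F x \<bullet> b) * (grad \<zeta> x \<bullet> b))"
    by (simp add: int1)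
  also have "\<dots> = - (\<Sum>b\<in>Basis. LINT x|lborel. \<zeta> x * (F' x b \<bullet> b))"
    by (simp add: parts sum_negf)
  also have "\<dots> = - (LINT x|lborel. \<zeta> x * (\<Sum>b\<in>Basis. F' x b \<bullet> b))"
    by (simp add: int2 sum_distrib_left)
  finally show ?thesis .
qed

section \<open>Growth and continuity of the fluxes\<close>

lemma norm_reg_flux_le:
  assumes "0 \<le> \<delta>"
  shows "norm (reg_flux q \<delta> v) \<le> (v \<bullet> v + \<delta>) powr ((1 + q) / 2)"
proof (cases "v \<bullet> v + \<delta> = 0")
  case True
  then show ?thesis by (simp add: reg_flux_def)
next
  case False
  then have pos: "v \<bullet> v + \<delta> > 0" using assms inner_ge_zero[of v] by linarith
  have "norm v \<le> (v \<bullet> v + \<delta>) powr (1 / 2)"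
    using assms by (simp add: powr_half_sqrt norm_eq_sqrt_inner)
  then have "norm (reg_flux q \<delta> v) \<le> (v \<bullet> v + \<delta>) powr (q / 2) * (v \<bullet> v + \<delta>) powr (1 / 2)"
    unfolding reg_flux_def by (simp add: mult_left_mono)
  also have "\<dots> = (v \<bullet> v + \<delta>) powr ((1 + q) / 2)"
    by (simp add: powr_add[symmetric] add_divide_distrib add.commute)
  finally show ?thesis .
qed

text \<open>Differentiability settles every point except the origin with
  \<open>\<delta> = 0\<close>. There the flux is bounded by the norm to the power
  \<open>1 + q\<close>, an exponent that is positive even for negative \<open>q\<close>.\<close>

lemma continuous_on_reg_flux:
  assumes "1 + q > 0" "0 \<le> \<delta>"
  shows "continuous_on UNIV (reg_flux q \<delta> :: 'a::euclidean_space \<Rightarrow> 'a)"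
proof -
  have "isCont (reg_flux q \<delta>) v" for v :: 'a
  proof (cases "v \<bullet> v + \<delta> = 0")
    case False
    then have "v \<bullet> v + \<delta> > 0" using assms(2) inner_ge_zero[of v] by linarith
    from has_derivative_continuous[OF reg_flux_has_derivative[OF this]] show ?thesis .
  next
    case True
    then have v: "v = 0" "\<delta> = 0"
      using assms(2) inner_ge_zero[of v] by (simp_all add: add_nonneg_eq_0_iff)
    have "((\<lambda>w::'a. (w \<bullet> w + \<delta>) powr ((1 + q) / 2)) \<longlongrightarrow> ((0::'a) \<bullet> 0 + \<delta>) powr ((1 + q) / 2)) (at 0)"
    proof (rule tendsto_powr2)
      show "((\<lambda>w::'a. w \<bullet> w + \<delta>) \<longlongrightarrow> (0::'a) \<bullet> 0 + \<delta>) (at 0)"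
        by (intro tendsto_add tendsto_inner tendsto_ident_at tendsto_const)
      show "\<forall>\<^sub>F w in at (0::'a). 0 \<le> w \<bullet> w + \<delta>" using assms by simp
      show "0 < (1 + q) / 2" using assms by simp
    qed (rule tendsto_const)
    then have lim: "((\<lambda>w::'a. (w \<bullet> w + \<delta>) powr ((1 + q) / 2)) \<longlongrightarrow> 0) (at 0)"
      using v by simp
    have "(reg_flux q \<delta> \<longlongrightarrow> (0::'a)) (at 0)"
      by (rule Lim_null_comparison[OF _ lim]) (intro always_eventually allI norm_reg_flux_le assms(2))
    moreover have "reg_flux q \<delta> (0::'a) = 0" by (simp add: reg_flux_def)
    ultimately show ?thesis by (simp add: v isCont_def)
  qed
  then show ?thesis
    by (simp add: continuous_at_imp_continuous_on)
qed

lemma continuous_on_p_flux: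
  "1 < p \<Longrightarrow> continuous_on UNIV (p_flux p :: 'a::euclidean_space \<Rightarrow> 'a)"
  using continuous_on_reg_flux[of "p - 2" 0] by (simp add: p_flux_eq_reg_flux[abs_def])

lemma reg_flux_tendsto:
  assumes "d \<longlonglongrightarrow> 0" "\<And>k. 0 < d k"
  shows "(\<lambda>k. reg_flux q (d k) v) \<longlonglongrightarrow> reg_flux q 0 v"
proof (cases "v = 0")
  case False
  have "(\<lambda>k. v \<bullet> v + d k) \<longlonglongrightarrow> v \<bullet> v + 0"
    using assms by (intro tendsto_intros)
  then show ?thesis unfolding reg_flux_def using False
    by (intro tendsto_intros assms(1)) auto
qed (simp add: reg_flux_def)

lemma C2_on_continuous:
  assumes "C2_on D w"
  shows "continuous_on D w" "continuous_on D (grad w)" "continuous_on D (hess w)"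
  using assms unfolding C2_on_def
  by (auto intro!: continuous_at_imp_continuous_on differentiable_imp_continuous_within)

lemma continuous_on_trace_blinfun [continuous_intros]:
  "continuous_on S f \<Longrightarrow> continuous_on S (\<lambda>x. trace_blinfun (f x))"
  unfolding trace_blinfun_def by (intro continuous_intros)

text \<open>The regularized operator is a convex combination of the trace and the normalized
  p-Laplacian, with weight tending to 1 uniformly where the gradient is bounded below.\<close>

lemma regularized_operator_nonpos:
  assumes w: "C2_on D w" and E: "compact E" "E \<subseteq> D"
    and npl: "\<And>x. x \<in> E \<Longrightarrow> grad w x \<noteq> 0 \<Longrightarrow> normalized_pl q (hess w x) (grad w x) < 0"
    and tr: "\<And>x. x \<in> E \<Longrightarrow> grad w x = 0 \<Longrightarrow> trace_blinfun (hess w x) < 0"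
  obtains \<delta>0 where "\<delta>0 > 0" "\<And>\<delta> x. 0 < \<delta> \<Longrightarrow> \<delta> < \<delta>0 \<Longrightarrow> x \<in> E \<Longrightarrow>
    trace_blinfun (hess w x) + q * (grad w x \<bullet> hess w x (grad w x)) / (grad w x \<bullet> grad w x + \<delta>) \<le> 0"
proof -
  \<comment> \<open>Off \<open>Z\<close> the regularized value is nonpositive for every
    \<open>\<delta> > 0\<close>, so only \<open>Z\<close> restricts \<open>\<delta>\<close>. On
    \<open>Z\<close> the trace is nonnegative, hence the gradient is nonzero, and compactness bounds
    it away from 0.\<close>
  define Z where "Z = {x\<in>E. 0 \<le> trace_blinfun (hess w x)}"
  have cont: "continuous_on E (grad w)" "continuous_on E (hess w)"
    using C2_on_continuous[OF w] E continuous_on_subset by blast+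
  have conttr: "continuous_on E (\<lambda>x. trace_blinfun (hess w x))"
    using cont by (intro continuous_intros)
  have "closedin (top_of_set E) (E \<inter> (\<lambda>x. trace_blinfun (hess w x)) -` {0..})"
    using conttr by (intro continuous_closedin_preimage) auto
  then have "compact (E \<inter> (\<lambda>x. trace_blinfun (hess w x)) -` {0..})"
    using E(1) closedin_compact by blast
  moreover have "E \<inter> (\<lambda>x. trace_blinfun (hess w x)) -` {0..} = Z" by (auto simp: Z_def)
  ultimately have Z: "compact Z" "Z \<subseteq> E" by (auto simp: Z_def)
  have gZ: "grad w x \<noteq> 0" if "x \<in> Z" for x using tr that by (force simp: Z_def)
  have contZ: "continuous_on Z (grad w)" "continuous_on Z (hess w)"
    using cont Z continuous_on_subset by blast+
  have comb: "trace_blinfun A + q * (g \<bullet> blinfun_apply A g) / (g \<bullet> g + \<delta>) =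
     \<delta> / (g \<bullet> g + \<delta>) * trace_blinfun A + (1 - \<delta> / (g \<bullet> g + \<delta>)) * normalized_pl q A g"
    if "g \<noteq> 0" "0 < \<delta>" for g :: 'a and A \<delta>
  proof -
    have "X > 0 \<Longrightarrow> T + Q / (X + \<delta>) = \<delta> / (X + \<delta>) * T + (1 - \<delta> / (X + \<delta>)) * (T + Q / X)" for X T Q :: real
      using that(2) by (simp add: divide_simps) (simp add: algebra_simps)
    from this[of "g \<bullet> g"] that show ?thesis by (simp add: normalized_pl_def)
  qed
  have out: "trace_blinfun (hess w x) + q * (grad w x \<bullet> hess w x (grad w x)) / (grad w x \<bullet> grad w x + \<delta>) \<le> 0"
    if "x \<in> E - Z" "0 < \<delta>" for x \<delta>
  proof (cases "grad w x = 0")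
    case True
    then show ?thesis using tr[of x] that by simp
  next
    case False
    have "\<delta> / (grad w x \<bullet> grad w x + \<delta>) * trace_blinfun (hess w x) \<le> 0"
      using that by (intro mult_nonneg_nonpos) (auto simp: Z_def intro!: divide_nonneg_nonneg)
    moreover have "(1 - \<delta> / (grad w x \<bullet> grad w x + \<delta>)) * normalized_pl q (hess w x) (grad w x) \<le> 0"
      using that npl[of x] False by (intro mult_nonneg_nonpos) (auto simp: divide_le_eq add_nonneg_pos)
    ultimately show ?thesis using comb[OF False that(2)] by simp
  qed
  show ?thesis
  proof (cases "Z = {}")
    case True
    show ?thesis using out True by (intro that[of 1]) auto
  next
    case False
    have "\<exists>x\<in>Z. \<forall>y\<in>Z. normalized_pl q (hess w y) (grad w y) \<le> normalized_pl q (hess w x) (grad w x)"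
      unfolding normalized_pl_def using gZ False Z
      by (intro continuous_attains_sup continuous_intros contZ) auto
    then obtain x1 where x1: "x1 \<in> Z" "\<And>y. y \<in> Z \<Longrightarrow> normalized_pl q (hess w y) (grad w y) \<le> normalized_pl q (hess w x1) (grad w x1)"
      by blast
    have "\<exists>x\<in>Z. \<forall>y\<in>Z. trace_blinfun (hess w y) \<le> trace_blinfun (hess w x)"
      using False Z by (intro continuous_attains_sup continuous_intros contZ) auto
    then obtain x2 where x2: "x2 \<in> Z" "\<And>y. y \<in> Z \<Longrightarrow> trace_blinfun (hess w y) \<le> trace_blinfun (hess w x2)"
      by blast
    have "\<exists>x\<in>Z. \<forall>y\<in>Z. grad w x \<bullet> grad w x \<le> grad w y \<bullet> grad w y"
      using False Z by (intro continuous_attains_inf continuous_intros contZ) auto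
    then obtain x3 where x3: "x3 \<in> Z" "\<And>y. y \<in> Z \<Longrightarrow> grad w x3 \<bullet> grad w x3 \<le> grad w y \<bullet> grad w y"
      by blast
    define \<gamma> where "\<gamma> = - normalized_pl q (hess w x1) (grad w x1)"
    define M where "M = trace_blinfun (hess w x2)"
    define m where "m = grad w x3 \<bullet> grad w x3"
    have \<gamma>: "\<gamma> > 0" using npl[of x1] x1 gZ Z by (auto simp: \<gamma>_def)
    have M: "M \<ge> 0" using x2 by (auto simp: M_def Z_def)
    have m: "m > 0" using gZ[OF x3(1)] by (simp add: m_def)
    \<comment> \<open>On \<open>Z\<close> the weight \<open>t\<close> of the trace is at most
      \<open>\<delta> / m\<close>; below \<open>m * \<gamma> / (M + \<gamma>)\<close> the gain
      \<open>(1 - t) * \<gamma>\<close> outweighs the loss \<open>t * M\<close>.\<close>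
    show ?thesis
    proof (rule that[of "m * \<gamma> / (M + \<gamma>)"])
      show "0 < m * \<gamma> / (M + \<gamma>)" using m \<gamma> M by (simp add: add_nonneg_pos)
      fix \<delta> x assume \<delta>: "0 < \<delta>" "\<delta> < m * \<gamma> / (M + \<gamma>)" and x: "x \<in> E"
      show "trace_blinfun (hess w x) + q * (grad w x \<bullet> hess w x (grad w x)) / (grad w x \<bullet> grad w x + \<delta>) \<le> 0"
      proof (cases "x \<in> Z")
        case False
        then show ?thesis using out x \<delta> by simp
      next
        case True
        define t where "t = \<delta> / (grad w x \<bullet> grad w x + \<delta>)"
        have t0: "0 \<le> t" "t \<le> 1" using \<delta> gZ[OF True] by (auto simp: t_def divide_le_eq add_nonneg_pos)
        have "t \<le> \<delta> / m" unfolding t_def using x3(2)[OF True] \<delta> m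
          by (intro divide_left_mono) (auto simp: m_def intro!: mult_pos_pos add_nonneg_pos)
        then have "t * (M + \<gamma>) \<le> \<delta> / m * (M + \<gamma>)" using M \<gamma> by (intro mult_right_mono) auto
        also have "\<dots> \<le> \<gamma>" using \<delta>(2) m M \<gamma> by (simp add: field_simps add_nonneg_pos less_divide_eq)
        finally have 1: "t * M - (1 - t) * \<gamma> \<le> 0" by (simp add: algebra_simps)
        have "t * trace_blinfun (hess w x) \<le> t * M"
          using x2(2)[OF True] t0 by (intro mult_left_mono) (auto simp: M_def)
        moreover have "(1 - t) * normalized_pl q (hess w x) (grad w x) \<le> (1 - t) * (- \<gamma>)"
          using x1(2)[OF True] t0 by (intro mult_left_mono) (auto simp: \<gamma>_def)
        ultimately show ?thesis using comb[OF gZ[OF True] \<delta>(1)] 1 by (simp add: t_def)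
      qed
    qed
  qed
qed

text \<open>Where the gradient vanishes the flux need not be differentiable, so integration by parts
  is done for \<open>reg_flux (p - 2) \<delta>\<close>. On the compact support of
  \<open>\<zeta>\<close> its divergence is nonpositive for small \<open>\<delta>\<close>, and the
  inequality passes to the limit. At a critical point the regularized divergence is a positive
  multiple of the trace, which is the origin of the second sign condition.\<close>

lemma weak_supersolution_C2:
  fixes w :: "'a::euclidean_space \<Rightarrow> real"
  assumes p: "1 < p" and D: "open D" and w: "C2_on D w"
    and npl: "\<And>x. x \<in> D \<Longrightarrow> grad w x \<noteq> 0 \<Longrightarrow> normalized_pl (p - 2) (hess w x) (grad w x) < 0"
    and tr: "\<And>x. x \<in> D \<Longrightarrow> grad w x = 0 \<Longrightarrow> trace_blinfun (hess w x) < 0"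
    and \<zeta>: "\<zeta> \<in> C1c D" "\<And>x. 0 \<le> \<zeta> x"
  shows "0 \<le> (LINT x|lborel. p_flux p (grad w x) \<bullet> grad \<zeta> x)"
proof -
  define E where "E = closure {x. \<zeta> x \<noteq> 0}"
  have E: "compact E" "E \<subseteq> D" using C1cD(3,4)[OF \<zeta>(1)] by (simp_all add: E_def)
  have zero: "\<zeta> x = 0" "grad \<zeta> x = 0" if "x \<notin> E" for x
    by (rule C1c_grad_eq_0[OF \<zeta>(1) that[unfolded E_def]])+
  have cont: "continuous_on E (grad w)" "continuous_on E (hess w)"
    using C2_on_continuous[OF w] E continuous_on_subset by blast+
  have cont\<zeta>: "continuous_on E (grad \<zeta>)" using C1cD(2)[OF \<zeta>(1)] continuous_on_subset by blast
  obtain \<delta>0 where \<delta>0: "\<delta>0 > 0" "\<And>\<delta> x. 0 < \<delta> \<Longrightarrow> \<delta> < \<delta>0 \<Longrightarrow> x \<in> E \<Longrightarrow>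
    trace_blinfun (hess w x) + (p - 2) * (grad w x \<bullet> hess w x (grad w x)) / (grad w x \<bullet> grad w x + \<delta>) \<le> 0"
    using regularized_operator_nonpos[OF w E, of "p - 2"] npl tr E by blast
  define d where "d = (\<lambda>k. 1 / real (Suc k))"
  have d: "0 < d k" "d k \<le> 1" for k by (auto simp: d_def)
  have d0: "d \<longlonglongrightarrow> 0" using LIMSEQ_inverse_real_of_nat by (simp add: d_def inverse_eq_divide)
  define f where "f k x = reg_flux (p - 2) (d k) (grad w x) \<bullet> grad \<zeta> x" for k x
  have nonneg: "0 \<le> (LINT x|lborel. f k x)" if k: "d k < \<delta>0" for k
  proof -
    have pos: "grad w x \<bullet> grad w x + d k > 0" for x using d[of k] by (simp add: add_nonneg_pos)
    let ?F' = "\<lambda>x h. (grad w x \<bullet> grad w x + d k) powr ((p - 2) / 2) *\<^sub>R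
     (hess w x h + ((p - 2) * (grad w x \<bullet> hess w x h) / (grad w x \<bullet> grad w x + d k)) *\<^sub>R grad w x)"
    have contD: "continuous_on D (\<lambda>x. ?F' x b)" for b
      using C2_on_continuous[OF w] pos by (intro continuous_intros) (auto simp: less_imp_neq[symmetric] add_nonneg_pos)
    have "(LINT x|lborel. f k x) = - (LINT x|lborel. \<zeta> x * (\<Sum>b\<in>Basis. ?F' x b \<bullet> b))"
      unfolding f_def using w pos
      by (intro integral_by_parts[OF D _ contD \<zeta>(1)] divergence_reg_flux(1)) (auto simp: C2_on_def)
    also have "\<dots> = (LINT x|lborel. - (\<zeta> x * (\<Sum>b\<in>Basis. ?F' x b \<bullet> b)))" by simp
    also have "\<dots> \<ge> 0"
    proof (rule Bochner_Integration.integral_nonneg)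
      fix x
      show "0 \<le> - (\<zeta> x * (\<Sum>b\<in>Basis. ?F' x b \<bullet> b))"
      proof (cases "x \<in> E")
        case True
        then have "grad w differentiable (at x)" using w E by (auto simp: C2_on_def)
        from divergence_reg_flux(2)[OF this pos[of x], of "p - 2"]
        have "(\<Sum>b\<in>Basis. ?F' x b \<bullet> b) \<le> 0"
          using \<delta>0(2)[OF d(1) k True] by (simp add: mult_nonneg_nonpos)
        then show ?thesis using \<zeta>(2)[of x] by (simp add: mult_nonneg_nonpos)
      qed (simp add: zero)
    qed
    finally show ?thesis .
  qed
  have contf: "continuous_on E (f k)" for k
  proof -
    have "continuous_on E (\<lambda>x. reg_flux (p - 2) (d k) (grad w x))"
      by (rule continuous_on_compose2[OF continuous_on_reg_flux cont(1)]) (use p d[of k] in auto)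
    then show ?thesis unfolding f_def using cont\<zeta> by (intro continuous_intros)
  qed
  have intf: "integrable lborel (f k)" for k
    using E contf zero by (intro integrable_compact_support[of E]) (auto simp: f_def)
  define f0 where "f0 x = p_flux p (grad w x) \<bullet> grad \<zeta> x" for x
  have "continuous_on E (\<lambda>x. p_flux p (grad w x))"
    by (rule continuous_on_compose2[OF continuous_on_p_flux[OF p] cont(1)]) auto
  then have "continuous_on E f0" unfolding f0_def using cont\<zeta> by (intro continuous_intros)
  then have intf0: "integrable lborel f0"
    using E zero by (intro integrable_compact_support[of E]) (auto simp: f0_def)
  \<comment> \<open>Dominates all \<open>f k\<close>, because \<open>d k <= 1\<close> and the
    exponent \<open>(p - 1) / 2\<close> is positive.\<close>
  define W where "W x = (if x \<in> E then (grad w x \<bullet> grad w x + 1) powr ((p - 1) / 2) * norm (grad \<zeta> x) else 0)" for x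
  have "continuous_on E (\<lambda>x. (grad w x \<bullet> grad w x + 1) powr ((p - 1) / 2) * norm (grad \<zeta> x))"
    using cont cont\<zeta> by (intro continuous_intros) (auto simp: add_nonneg_pos less_imp_neq[symmetric] add_nonneg_eq_0_iff)
  then have "continuous_on E W" by (subst continuous_on_cong[OF refl]) (auto simp: W_def)
  then have intW: "integrable lborel W"
    using E by (intro integrable_compact_support[of E]) (auto simp: W_def)
  have "(\<lambda>k. LINT x|lborel. f k x) \<longlonglongrightarrow> (LINT x|lborel. f0 x)"
  proof (rule integral_dominated_convergence[where w = W])
    show "AE x in lborel. (\<lambda>k. f k x) \<longlonglongrightarrow> f0 x"
      unfolding f_def f0_def p_flux_eq_reg_flux using d d0
      by (intro AE_I2 tendsto_intros reg_flux_tendsto)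
    show "AE x in lborel. norm (f k x) \<le> W x" for k
    proof (intro AE_I2)
      fix x
      show "norm (f k x) \<le> W x"
      proof (cases "x \<in> E")
        case True
        have "norm (f k x) \<le> norm (reg_flux (p - 2) (d k) (grad w x)) * norm (grad \<zeta> x)"
          unfolding f_def using Cauchy_Schwarz_ineq2 by simp
        also have "norm (reg_flux (p - 2) (d k) (grad w x)) \<le> (grad w x \<bullet> grad w x + d k) powr ((p - 1) / 2)"
          using norm_reg_flux_le[of "d k" "p - 2" "grad w x"] p d[of k] by simp
        also have "\<dots> \<le> (grad w x \<bullet> grad w x + 1) powr ((p - 1) / 2)"
          using d[of k] p by (intro powr_mono2) auto
        finally show ?thesis using True by (simp add: W_def mult_right_mono)
      qed (simp add: f_def W_def zero)
    qed
  qed (use intf intf0 intW in auto)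
  moreover have "\<forall>\<^sub>F k in sequentially. 0 \<le> (LINT x|lborel. f k x)"
    using order_tendstoD(2)[OF d0 \<delta>0(1)] by eventually_elim (rule nonneg)
  ultimately show ?thesis unfolding f0_def
    by (intro tendsto_lowerbound) auto
qed

section \<open>Mollification\<close>

lemma integrable_scaleR_bounded:
  fixes f :: "'a::euclidean_space \<Rightarrow> 'b::euclidean_space" and g :: "'a \<Rightarrow> real"
  assumes "integrable lborel f" "g \<in> borel_measurable borel" "\<And>y. \<bar>g y\<bar> \<le> B"
  shows "integrable lborel (\<lambda>y. g y *\<^sub>R f y)"
proof (rule Bochner_Integration.integrable_bound)
  show "integrable lborel (\<lambda>y. B *\<^sub>R norm (f y))" using assms(1) by simp
  show "(\<lambda>y. g y *\<^sub>R f y) \<in> borel_measurable lborel" using assms by (intro borel_measurable_scaleR) auto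
  show "AE y in lborel. norm (g y *\<^sub>R f y) \<le> norm (B *\<^sub>R norm (f y))"
    using assms(3) by (intro AE_I2) (auto simp: abs_mult intro!: mult_right_mono order_trans[OF assms(3) abs_ge_self])
qed

lemma integrable_scaleR_bounded':
  fixes f :: "'a::euclidean_space \<Rightarrow> real" and g :: "'a \<Rightarrow> 'b::euclidean_space"
  assumes "integrable lborel f" "g \<in> borel_measurable borel" "\<And>y. norm (g y) \<le> B"
  shows "integrable lborel (\<lambda>y. f y *\<^sub>R g y)"
proof (rule Bochner_Integration.integrable_bound)
  show "integrable lborel (\<lambda>y. B *\<^sub>R \<bar>f y\<bar>)" using assms(1) by simp
  show "(\<lambda>y. f y *\<^sub>R g y) \<in> borel_measurable lborel" using assms by (intro borel_measurable_scaleR) auto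
  show "AE y in lborel. norm (f y *\<^sub>R g y) \<le> norm (B *\<^sub>R \<bar>f y\<bar>)"
    using assms(3) by (intro AE_I2) (auto simp: abs_mult mult.commute[of B] intro!: mult_left_mono order_trans[OF assms(3) abs_ge_self])
qed

text \<open>A kernel of class C1 is smooth enough, since test functions are only asked to be C1. The
  squared positive part of a quadratic polynomial has an explicit gradient and a second-order
  remainder that is bounded uniformly in the base point.\<close>

definition bump :: "real \<Rightarrow> 'a::euclidean_space \<Rightarrow> real" where
  "bump \<epsilon> z = (max 0 (\<epsilon>\<^sup>2 - z \<bullet> z))\<^sup>2"

definition bump_mass :: "'a::euclidean_space itself \<Rightarrow> real \<Rightarrow> real" where
  "bump_mass _ \<epsilon> = (LINT z|lborel. bump \<epsilon> (z :: 'a))"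

definition mollifier :: "real \<Rightarrow> 'a::euclidean_space \<Rightarrow> real" where
  "mollifier \<epsilon> z = bump \<epsilon> z / bump_mass TYPE('a) \<epsilon>"

definition mollifier_grad :: "real \<Rightarrow> 'a::euclidean_space \<Rightarrow> 'a" where
  "mollifier_grad \<epsilon> z = (- 4 * max 0 (\<epsilon>\<^sup>2 - z \<bullet> z) / bump_mass TYPE('a) \<epsilon>) *\<^sub>R z"

text \<open>The squared positive part has the Lipschitz derivative \<open>2 * max 0 t\<close>. The
  quadratic remainder serves both the kernel and the truncated test functions of the comparison
  principle.\<close>

lemma max_square_expansion:
  "\<bar>(max 0 (t + \<tau>))\<^sup>2 - (max 0 t)\<^sup>2 - 2 * max 0 t * \<tau>\<bar> \<le> (\<tau>::real)\<^sup>2"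
proof -
  have sq: "(max 0 a)\<^sup>2 = max 0 a * max 0 a" for a :: real by (simp add: power2_eq_square)
  consider "0 \<le> t" "0 \<le> t + \<tau>" | "0 \<le> t" "t + \<tau> < 0" | "t < 0" "0 \<le> t + \<tau>" | "t < 0" "t + \<tau> < 0" by linarith
  then show ?thesis
  proof cases
    case 2
    then have "t * \<tau> \<le> t * (- t)" by (intro mult_left_mono) auto
    then have "t * t + 2 * (t * \<tau>) \<le> \<tau> * \<tau>"
      using zero_le_square[of t] zero_le_square[of \<tau>] by (simp only: mult_minus_right)
    moreover have "0 \<le> (t + \<tau>) * (t + \<tau>)" by simp
    then have "- (t * t + 2 * (t * \<tau>)) \<le> \<tau> * \<tau>" by (simp add: algebra_simps)
    moreover have "max 0 (t + \<tau>) = 0" "max 0 t = t" using 2 by auto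
    ultimately show ?thesis by (simp add: power2_eq_square abs_le_iff)
  next
    case 3
    then have "(t + \<tau>) * (t + \<tau>) \<le> \<tau> * \<tau>" by (intro mult_mono) auto
    then show ?thesis using 3 by (simp add: power2_eq_square)
  qed (auto simp: power2_eq_square algebra_simps)
qed

lemma norm_ge_imp_bump: "norm z \<ge> \<epsilon> \<Longrightarrow> \<epsilon> > 0 \<Longrightarrow> max 0 (\<epsilon>\<^sup>2 - z \<bullet> z) = 0"
  using power_mono[of \<epsilon> "norm z" 2] by (simp add: dot_square_norm)

context
  fixes \<epsilon> :: real
  assumes \<epsilon>: "\<epsilon> > 0"
begin

lemma bump_bounds: "0 \<le> bump \<epsilon> z" "bump \<epsilon> z \<le> \<epsilon> ^ 4"
proof -
  have "max 0 (\<epsilon>\<^sup>2 - z \<bullet> z) \<le> \<epsilon>\<^sup>2" by simp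
  then have "(max 0 (\<epsilon>\<^sup>2 - z \<bullet> z))\<^sup>2 \<le> (\<epsilon>\<^sup>2)\<^sup>2" by (intro power_mono) auto
  then show "bump \<epsilon> z \<le> \<epsilon> ^ 4" by (simp add: bump_def)
qed (simp add: bump_def)

lemma bump_eq_0: "norm z \<ge> \<epsilon> \<Longrightarrow> bump \<epsilon> z = 0"
  using norm_ge_imp_bump[of \<epsilon> z] \<epsilon> by (simp add: bump_def)

lemma continuous_on_bump: "continuous_on S (bump \<epsilon>)"
  unfolding bump_def[abs_def] by (intro continuous_intros)

lemma integrable_bump: "integrable lborel (bump \<epsilon> :: 'a::euclidean_space \<Rightarrow> real)"
  by (rule integrable_compact_support[of "cball 0 \<epsilon>"])
    (auto intro!: continuous_on_bump bump_eq_0)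

lemma bump_mass_pos: "0 < bump_mass TYPE('a::euclidean_space) \<epsilon>"
proof -
  let ?c = "(\<epsilon>\<^sup>2 * 3 / 4)\<^sup>2"
  have "0 < ?c * measure lborel (ball (0::'a) (\<epsilon> / 2))"
    using \<epsilon> by (intro mult_pos_pos) (auto simp: content_ball_pos)
  also have "\<dots> = (LINT z|lborel. indicator (ball (0::'a) (\<epsilon> / 2)) z * ?c)"
    by simp
  also have "\<dots> \<le> (LINT z|lborel. bump \<epsilon> (z :: 'a))"
  proof (rule integral_mono)
    show "integrable lborel (\<lambda>z. indicator (ball (0::'a) (\<epsilon> / 2)) z * ?c)"
      by (intro integrable_mult_left integrable_real_indicator) (use emeasure_lborel_ball_finite[of "0::'a" "\<epsilon> / 2"] in auto)
    fix z :: 'a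
    show "indicator (ball 0 (\<epsilon> / 2)) z * ?c \<le> bump \<epsilon> z"
    proof (cases "z \<in> ball 0 (\<epsilon> / 2)")
      case True
      then have "(norm z)\<^sup>2 \<le> (\<epsilon> / 2)\<^sup>2" by (intro power_mono) auto
      then have "\<epsilon>\<^sup>2 * 3 / 4 \<le> \<epsilon>\<^sup>2 - z \<bullet> z" by (simp add: dot_square_norm power2_eq_square)
      then have "\<epsilon>\<^sup>2 * 3 / 4 \<le> max 0 (\<epsilon>\<^sup>2 - z \<bullet> z)" by (simp add: le_max_iff_disj)
      then have "?c \<le> bump \<epsilon> z" unfolding bump_def using \<epsilon> by (intro power_mono) auto
      then show ?thesis using True by simp
    qed (simp add: bump_bounds)
  qed (rule integrable_bump)
  finally show ?thesis by (simp add: bump_mass_def)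
qed

lemma mollifier_nonneg: "0 \<le> mollifier \<epsilon> (z::'a::euclidean_space)"
  using bump_bounds[of z] bump_mass_pos[where 'a='a] by (simp add: mollifier_def less_imp_le)

lemma mollifier_eq_0: "norm z \<ge> \<epsilon> \<Longrightarrow> mollifier \<epsilon> z = 0"
  by (simp add: mollifier_def bump_eq_0)

lemma mollifier_grad_eq_0: "norm z \<ge> \<epsilon> \<Longrightarrow> mollifier_grad \<epsilon> z = 0"
  using norm_ge_imp_bump[of \<epsilon> z] \<epsilon> by (simp add: mollifier_grad_def)

lemma continuous_on_mollifier: "continuous_on S (mollifier \<epsilon> :: 'a::euclidean_space \<Rightarrow> real)"
  unfolding mollifier_def[abs_def] using bump_mass_pos[where 'a='a]
  by (intro continuous_intros continuous_on_bump) auto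

lemma continuous_on_mollifier_grad: "continuous_on S (mollifier_grad \<epsilon> :: 'a::euclidean_space \<Rightarrow> 'a)"
  unfolding mollifier_grad_def[abs_def] using bump_mass_pos[where 'a='a]
  by (intro continuous_intros) auto

lemma mollifier_measurable [measurable]: "mollifier \<epsilon> \<in> borel_measurable borel"
  "mollifier_grad \<epsilon> \<in> borel_measurable borel"
  by (intro borel_measurable_continuous_onI continuous_on_mollifier continuous_on_mollifier_grad)+

lemma mollifier_bounded: "\<bar>mollifier \<epsilon> (z::'a::euclidean_space)\<bar> \<le> \<epsilon> ^ 4 / bump_mass TYPE('a) \<epsilon>"
  using bump_bounds[of z] bump_mass_pos[where 'a='a] by (simp add: mollifier_def divide_right_mono)

lemma mollifier_grad_bounded: "norm (mollifier_grad \<epsilon> (z::'a::euclidean_space)) \<le> 4 * \<epsilon> ^ 3 / bump_mass TYPE('a) \<epsilon>"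
proof (cases "norm z \<ge> \<epsilon>")
  case True
  then show ?thesis using bump_mass_pos[where 'a='a] \<epsilon> by (simp add: mollifier_grad_eq_0)
next
  case False
  have "max 0 (\<epsilon>\<^sup>2 - z \<bullet> z) * norm z \<le> \<epsilon>\<^sup>2 * \<epsilon>" using False by (intro mult_mono) auto
  then show ?thesis using bump_mass_pos[where 'a='a]
    by (simp add: mollifier_grad_def abs_mult power2_eq_square power3_eq_cube divide_right_mono)
qed

lemma integral_mollifier: "(LINT z|lborel. mollifier \<epsilon> (z::'a::euclidean_space)) = 1"
  using bump_mass_pos[where 'a='a] by (simp add: mollifier_def bump_mass_def)

lemma integrable_mollifier: "integrable lborel (mollifier \<epsilon> :: 'a::euclidean_space \<Rightarrow> real)"
  unfolding mollifier_def[abs_def] using integrable_bump[where 'a='a] by simp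

lemma mollifier_reflect: "mollifier \<epsilon> (x - y) = mollifier \<epsilon> (y - x)"
  by (simp add: mollifier_def bump_def norm_minus_commute dot_square_norm)

lemma integral_mollifier_shift:
  "integrable lborel (\<lambda>y. mollifier \<epsilon> (x - y :: 'a::euclidean_space))"
  "(LINT y|lborel. mollifier \<epsilon> (x - y :: 'a)) = 1"
proof -
  have eq: "(\<lambda>y. mollifier \<epsilon> (x - y)) = (\<lambda>y. mollifier \<epsilon> (y + - x))"
    by (subst mollifier_reflect) simp
  show "integrable lborel (\<lambda>y. mollifier \<epsilon> (x - y :: 'a))"
    unfolding eq using lborel_integral_translate(2)[of "mollifier \<epsilon>" "- x"] integrable_mollifier by simp
  show "(LINT y|lborel. mollifier \<epsilon> (x - y :: 'a)) = 1"
    unfolding eq using lborel_integral_translate(1)[of "mollifier \<epsilon>" "- x"] integral_mollifier[where 'a='a] by simp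
qed

text \<open>The constant does not depend on \<open>z\<close>. This uniformity is what allows a
  convolution with a merely integrable function to be differentiated under the integral.\<close>

lemma mollifier_expansion:
  obtains C where "C \<ge> 0" "\<And>z h :: 'a::euclidean_space. norm h \<le> 1 \<Longrightarrow>
    \<bar>mollifier \<epsilon> (z + h) - mollifier \<epsilon> z - mollifier_grad \<epsilon> z \<bullet> h\<bar> \<le> C * (norm h)\<^sup>2"
proof -
  define m where "m = bump_mass TYPE('a) \<epsilon>"
  have m: "m > 0" using bump_mass_pos by (simp add: m_def)
  define C where "C = ((2 * \<epsilon> + 3)\<^sup>2 + 2 * \<epsilon>\<^sup>2) / m"
  show ?thesis
  proof (rule that)
    show C0: "C \<ge> 0" using m \<epsilon> by (simp add: C_def)
    fix z h :: 'a assume h: "norm h \<le> 1"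
    \<comment> \<open>Since \<open>|h| <= 1\<close>, all three terms vanish once
      \<open>|z| \<ge> \<epsilon> + 1\<close>. For smaller \<open>z\<close> the increment
      \<open>\<tau>\<close> of \<open>\<epsilon>^2 - |z|^2\<close> is at most a constant times
      \<open>|h|\<close>.\<close>
    show "\<bar>mollifier \<epsilon> (z + h) - mollifier \<epsilon> z - mollifier_grad \<epsilon> z \<bullet> h\<bar> \<le> C * (norm h)\<^sup>2"
    proof (cases "norm z \<ge> \<epsilon> + 1")
      case True
      moreover have "norm (z + h) \<ge> \<epsilon>" using True h norm_diff_ineq[of z h] by simp
      ultimately show ?thesis using C0 by (simp add: mollifier_eq_0 mollifier_grad_eq_0)
    next
      case False
      define t where "t = \<epsilon>\<^sup>2 - z \<bullet> z"
      define \<tau> where "\<tau> = - 2 * (z \<bullet> h) - h \<bullet> h"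
      have "\<bar>\<tau>\<bar> \<le> 2 * \<bar>z \<bullet> h\<bar> + h \<bullet> h" unfolding \<tau>_def using inner_ge_zero[of h] by arith
      also have "\<dots> \<le> 2 * (norm z * norm h) + norm h * norm h"
        using Cauchy_Schwarz_ineq2[of z h] by (simp add: dot_square_norm power2_eq_square)
      also have "\<dots> \<le> 2 * ((\<epsilon> + 1) * norm h) + 1 * norm h"
        using False h by (intro add_mono mult_left_mono mult_right_mono) auto
      finally have "\<bar>\<tau>\<bar> \<le> (2 * \<epsilon> + 3) * norm h" by (simp add: algebra_simps)
      then have "\<bar>\<tau>\<bar>\<^sup>2 \<le> ((2 * \<epsilon> + 3) * norm h)\<^sup>2" by (intro power_mono) auto
      then have \<tau>2: "\<tau>\<^sup>2 \<le> (2 * \<epsilon> + 3)\<^sup>2 * (norm h)\<^sup>2" by (simp add: power_mult_distrib)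
      have t: "max 0 t \<le> \<epsilon>\<^sup>2" "0 \<le> max 0 t" by (auto simp: t_def)
      have b: "bump \<epsilon> (z + h) = (max 0 (t + \<tau>))\<^sup>2" "bump \<epsilon> z = (max 0 t)\<^sup>2"
        by (simp_all add: bump_def t_def \<tau>_def inner_add_left inner_add_right inner_commute algebra_simps)
      have mg: "mollifier_grad \<epsilon> z \<bullet> h = - 4 * max 0 t * (z \<bullet> h) / m"
        by (simp add: mollifier_grad_def t_def m_def)
      \<comment> \<open>The linear term \<open>- 4 * max 0 t * (z \<bullet> h)\<close> equals
        \<open>2 * max 0 t * \<tau>\<close> plus the quadratic correction
        \<open>2 * max 0 t * (h \<bullet> h)\<close>.\<close>
      have "mollifier \<epsilon> (z + h) - mollifier \<epsilon> z - mollifier_grad \<epsilon> z \<bullet> h =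
        ((max 0 (t + \<tau>))\<^sup>2 - (max 0 t)\<^sup>2 - 2 * max 0 t * \<tau> - 2 * max 0 t * (h \<bullet> h)) / m"
        unfolding mg mollifier_def b m_def[symmetric] by (simp add: \<tau>_def algebra_simps diff_divide_distrib add_divide_distrib)
      also have "\<bar>\<dots>\<bar> \<le> (\<tau>\<^sup>2 + 2 * \<epsilon>\<^sup>2 * (norm h)\<^sup>2) / m"
      proof -
        have "2 * max 0 t * (h \<bullet> h) \<le> 2 * \<epsilon>\<^sup>2 * (norm h)\<^sup>2" "0 \<le> 2 * max 0 t * (h \<bullet> h)"
          unfolding dot_square_norm using t by (auto intro!: mult_right_mono)
        then have "\<bar>(max 0 (t + \<tau>))\<^sup>2 - (max 0 t)\<^sup>2 - 2 * max 0 t * \<tau> - 2 * max 0 t * (h \<bullet> h)\<bar> \<le> \<tau>\<^sup>2 + 2 * \<epsilon>\<^sup>2 * (norm h)\<^sup>2"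
          using max_square_expansion[of t \<tau>] by linarith
        then show ?thesis using m by (simp add: divide_right_mono)
      qed
      also have "\<dots> \<le> C * (norm h)\<^sup>2"
        using \<tau>2 m by (simp add: C_def algebra_simps divide_right_mono add_divide_distrib[symmetric])
      finally show ?thesis .
    qed
  qed
qed

lemma mollifier_has_derivative:
  "(mollifier \<epsilon> has_derivative (\<lambda>h. mollifier_grad \<epsilon> z \<bullet> h)) (at (z :: 'a::euclidean_space))"
proof -
  obtain C where C: "C \<ge> 0" "\<And>z h :: 'a. norm h \<le> 1 \<Longrightarrow>
    \<bar>mollifier \<epsilon> (z + h) - mollifier \<epsilon> z - mollifier_grad \<epsilon> z \<bullet> h\<bar> \<le> C * (norm h)\<^sup>2"
    using mollifier_expansion by blast
  show ?thesis unfolding has_derivative_at_alt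
  proof (intro conjI allI impI)
    show "bounded_linear ((\<bullet>) (mollifier_grad \<epsilon> z))" by (rule bounded_linear_inner_right)
    fix e :: real assume e: "0 < e"
    define d where "d = min 1 (e / (C + 1))"
    have "d > 0" using e C by (simp add: d_def)
    moreover have "norm (mollifier \<epsilon> y - mollifier \<epsilon> z - mollifier_grad \<epsilon> z \<bullet> (y - z)) \<le> e * norm (y - z)"
      if "norm (y - z) < d" for y
    proof -
      have le: "norm (y - z) \<le> 1" "norm (y - z) \<le> e / (C + 1)" using that by (auto simp: d_def)
      have "norm (mollifier \<epsilon> y - mollifier \<epsilon> z - mollifier_grad \<epsilon> z \<bullet> (y - z)) \<le> C * (norm (y - z))\<^sup>2"
        using C(2)[OF le(1), of z] by simp
      also have "\<dots> \<le> ((C + 1) * norm (y - z)) * norm (y - z)"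
        using C(1) by (simp add: power2_eq_square algebra_simps)
      also have "\<dots> \<le> e * norm (y - z)"
        using le(2) C(1) by (intro mult_right_mono) (auto simp: field_simps)
      finally show ?thesis .
    qed
    ultimately show "\<exists>d>0. \<forall>y. norm (y - z) < d \<longrightarrow> norm (mollifier \<epsilon> y - mollifier \<epsilon> z - mollifier_grad \<epsilon> z \<bullet> (y - z)) \<le> e * norm (y - z)"
      by blast
  qed
qed

lemma mollification_has_derivative:
  fixes f :: "'a::euclidean_space \<Rightarrow> real"
  assumes f: "integrable lborel f"
  shows "((\<lambda>x. LINT y|lborel. f y * mollifier \<epsilon> (x - y)) has_derivative
     (\<lambda>h. (LINT y|lborel. f y *\<^sub>R mollifier_grad \<epsilon> (x - y)) \<bullet> h)) (at x)"
proof -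
  obtain C where C: "C \<ge> 0" "\<And>z h :: 'a. norm h \<le> 1 \<Longrightarrow>
    \<bar>mollifier \<epsilon> (z + h) - mollifier \<epsilon> z - mollifier_grad \<epsilon> z \<bullet> h\<bar> \<le> C * (norm h)\<^sup>2"
    using mollifier_expansion by blast
  define I where "I = (LINT y|lborel. \<bar>f y\<bar>)"
  have I: "I \<ge> 0" unfolding I_def by simp
  have int1: "integrable lborel (\<lambda>y. f y * mollifier \<epsilon> (x - y))" for x
    using integrable_scaleR_bounded'[OF f, of "\<lambda>y. mollifier \<epsilon> (x - y)", OF _ mollifier_bounded[folded real_norm_def]] by simp
  have int2: "integrable lborel (\<lambda>y. f y *\<^sub>R mollifier_grad \<epsilon> (x - y))" for x
    using integrable_scaleR_bounded'[OF f, of "\<lambda>y. mollifier_grad \<epsilon> (x - y)", OF _ mollifier_grad_bounded] by simp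
  have exp: "\<bar>(LINT y|lborel. f y * mollifier \<epsilon> (x + h - y)) - (LINT y|lborel. f y * mollifier \<epsilon> (x - y))
     - (LINT y|lborel. f y *\<^sub>R mollifier_grad \<epsilon> (x - y)) \<bullet> h\<bar> \<le> C * I * (norm h)\<^sup>2" if h: "norm h \<le> 1" for h
  proof -
    let ?R = "\<lambda>y. mollifier \<epsilon> (x - y + h) - mollifier \<epsilon> (x - y) - mollifier_grad \<epsilon> (x - y) \<bullet> h"
    have int3: "integrable lborel (\<lambda>y. f y * (mollifier_grad \<epsilon> (x - y) \<bullet> h))"
      using integrable_inner_left[OF int2[of x], of h] by simp
    have fR: "f y * ?R y = f y * mollifier \<epsilon> (x + h - y) - f y * mollifier \<epsilon> (x - y) - f y * (mollifier_grad \<epsilon> (x - y) \<bullet> h)" for y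
      by (simp add: algebra_simps)
    have intR: "integrable lborel (\<lambda>y. f y * ?R y)"
      unfolding fR using int1[of x] int1[of "x + h"] int3 by simp
    have "(LINT y|lborel. f y *\<^sub>R mollifier_grad \<epsilon> (x - y)) \<bullet> h = (LINT y|lborel. f y *\<^sub>R mollifier_grad \<epsilon> (x - y) \<bullet> h)"
      by (rule integral_inner_left[symmetric]) (rule int2)
    then have "(LINT y|lborel. f y * mollifier \<epsilon> (x + h - y)) - (LINT y|lborel. f y * mollifier \<epsilon> (x - y))
     - (LINT y|lborel. f y *\<^sub>R mollifier_grad \<epsilon> (x - y)) \<bullet> h = (LINT y|lborel. f y * ?R y)"
      unfolding fR using int1[of x] int1[of "x + h"] int3 by simp
    also have "\<bar>\<dots>\<bar> \<le> (LINT y|lborel. C * (norm h)\<^sup>2 * \<bar>f y\<bar>)"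
    proof -
      have "norm (LINT y|lborel. f y * ?R y) \<le> (LINT y|lborel. C * (norm h)\<^sup>2 * \<bar>f y\<bar>)"
      proof (rule Bochner_Integration.integral_norm_bound_integral)
        show "integrable lborel (\<lambda>y. f y * ?R y)" by (rule intR)
        show "norm (f y * ?R y) \<le> C * (norm h)\<^sup>2 * \<bar>f y\<bar>" for y
          using mult_left_mono[OF C(2)[OF h, of "x - y"], of "\<bar>f y\<bar>"] by (simp add: abs_mult mult_ac)
      qed (use f in auto)
      then show ?thesis by simp
    qed
    also have "\<dots> = C * I * (norm h)\<^sup>2" using f by (simp add: I_def)
    finally show ?thesis .
  qed
  define L where "L = (LINT y|lborel. f y *\<^sub>R mollifier_grad \<epsilon> (x - y))"
  show ?thesis unfolding has_derivative_at_alt L_def[symmetric]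
  proof (intro conjI allI impI)
    show "bounded_linear ((\<bullet>) L)" by (rule bounded_linear_inner_right)
    fix e :: real assume e: "0 < e"
    define d where "d = min 1 (e / (C * I + 1))"
    have CI: "C * I \<ge> 0" using C I by simp
    have "d > 0" using e CI by (simp add: d_def)
    moreover have "norm ((LINT y|lborel. f y * mollifier \<epsilon> (z - y)) - (LINT y|lborel. f y * mollifier \<epsilon> (x - y)) - L \<bullet> (z - x)) \<le> e * norm (z - x)"
      if "norm (z - x) < d" for z
    proof -
      have le: "norm (z - x) \<le> 1" "norm (z - x) \<le> e / (C * I + 1)" using that by (auto simp: d_def)
      have "norm ((LINT y|lborel. f y * mollifier \<epsilon> (z - y)) - (LINT y|lborel. f y * mollifier \<epsilon> (x - y)) - L \<bullet> (z - x)) \<le> C * I * (norm (z - x))\<^sup>2"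
        using exp[OF le(1)] by (simp add: L_def)
      also have "\<dots> \<le> ((C * I + 1) * norm (z - x)) * norm (z - x)"
        by (simp add: power2_eq_square algebra_simps)
      also have "\<dots> \<le> e * norm (z - x)"
        using le(2) CI by (intro mult_right_mono) (auto simp: field_simps)
      finally show ?thesis .
    qed
    ultimately show "\<exists>d>0. \<forall>z. norm (z - x) < d \<longrightarrow> norm ((LINT y|lborel. f y * mollifier \<epsilon> (z - y)) - (LINT y|lborel. f y * mollifier \<epsilon> (x - y)) - L \<bullet> (z - x)) \<le> e * norm (z - x)"
      by blast
  qed
qed

lemma continuous_mollification_grad:
  fixes f :: "'a::euclidean_space \<Rightarrow> real"
  assumes f: "integrable lborel f"
  shows "continuous_on UNIV (\<lambda>x. LINT y|lborel. f y *\<^sub>R mollifier_grad \<epsilon> (x - y))"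
proof -
  have [measurable]: "f \<in> borel_measurable borel" using borel_measurable_integrable[OF f] by simp
  have "(\<lambda>k. LINT y|lborel. f y *\<^sub>R mollifier_grad \<epsilon> (s k - y)) \<longlonglongrightarrow> (LINT y|lborel. f y *\<^sub>R mollifier_grad \<epsilon> (x - y))"
    if s: "s \<longlonglongrightarrow> x" for s and x :: 'a
  proof (rule integral_dominated_convergence[where w = "\<lambda>y. \<bar>f y\<bar> * (4 * \<epsilon> ^ 3 / bump_mass TYPE('a) \<epsilon>)"])
    have "(\<lambda>k. mollifier_grad \<epsilon> (s k - y)) \<longlonglongrightarrow> mollifier_grad \<epsilon> (x - y)" for y
    proof -
      have "isCont (mollifier_grad \<epsilon>) (x - y)"
        using continuous_on_mollifier_grad[of UNIV] continuous_on_eq_continuous_at by blast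
      then show ?thesis by (rule isCont_tendsto_compose) (intro tendsto_intros s)
    qed
    then show "AE y in lborel. (\<lambda>k. f y *\<^sub>R mollifier_grad \<epsilon> (s k - y)) \<longlonglongrightarrow> f y *\<^sub>R mollifier_grad \<epsilon> (x - y)"
      by (intro AE_I2 tendsto_intros)
    show "AE y in lborel. norm (f y *\<^sub>R mollifier_grad \<epsilon> (s k - y)) \<le> \<bar>f y\<bar> * (4 * \<epsilon> ^ 3 / bump_mass TYPE('a) \<epsilon>)" for k
      by (intro AE_I2) (simp only: norm_scaleR, intro mult_left_mono mollifier_grad_bounded abs_ge_zero)
  qed (use f in auto)
  then show ?thesis by (auto simp: continuous_on_sequentially o_def)
qed

end

section \<open>Mollification in the p-th mean\<close>

lemma powr_add_le:
  fixes a b p :: real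
  assumes "0 \<le> a" "0 \<le> b" "0 < p"
  shows "(a + b) powr p \<le> 2 powr p * (a powr p + b powr p)"
proof -
  have "(a + b) powr p \<le> (2 * max a b) powr p" using assms by (intro powr_mono2) auto
  also have "\<dots> = 2 powr p * max a b powr p" using assms by (simp add: powr_mult)
  also have "max a b powr p \<le> a powr p + b powr p" by (auto simp: max_def)
  finally show ?thesis by simp
qed

text \<open>Jensen's inequality up to a constant: split the integrand at half its mean.\<close>

lemma powr_mollification_le:
  fixes r :: "'a::euclidean_space \<Rightarrow> 'a"
  assumes p: "1 < p" and \<epsilon>: "0 < \<epsilon>" and r: "integrable lborel r" "integrable lborel (\<lambda>y. norm (r y) powr p)"
  shows "norm (LINT y|lborel. mollifier \<epsilon> (x - y) *\<^sub>R r y) powr p \<le> 2 powr p * (LINT y|lborel. mollifier \<epsilon> (x - y) * norm (r y) powr p)"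
proof -
  have [measurable]: "mollifier \<epsilon> \<in> borel_measurable borel" by (rule mollifier_measurable[OF \<epsilon>])
  define m where "m = (LINT y|lborel. mollifier \<epsilon> (x - y) * norm (r y))"
  define J where "J = (LINT y|lborel. mollifier \<epsilon> (x - y) * norm (r y) powr p)"
  have \<rho>: "0 \<le> mollifier \<epsilon> z" for z :: 'a by (rule mollifier_nonneg[OF \<epsilon>])
  have bd: "\<bar>mollifier \<epsilon> (x - y)\<bar> \<le> \<epsilon> ^ 4 / bump_mass TYPE('a) \<epsilon>" for y by (rule mollifier_bounded[OF \<epsilon>])
  have i1: "integrable lborel (\<lambda>y. mollifier \<epsilon> (x - y) * norm (r y))"
    using integrable_scaleR_bounded[OF integrable_norm[OF r(1)] _ bd] by simp
  have i2: "integrable lborel (\<lambda>y. mollifier \<epsilon> (x - y) * norm (r y) powr p)"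
    using integrable_scaleR_bounded[OF r(2) _ bd] by simp
  have i0: "integrable lborel (\<lambda>y. mollifier \<epsilon> (x - y))" by (rule integral_mollifier_shift(1)[OF \<epsilon>])
  have m0: "0 \<le> m" unfolding m_def by (intro Bochner_Integration.integral_nonneg mult_nonneg_nonneg \<rho> norm_ge_zero)
  have J0: "0 \<le> J" unfolding J_def by (intro Bochner_Integration.integral_nonneg mult_nonneg_nonneg \<rho> powr_ge_zero)
  have "norm (LINT y|lborel. mollifier \<epsilon> (x - y) *\<^sub>R r y) \<le> (LINT y|lborel. norm (mollifier \<epsilon> (x - y) *\<^sub>R r y))"
    by (rule integral_norm_bound)
  also have "\<dots> = m" unfolding m_def by (simp add: \<rho>)
  finally have "norm (LINT y|lborel. mollifier \<epsilon> (x - y) *\<^sub>R r y) powr p \<le> m powr p"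
    using p by (intro powr_mono2) auto
  also have "\<dots> \<le> 2 powr p * J"
  proof (cases "m = 0")
    case False
    then have m: "m > 0" using m0 by simp
    \<comment> \<open>Values up to half the mean are covered by \<open>m / 2\<close>; above it,
      \<open>a = a powr (1 - p) * a powr p\<close> and the first factor decreases in
      \<open>a\<close>.\<close>
    have pt: "a \<le> m / 2 + (m / 2) powr (1 - p) * a powr p" if "0 \<le> a" for a
    proof (cases "a \<le> m / 2")
      case True
      then show ?thesis by (simp add: add_increasing2)
    next
      case False
      then have "a > 0" using m by linarith
      then have "a = a powr (1 - p) * a powr p" by (simp add: powr_add[symmetric])
      also have "\<dots> \<le> (m / 2) powr (1 - p) * a powr p"
        using False m p by (intro mult_right_mono powr_mono2') auto
      finally show ?thesis using m by simp
    qed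
    have "m \<le> (LINT y|lborel. mollifier \<epsilon> (x - y) * (m / 2) + (m / 2) powr (1 - p) * (mollifier \<epsilon> (x - y) * norm (r y) powr p))"
      unfolding m_def[symmetric]
    proof (subst (1) m_def, rule integral_mono)
      show "mollifier \<epsilon> (x - y) * norm (r y) \<le> mollifier \<epsilon> (x - y) * (m / 2) + (m / 2) powr (1 - p) * (mollifier \<epsilon> (x - y) * norm (r y) powr p)" for y
        using mult_left_mono[OF pt[of "norm (r y)"] \<rho>[of "x - y"]] by (simp add: algebra_simps)
    qed (use i0 i1 i2 in auto)
    also have "\<dots> = m / 2 + (m / 2) powr (1 - p) * J"
      using i0 i2 integral_mollifier_shift(2)[OF \<epsilon>, of x] by (simp add: J_def)
    finally have "m / 2 \<le> (m / 2) powr (1 - p) * J" by simp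
    then have "(m / 2) powr (p - 1) * (m / 2) \<le> (m / 2) powr (p - 1) * ((m / 2) powr (1 - p) * J)"
      by (intro mult_left_mono) auto
    also have "\<dots> = J" using m by (simp add: mult.assoc[symmetric] powr_add[symmetric])
    also have "(m / 2) powr (p - 1) * (m / 2) = (m / 2) powr p"
    proof -
      have *: "t powr (p - 1) * t = t powr p" if "t > 0" for t
        using powr_mult_base[of t "p - 1"] that by (simp add: mult.commute)
      show ?thesis by (rule *) (use m in simp)
    qed
    finally have "2 powr p * (m / 2) powr p \<le> 2 powr p * J" by simp
    then show ?thesis using m by (simp add: powr_mult[symmetric])
  qed (use J0 p in auto)
  finally show ?thesis by (simp add: J_def)
qed

text \<open>After the pointwise bound, Fubini integrates the kernel over its other variable, which
  by symmetry gives 1 again. The constant is independent of \<open>\<epsilon>\<close>, as the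
  approximation argument below demands.\<close>

lemma nn_integral_mollification_powr_le:
  fixes r :: "'a::euclidean_space \<Rightarrow> 'a"
  assumes p: "1 < p" and \<epsilon>: "0 < \<epsilon>" and r: "integrable lborel r" "integrable lborel (\<lambda>y. norm (r y) powr p)"
  shows "(\<integral>\<^sup>+x. ennreal (norm (LINT y|lborel. mollifier \<epsilon> (x - y) *\<^sub>R r y) powr p) \<partial>lborel)
    \<le> ennreal (2 powr p) * (\<integral>\<^sup>+y. ennreal (norm (r y) powr p) \<partial>lborel)"
proof -
  have [measurable]: "mollifier \<epsilon> \<in> borel_measurable borel" by (rule mollifier_measurable[OF \<epsilon>])
  have [measurable]: "r \<in> borel_measurable borel" using borel_measurable_integrable[OF r(1)] by simp
  have \<rho>: "0 \<le> mollifier \<epsilon> z" for z :: 'a by (rule mollifier_nonneg[OF \<epsilon>])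
  have bd: "\<bar>mollifier \<epsilon> (x - y)\<bar> \<le> \<epsilon> ^ 4 / bump_mass TYPE('a) \<epsilon>" for x y :: 'a by (rule mollifier_bounded[OF \<epsilon>])
  have i2: "integrable lborel (\<lambda>y. mollifier \<epsilon> (x - y) * norm (r y) powr p)" for x
    using integrable_scaleR_bounded[OF r(2) _ bd] by simp
  have "(\<integral>\<^sup>+x. ennreal (norm (LINT y|lborel. mollifier \<epsilon> (x - y) *\<^sub>R r y) powr p) \<partial>lborel)
    \<le> (\<integral>\<^sup>+x. ennreal (2 powr p) * (\<integral>\<^sup>+y. ennreal (mollifier \<epsilon> (x - y) * norm (r y) powr p) \<partial>lborel) \<partial>lborel)"
  proof (rule nn_integral_mono)
    fix x :: 'a
    have "ennreal (norm (LINT y|lborel. mollifier \<epsilon> (x - y) *\<^sub>R r y) powr p) \<le>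
      ennreal (2 powr p * (LINT y|lborel. mollifier \<epsilon> (x - y) * norm (r y) powr p))"
      by (rule ennreal_leI[OF powr_mollification_le[OF p \<epsilon> r]])
    also have "\<dots> = ennreal (2 powr p) * (\<integral>\<^sup>+y. ennreal (mollifier \<epsilon> (x - y) * norm (r y) powr p) \<partial>lborel)"
      using i2[of x] \<rho> by (subst nn_integral_eq_integral) (auto simp: ennreal_mult')
    finally show "ennreal (norm (LINT y|lborel. mollifier \<epsilon> (x - y) *\<^sub>R r y) powr p) \<le> ennreal (2 powr p) * (\<integral>\<^sup>+y. ennreal (mollifier \<epsilon> (x - y) * norm (r y) powr p) \<partial>lborel)" .
  qed
  also have "\<dots> = ennreal (2 powr p) * (\<integral>\<^sup>+x. (\<integral>\<^sup>+y. ennreal (mollifier \<epsilon> (x - y) * norm (r y) powr p) \<partial>lborel) \<partial>lborel)"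
    by (rule nn_integral_cmult) measurable
  also have "(\<integral>\<^sup>+x. (\<integral>\<^sup>+y. ennreal (mollifier \<epsilon> (x - y) * norm (r y) powr p) \<partial>lborel) \<partial>lborel) =
    (\<integral>\<^sup>+y. (\<integral>\<^sup>+x. ennreal (mollifier \<epsilon> (x - y) * norm (r y) powr p) \<partial>lborel) \<partial>lborel)"
    by (rule lborel_pair.Fubini'[symmetric]) measurable
  also have "\<dots> = (\<integral>\<^sup>+y. ennreal (norm (r y) powr p) \<partial>lborel)"
  proof (rule nn_integral_cong)
    fix y :: 'a
    have "(\<integral>\<^sup>+x. ennreal (mollifier \<epsilon> (x - y) * norm (r y) powr p) \<partial>lborel) =
      (\<integral>\<^sup>+x. ennreal (mollifier \<epsilon> (y - x)) * ennreal (norm (r y) powr p) \<partial>lborel)"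
      by (rule nn_integral_cong) (simp add: mollifier_reflect[OF \<epsilon>, of _ y] ennreal_mult' \<rho>)
    also have "\<dots> = (\<integral>\<^sup>+x. ennreal (mollifier \<epsilon> (y - x)) \<partial>lborel) * ennreal (norm (r y) powr p)"
      by (rule nn_integral_multc) measurable
    also have "(\<integral>\<^sup>+x. ennreal (mollifier \<epsilon> (y - x)) \<partial>lborel) = 1"
      using integral_mollifier_shift[OF \<epsilon>, of y] \<rho> by (subst nn_integral_eq_integral) auto
    finally show "(\<integral>\<^sup>+x. ennreal (mollifier \<epsilon> (x - y) * norm (r y) powr p) \<partial>lborel) = ennreal (norm (r y) powr p)" by simp
  qed
  finally show ?thesis .
qed

text \<open>As \<open>cball x \<epsilon> \<subseteq> K\<close>, the cutoff by
  \<open>indicator K\<close> is invisible at \<open>x\<close>, and one modulus of uniform continuity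
  serves all such points.\<close>

lemma mollification_uniform:
  fixes g :: "'a::euclidean_space \<Rightarrow> 'b::euclidean_space"
  assumes K: "compact K" and g: "continuous_on K g" and e: "0 < e"
  obtains d where "0 < d" "\<And>\<epsilon> x. 0 < \<epsilon> \<Longrightarrow> \<epsilon> < d \<Longrightarrow> cball x \<epsilon> \<subseteq> K \<Longrightarrow>
     norm ((LINT y|lborel. mollifier \<epsilon> (x - y) *\<^sub>R (indicator K y *\<^sub>R g y)) - g x) \<le> e"
proof -
  have ig: "integrable lborel (\<lambda>y. indicator K y *\<^sub>R g y)" using borel_integrable_compact[OF K g] .
  obtain d where d: "0 < d" "\<And>x y. x \<in> K \<Longrightarrow> y \<in> K \<Longrightarrow> dist y x < d \<Longrightarrow> dist (g y) (g x) < e"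
    using compact_uniformly_continuous[OF g K] e unfolding uniformly_continuous_on_def by metis
  show ?thesis
  proof (rule that[OF d(1)])
    fix \<epsilon> x assume \<epsilon>: "0 < \<epsilon>" "\<epsilon> < d" and x: "cball x \<epsilon> \<subseteq> K"
    have xK: "x \<in> K" using x \<epsilon> by auto
    have [measurable]: "mollifier \<epsilon> \<in> borel_measurable borel" by (rule mollifier_measurable[OF \<epsilon>(1)])
    have i0: "integrable lborel (\<lambda>y. mollifier \<epsilon> (x - y))" by (rule integral_mollifier_shift(1)[OF \<epsilon>(1)])
    have i1: "integrable lborel (\<lambda>y. mollifier \<epsilon> (x - y) *\<^sub>R (indicator K y *\<^sub>R g y))"
      by (rule integrable_scaleR_bounded[OF ig _ mollifier_bounded[OF \<epsilon>(1)]]) measurable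
    have i2: "integrable lborel (\<lambda>y. mollifier \<epsilon> (x - y) *\<^sub>R g x)" using i0 by simp
    have "(LINT y|lborel. mollifier \<epsilon> (x - y) *\<^sub>R g x) = g x"
      using integral_mollifier_shift[OF \<epsilon>(1), of x] by simp
    then have "(LINT y|lborel. mollifier \<epsilon> (x - y) *\<^sub>R (indicator K y *\<^sub>R g y)) - g x =
      (LINT y|lborel. mollifier \<epsilon> (x - y) *\<^sub>R (indicator K y *\<^sub>R g y) - mollifier \<epsilon> (x - y) *\<^sub>R g x)"
      using i1 i2 by simp
    also have "norm \<dots> \<le> (LINT y|lborel. mollifier \<epsilon> (x - y) * e)"
    proof (rule Bochner_Integration.integral_norm_bound_integral)
      show "norm (mollifier \<epsilon> (x - y) *\<^sub>R (indicator K y *\<^sub>R g y) - mollifier \<epsilon> (x - y) *\<^sub>R g x) \<le> mollifier \<epsilon> (x - y) * e" for y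
      proof (cases "norm (x - y) \<ge> \<epsilon>")
        case True
        then show ?thesis by (simp add: mollifier_eq_0[OF \<epsilon>(1)])
      next
        case False
        then have y: "y \<in> K" using x by (auto simp: dist_norm)
        have "norm (g y - g x) \<le> e"
          using d(2)[OF xK y] False \<epsilon> by (simp add: dist_norm norm_minus_commute)
        then show ?thesis using y mollifier_nonneg[OF \<epsilon>(1), of "x - y"]
          by (simp add: scaleR_diff_right[symmetric] mult_left_mono)
      qed
    qed (use i0 i1 i2 in auto)
    also have "\<dots> = e" using i0 integral_mollifier_shift(2)[OF \<epsilon>(1), of x] by simp
    finally show "norm ((LINT y|lborel. mollifier \<epsilon> (x - y) *\<^sub>R (indicator K y *\<^sub>R g y)) - g x) \<le> e" .
  qed
qed

lemma powr_integrable_imp_integrable: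
  fixes f :: "'a::euclidean_space \<Rightarrow> 'a"
  assumes p: "1 < p" and K: "compact K" and f: "f \<in> borel_measurable borel" "\<And>x. x \<notin> K \<Longrightarrow> f x = 0"
    and int: "integrable lborel (\<lambda>x. norm (f x) powr p)"
  shows "integrable lborel f"
proof (rule Bochner_Integration.integrable_bound)
  have "integrable lborel (\<lambda>x. indicator K x *\<^sub>R (1::real))"
    by (rule borel_integrable_compact[OF K]) simp
  then show "integrable lborel (\<lambda>x. indicator K x *\<^sub>R 1 + norm (f x) powr p)" using int by simp
  show "AE x in lborel. norm (f x) \<le> norm (indicator K x *\<^sub>R 1 + norm (f x) powr p)"
  proof (intro AE_I2)
    fix x
    have "norm (f x) \<le> 1 + norm (f x) powr p"
    proof (cases "norm (f x) \<le> 1")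
      case False
      then have "norm (f x) powr 1 \<le> norm (f x) powr p" using p by (intro powr_mono) auto
      then show ?thesis using False by simp
    qed (simp add: add_increasing2)
    then show "norm (f x) \<le> norm (indicator K x *\<^sub>R 1 + norm (f x) powr p)"
      using f(2)[of x] by (cases "x \<in> K") auto
  qed
qed (use f in auto)

text \<open>A measurable function is almost everywhere a limit of continuous functions, but without
  a dominating bound. Projecting the values onto a large ball, a continuous map, truncates the
  function and its approximants alike, so that dominated convergence applies.\<close>

lemma continuous_dense_powr:
  fixes f :: "'a::euclidean_space \<Rightarrow> 'a"
  assumes p: "1 < p" and K: "compact K" and f: "f \<in> borel_measurable borel"
    and int: "integrable lborel (\<lambda>x. indicator K x * norm (f x) powr p)" and \<theta>: "0 < \<theta>"
  obtains g where "continuous_on UNIV g" "integrable lborel (\<lambda>x. indicator K x * norm (f x - g x) powr p)"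
    "(LINT x|lborel. indicator K x * norm (f x - g x) powr p) \<le> \<theta>"
proof -
  note [measurable] = f
  have [measurable]: "K \<in> sets borel" using K by (simp add: borel_compact)
  define cl :: "nat \<Rightarrow> 'a \<Rightarrow> 'a" where "cl k = closest_point (cball 0 (real k))" for k
  have contcl: "continuous_on UNIV (cl k)" for k
    unfolding cl_def by (intro continuous_on_closest_point) auto
  then have [measurable]: "cl k \<in> borel_measurable borel" for k
    by (intro borel_measurable_continuous_onI)
  have cl_le: "norm (cl k v) \<le> real k" for k v
    using closest_point_in_set[of "cball (0::'a) (real k)" v] by (simp add: cl_def)
  have cl_diff: "norm (v - cl k v) \<le> norm v" for k v
    using closest_point_le[of "cball 0 (real k)" "0::'a" v] by (simp add: cl_def dist_norm)
  have cl_eq: "cl k v = v" if "norm v \<le> real k" for k v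
    using that closest_point_self[of v "cball 0 (real k)"] by (simp add: cl_def)
  have "(\<lambda>k. LINT x|lborel. indicator K x * norm (f x - cl k (f x)) powr p) \<longlonglongrightarrow> (LINT x|(lborel::'a measure). 0)"
  proof (rule integral_dominated_convergence[where w = "\<lambda>x. indicator K x * norm (f x) powr p"])
    show "AE x in lborel. (\<lambda>k. indicator K x * norm (f x - cl k (f x)) powr p) \<longlonglongrightarrow> 0"
    proof (intro AE_I2)
      fix x
      have "\<forall>\<^sub>F k in sequentially. indicator K x * norm (f x - cl k (f x)) powr p = 0"
        using eventually_ge_at_top[of "nat \<lceil>norm (f x)\<rceil>"]
        by eventually_elim (subst cl_eq, auto simp: nat_ceiling_le_eq)
      then show "(\<lambda>k. indicator K x * norm (f x - cl k (f x)) powr p) \<longlonglongrightarrow> 0"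
        by (rule tendsto_eventually)
    qed
    show "AE x in lborel. norm (indicator K x * norm (f x - cl k (f x)) powr p) \<le> indicator K x * norm (f x) powr p" for k
      using cl_diff p by (intro AE_I2) (auto simp: indicator_def intro!: powr_mono2)
  qed (use int in auto)
  then have "\<forall>\<^sub>F k in sequentially. (LINT x|lborel. indicator K x * norm (f x - cl k (f x)) powr p) < \<theta> / (2 * 2 powr p)"
    using \<theta> by (intro order_tendstoD(2)[of _ 0]) auto
  then obtain k where k: "(LINT x|lborel. indicator K x * norm (f x - cl k (f x)) powr p) < \<theta> / (2 * 2 powr p)"
    using eventually_happens trivial_limit_sequentially by blast
  have "f \<in> borel_measurable lebesgue" using f by (simp add: measurable_completion)
  then have "f measurable_on UNIV" by (rule lebesgue_measurable_imp_measurable_on) simp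
  then obtain N h where N: "negligible N" and h: "\<And>n. continuous_on UNIV (h n)"
    and lim: "\<And>x. x \<notin> N \<Longrightarrow> (\<lambda>n. h n x) \<longlonglongrightarrow> f x"
    unfolding measurable_on_def by auto
  have conth: "continuous_on UNIV (\<lambda>x. cl k (h n x))" for n
    by (rule continuous_on_compose2[OF contcl h]) auto
  have [measurable]: "h n \<in> borel_measurable borel" for n
    using h by (intro borel_measurable_continuous_onI)
  have "N \<in> null_sets lebesgue" using N by (simp add: negligible_iff_null_sets)
  then have "AE x in lebesgue. x \<notin> N" by (rule AE_not_in)
  then have N': "AE x in lborel. x \<notin> N" by (simp add: AE_completion_iff)
  have iK: "integrable lborel (\<lambda>x. indicator K x * (2 * real k) powr p)"
    using borel_integrable_compact[OF K, of "\<lambda>_. (2 * real k) powr p"] by simp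
  have bnd: "norm (indicator K x * norm (cl k (f x) - cl k (h n x)) powr p) \<le> indicator K x * (2 * real k) powr p" for n x
  proof -
    have "norm (cl k (f x) - cl k (h n x)) \<le> 2 * real k"
      using norm_triangle_ineq4[of "cl k (f x)" "cl k (h n x)"] cl_le[of k "f x"] cl_le[of k "h n x"] by linarith
    then have "norm (cl k (f x) - cl k (h n x)) powr p \<le> (2 * real k) powr p" using p by (intro powr_mono2) auto
    then show ?thesis by (auto simp: indicator_def)
  qed
  have "(\<lambda>n. LINT x|lborel. indicator K x * norm (cl k (f x) - cl k (h n x)) powr p) \<longlonglongrightarrow> (LINT x|(lborel::'a measure). 0)"
  proof (rule integral_dominated_convergence[where w = "\<lambda>x. indicator K x * (2 * real k) powr p"])
    show "AE x in lborel. (\<lambda>n. indicator K x * norm (cl k (f x) - cl k (h n x)) powr p) \<longlonglongrightarrow> 0"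
      using N'
    proof eventually_elim
      case (elim x)
      have "isCont (cl k) (f x)" using contcl continuous_on_eq_continuous_at by blast
      then have "(\<lambda>n. cl k (h n x)) \<longlonglongrightarrow> cl k (f x)" using lim[OF elim] by (rule isCont_tendsto_compose)
      then have "(\<lambda>n. norm (cl k (f x) - cl k (h n x))) \<longlonglongrightarrow> norm (cl k (f x) - cl k (f x))"
        by (intro tendsto_intros)
      then have "(\<lambda>n. norm (cl k (f x) - cl k (h n x)) powr p) \<longlonglongrightarrow> 0"
        using tendsto_powr2[of "\<lambda>n. norm (cl k (f x) - cl k (h n x))" 0 sequentially "\<lambda>_. p" p] p by simp
      then show ?case by (rule tendsto_mult_right_zero)
    qed
    show "AE x in lborel. norm (indicator K x * norm (cl k (f x) - cl k (h n x)) powr p) \<le> indicator K x * (2 * real k) powr p" for n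
      by (intro AE_I2 bnd)
  qed (use iK in auto)
  then have "\<forall>\<^sub>F n in sequentially. (LINT x|lborel. indicator K x * norm (cl k (f x) - cl k (h n x)) powr p) < \<theta> / (2 * 2 powr p)"
    using \<theta> by (intro order_tendstoD(2)[of _ 0]) auto
  then obtain n where n: "(LINT x|lborel. indicator K x * norm (cl k (f x) - cl k (h n x)) powr p) < \<theta> / (2 * 2 powr p)"
    using eventually_happens trivial_limit_sequentially by blast
  have i1: "integrable lborel (\<lambda>x. indicator K x * norm (f x - cl k (f x)) powr p)"
    by (rule Bochner_Integration.integrable_bound[OF int], measurable)
       (use cl_diff p in \<open>auto simp: indicator_def intro!: AE_I2 powr_mono2\<close>)
  have i2: "integrable lborel (\<lambda>x. indicator K x * norm (cl k (f x) - cl k (h n x)) powr p)"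
    by (rule Bochner_Integration.integrable_bound[OF iK], measurable)
      (use bnd in \<open>auto intro!: AE_I2 order_trans[OF bnd abs_ge_self]\<close>)
  have pt: "indicator K x * norm (f x - cl k (h n x)) powr p \<le> 2 powr p * (indicator K x * norm (f x - cl k (f x)) powr p
     + indicator K x * norm (cl k (f x) - cl k (h n x)) powr p)" for x
  proof -
    have "norm (f x - cl k (h n x)) powr p \<le> (norm (f x - cl k (f x)) + norm (cl k (f x) - cl k (h n x))) powr p"
      using p norm_triangle_ineq[of "f x - cl k (f x)" "cl k (f x) - cl k (h n x)"] by (intro powr_mono2) auto
    also have "\<dots> \<le> 2 powr p * (norm (f x - cl k (f x)) powr p + norm (cl k (f x) - cl k (h n x)) powr p)"
      using p by (intro powr_add_le) auto
    finally show ?thesis by (auto simp: indicator_def)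
  qed
  have i12: "integrable lborel (\<lambda>x. 2 powr p * (indicator K x * norm (f x - cl k (f x)) powr p
     + indicator K x * norm (cl k (f x) - cl k (h n x)) powr p))"
    using i1 i2 by simp
  have i3: "integrable lborel (\<lambda>x. indicator K x * norm (f x - cl k (h n x)) powr p)"
    by (rule Bochner_Integration.integrable_bound[OF i12], measurable)
      (intro AE_I2, use pt in \<open>simp add: order_trans[OF pt abs_ge_self]\<close>)
  show ?thesis
  proof (rule that[OF conth i3])
    have "(LINT x|lborel. indicator K x * norm (f x - cl k (h n x)) powr p) \<le>
      (LINT x|lborel. 2 powr p * (indicator K x * norm (f x - cl k (f x)) powr p
     + indicator K x * norm (cl k (f x) - cl k (h n x)) powr p))"
      using i3 i12 pt by (rule integral_mono)
    also have "\<dots> = 2 powr p * ((LINT x|lborel. indicator K x * norm (f x - cl k (f x)) powr p) +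
       (LINT x|lborel. indicator K x * norm (cl k (f x) - cl k (h n x)) powr p))"
      using i1 i2 by simp
    also have "\<dots> \<le> 2 powr p * (\<theta> / (2 * 2 powr p) + \<theta> / (2 * 2 powr p))"
      using k n by (intro mult_left_mono) auto
    also have "\<dots> = \<theta>" by (simp add: field_simps)
    finally show "(LINT x|lborel. indicator K x * norm (f x - cl k (h n x)) powr p) \<le> \<theta>" .
  qed
qed

text \<open>Split \<open>f\<close> on \<open>K'\<close> into a continuous \<open>g\<close> and a
  remainder \<open>r\<close> that is small in the p-th mean. The mollifications of \<open>g\<close>
  converge uniformly on \<open>K\<close>, while those of \<open>r\<close> stay small uniformly in
  \<open>\<epsilon>\<close>.\<close>

lemma mollification_powr_converges:
  fixes f :: "'a::euclidean_space \<Rightarrow> 'a"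
  assumes p: "1 < p" and K: "compact K" "compact K'" and d: "0 < d" "\<And>x. x \<in> K \<Longrightarrow> cball x d \<subseteq> K'"
    and f: "f \<in> borel_measurable borel" "\<And>x. x \<notin> K' \<Longrightarrow> f x = 0"
    and int: "integrable lborel (\<lambda>x. norm (f x) powr p)" and e: "0 < e"
  obtains d' where "0 < d'" "\<And>\<epsilon>. 0 < \<epsilon> \<Longrightarrow> \<epsilon> < d' \<Longrightarrow>
     (LINT x|lborel. indicator K x * norm ((LINT y|lborel. mollifier \<epsilon> (x - y) *\<^sub>R f y) - f x) powr p) \<le> e"
proof -
  note [measurable] = f(1)
  have [measurable]: "K \<in> sets borel" "K' \<in> sets borel" using K by (auto simp: borel_compact)
  define c where "c = 2 powr p"
  have c: "c > 0" by (simp add: c_def)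
  define \<mu> where "\<mu> = measure lborel K"
  \<comment> \<open>The final bound has the terms \<open>c\<^sup>2 * \<theta>\<close> from the
    mollified remainder, \<open>c\<^sup>2 * \<eta> powr p * \<mu>\<close> from the continuous part
    and \<open>c\<^sup>2 * \<theta>\<close> from the remainder itself. They receive
    \<open>e / 4\<close>, \<open>e / 2\<close> and \<open>e / 4\<close>; \<open>\<mu> + 1\<close>
    covers a set \<open>K\<close> of measure 0.\<close>
  define \<theta> where "\<theta> = e / (4 * c\<^sup>2)"
  define \<eta> where "\<eta> = (e / (2 * c\<^sup>2 * (\<mu> + 1))) powr (1 / p)"
  have \<mu>: "\<mu> \<ge> 0" by (simp add: \<mu>_def)
  have \<theta>: "\<theta> > 0" using e c by (simp add: \<theta>_def)
  have \<eta>: "\<eta> > 0" "\<eta> powr p = e / (2 * c\<^sup>2 * (\<mu> + 1))"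
    using e c \<mu> p by (auto simp: \<eta>_def powr_powr add_nonneg_pos)
  have intK': "integrable lborel (\<lambda>x. indicator K' x * norm (f x) powr p)"
    using integrable_scaleR_bounded[OF int, of "indicator K'" 1] by (simp add: indicator_def)
  obtain g where g: "continuous_on UNIV g" "integrable lborel (\<lambda>x. indicator K' x * norm (f x - g x) powr p)"
    "(LINT x|lborel. indicator K' x * norm (f x - g x) powr p) \<le> \<theta>"
    using continuous_dense_powr[OF p K(2) f(1) intK' \<theta>] by blast
  have [measurable]: "g \<in> borel_measurable borel" using g(1) by (intro borel_measurable_continuous_onI)
  have gK: "continuous_on K' g" using g(1) continuous_on_subset by blast
  define r where "r y = indicator K' y *\<^sub>R (f y - g y)" for y
  have [measurable]: "r \<in> borel_measurable borel" unfolding r_def[abs_def] by measurable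
  have rp: "norm (r x) powr p = indicator K' x * norm (f x - g x) powr p" for x
    using p by (auto simp: r_def indicator_def)
  have ir: "integrable lborel (\<lambda>x. norm (r x) powr p)" using g(2) by (simp add: rp)
  have ir1: "integrable lborel r"
    by (rule powr_integrable_imp_integrable[OF p K(2) _ _ ir]) (auto simp: r_def)
  have nr: "(\<integral>\<^sup>+y. ennreal (norm (r y) powr p) \<partial>lborel) \<le> ennreal \<theta>"
    using g(3) by (subst nn_integral_eq_integral[OF ir]) (auto simp: rp intro: ennreal_leI)
  have ig: "integrable lborel (\<lambda>y. indicator K' y *\<^sub>R g y)" by (rule borel_integrable_compact[OF K(2) gK])
  obtain d1 where d1: "0 < d1" "\<And>\<epsilon> x. 0 < \<epsilon> \<Longrightarrow> \<epsilon> < d1 \<Longrightarrow> cball x \<epsilon> \<subseteq> K' \<Longrightarrow>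
     norm ((LINT y|lborel. mollifier \<epsilon> (x - y) *\<^sub>R (indicator K' y *\<^sub>R g y)) - g x) \<le> \<eta>"
    using mollification_uniform[OF K(2) gK \<eta>(1)] by blast
  show ?thesis
  proof (rule that[of "min d d1"])
    show "0 < min d d1" using d d1 by simp
    fix \<epsilon> assume \<epsilon>: "0 < \<epsilon>" "\<epsilon> < min d d1"
    have [measurable]: "mollifier \<epsilon> \<in> borel_measurable borel" by (rule mollifier_measurable[OF \<epsilon>(1)])
    define Q where "Q x = indicator K x * norm ((LINT y|lborel. mollifier \<epsilon> (x - y) *\<^sub>R f y) - f x) powr p" for x
    have [measurable]: "Q \<in> borel_measurable borel" unfolding Q_def[abs_def] by measurable
    define R where "R x = (LINT y|lborel. mollifier \<epsilon> (x - y) *\<^sub>R r y)" for x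
    have [measurable]: "R \<in> borel_measurable borel" unfolding R_def[abs_def] by measurable
    have i1: "integrable lborel (\<lambda>y. mollifier \<epsilon> (x - y) *\<^sub>R r y)" for x
      by (rule integrable_scaleR_bounded[OF ir1 _ mollifier_bounded[OF \<epsilon>(1)]]) measurable
    have i2: "integrable lborel (\<lambda>y. mollifier \<epsilon> (x - y) *\<^sub>R (indicator K' y *\<^sub>R g y))" for x
      by (rule integrable_scaleR_bounded[OF ig _ mollifier_bounded[OF \<epsilon>(1)]]) measurable
    have Qle: "Q x \<le> c * norm (R x) powr p + c\<^sup>2 * \<eta> powr p * indicator K x + c\<^sup>2 * norm (r x) powr p" for x
    proof (cases "x \<in> K")
      case True
      have sub: "cball x \<epsilon> \<subseteq> K'" using d(2)[OF True] \<epsilon> by (auto simp: subset_eq)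
      have xK': "x \<in> K'" using sub \<epsilon> by auto
      have "(LINT y|lborel. mollifier \<epsilon> (x - y) *\<^sub>R f y) = (LINT y|lborel. mollifier \<epsilon> (x - y) *\<^sub>R r y + mollifier \<epsilon> (x - y) *\<^sub>R (indicator K' y *\<^sub>R g y))"
        by (rule Bochner_Integration.integral_cong[OF refl]) (use f(2) in \<open>auto simp: r_def indicator_def algebra_simps\<close>)
      also have "\<dots> = R x + (LINT y|lborel. mollifier \<epsilon> (x - y) *\<^sub>R (indicator K' y *\<^sub>R g y))"
        using i1 i2 by (simp add: R_def)
      finally have eq: "(LINT y|lborel. mollifier \<epsilon> (x - y) *\<^sub>R f y) - f x = R x + (((LINT y|lborel. mollifier \<epsilon> (x - y) *\<^sub>R (indicator K' y *\<^sub>R g y)) - g x) - r x)"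
        using xK' by (simp add: r_def)
      have X: "norm (X - g x) \<le> \<eta> \<Longrightarrow> norm (R x + ((X - g x) - r x)) \<le> norm (R x) + (\<eta> + norm (r x))" for X
        using norm_triangle_ineq[of "R x" "(X - g x) - r x"] norm_triangle_ineq4[of "X - g x" "r x"] by linarith
      have "norm ((LINT y|lborel. mollifier \<epsilon> (x - y) *\<^sub>R f y) - f x) \<le> norm (R x) + (\<eta> + norm (r x))"
        unfolding eq by (rule X[OF d1(2)[OF \<epsilon>(1) _ sub]]) (use \<epsilon>(2) in simp)
      then have "Q x \<le> (norm (R x) + (\<eta> + norm (r x))) powr p"
        using True p by (simp add: Q_def powr_mono2)
      also have "\<dots> \<le> c * (norm (R x) powr p + (\<eta> + norm (r x)) powr p)"
        unfolding c_def using p \<eta> by (intro powr_add_le) auto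
      also have "\<dots> \<le> c * (norm (R x) powr p + c * (\<eta> powr p + norm (r x) powr p))"
        using p \<eta> c powr_add_le[of \<eta> "norm (r x)" p] by (intro mult_left_mono add_left_mono) (auto simp: c_def)
      finally show ?thesis using True by (simp add: algebra_simps power2_eq_square)
    next
      case False
      then show ?thesis using c by (simp add: Q_def)
    qed
    have Q0: "0 \<le> Q x" for x by (simp add: Q_def)
    have "(\<integral>\<^sup>+x. ennreal (Q x) \<partial>lborel) \<le> (\<integral>\<^sup>+x. ennreal c * ennreal (norm (R x) powr p) + (ennreal (c\<^sup>2 * \<eta> powr p) * indicator K x + ennreal (c\<^sup>2) * ennreal (norm (r x) powr p)) \<partial>lborel)"
    proof (rule nn_integral_mono)
      fix x
      have "ennreal (Q x) \<le> ennreal (c * norm (R x) powr p + (c\<^sup>2 * \<eta> powr p * indicator K x + c\<^sup>2 * norm (r x) powr p))"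
        using Qle[of x] by (intro ennreal_leI) simp
      also have "\<dots> = ennreal c * ennreal (norm (R x) powr p) + (ennreal (c\<^sup>2 * \<eta> powr p) * indicator K x + ennreal (c\<^sup>2) * ennreal (norm (r x) powr p))"
        using c by (cases "x \<in> K") (simp_all add: ennreal_mult')
      finally show "ennreal (Q x) \<le> ennreal c * ennreal (norm (R x) powr p) + (ennreal (c\<^sup>2 * \<eta> powr p) * indicator K x + ennreal (c\<^sup>2) * ennreal (norm (r x) powr p))" .
    qed
    also have "\<dots> = ennreal c * (\<integral>\<^sup>+x. ennreal (norm (R x) powr p) \<partial>lborel) + (ennreal (c\<^sup>2 * \<eta> powr p) * emeasure lborel K + ennreal (c\<^sup>2) * (\<integral>\<^sup>+x. ennreal (norm (r x) powr p) \<partial>lborel))"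
      by (simp add: nn_integral_add nn_integral_cmult nn_integral_cmult_indicator)
    also have "\<dots> \<le> ennreal c * (ennreal c * ennreal \<theta>) + (ennreal (c\<^sup>2 * \<eta> powr p) * ennreal \<mu> + ennreal (c\<^sup>2) * ennreal \<theta>)"
    proof (intro add_mono mult_left_mono)
      show "(\<integral>\<^sup>+x. ennreal (norm (R x) powr p) \<partial>lborel) \<le> ennreal c * ennreal \<theta>"
        using nn_integral_mollification_powr_le[OF p \<epsilon>(1) ir1 ir] nr unfolding R_def c_def
        by (meson mult_left_mono order_trans zero_le)
      have "emeasure lborel K < \<infinity>" by (rule emeasure_bounded_finite[OF compact_imp_bounded[OF K(1)]])
      then show "emeasure lborel K \<le> ennreal \<mu>" unfolding \<mu>_def by (subst emeasure_eq_ennreal_measure) auto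
    qed (use nr in auto)
    also have "\<dots> = ennreal (c * (c * \<theta>) + (c\<^sup>2 * \<eta> powr p * \<mu> + c\<^sup>2 * \<theta>))"
      using c \<theta> \<mu> by (simp add: ennreal_mult')
    also have "\<dots> \<le> ennreal e"
    proof (rule ennreal_leI)
      have "c * (c * \<theta>) = e / 4" "c\<^sup>2 * \<theta> = e / 4" using c by (auto simp: \<theta>_def power2_eq_square)
      moreover have "c\<^sup>2 * \<eta> powr p * \<mu> \<le> e / 2"
      proof -
        have "c\<^sup>2 * \<eta> powr p * \<mu> = e / 2 * (\<mu> / (\<mu> + 1))" using c by (simp add: \<eta>(2))
        also have "\<dots> \<le> e / 2 * 1" using e \<mu> by (intro mult_left_mono) auto
        finally show ?thesis by simp
      qed
      ultimately show "c * (c * \<theta>) + (c\<^sup>2 * \<eta> powr p * \<mu> + c\<^sup>2 * \<theta>) \<le> e" by linarith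
    qed
    finally have "(\<integral>\<^sup>+x. ennreal (Q x) \<partial>lborel) \<le> ennreal e" .
    then have "(LINT x|lborel. Q x) \<le> e"
      using Q0 e by (subst integral_eq_nn_integral) (auto intro: enn2real_leI)
    then show "(LINT x|lborel. indicator K x * norm ((LINT y|lborel. mollifier \<epsilon> (x - y) *\<^sub>R f y) - f x) powr p) \<le> e"
      by (simp add: Q_def)
  qed
qed

section \<open>Smooth approximation of local Sobolev functions\<close>

lemma borel_representative:
  fixes f :: "'a::euclidean_space \<Rightarrow> 'b::euclidean_space"
  assumes "f \<in> borel_measurable lebesgue"
  obtains g where "g \<in> borel_measurable borel" "AE x in lebesgue. f x = g x"
proof -
  have "\<exists>h\<in>borel_measurable lborel. AE x in lborel. f x \<bullet> b = h x" for b
    using assms by (intro completion_ex_borel_measurable_real) simp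
  then obtain h where h: "\<And>b. h b \<in> borel_measurable lborel" "\<And>b. AE x in lborel. f x \<bullet> b = h b x"
    by metis
  define g where "g x = (\<Sum>b\<in>Basis. h b x *\<^sub>R b)" for x
  have "g \<in> borel_measurable borel" unfolding g_def[abs_def] using h(1) by (intro borel_measurable_sum) simp
  moreover have "AE x in lborel. \<forall>b\<in>Basis. f x \<bullet> b = h b x"
    using h(2) by (intro AE_finite_allI) auto
  then have "AE x in lborel. f x = g x"
  proof eventually_elim
    case (elim x)
    have "f x = (\<Sum>b\<in>Basis. (f x \<bullet> b) *\<^sub>R b)" by (simp add: euclidean_representation)
    also have "\<dots> = g x" unfolding g_def using elim by (intro sum.cong) auto
    finally show ?case .
  qed
  then have "AE x in lebesgue. f x = g x" by (rule AE_completion)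
  ultimately show ?thesis using that by blast
qed

text \<open>For \<open>x\<close> in \<open>K\<close> the kernel centred at \<open>x\<close> is an
  admissible test function on \<open>\<Omega>\<close>, and the definition of the weak gradient then
  says that the gradient of the mollified \<open>u\<close> is the mollified \<open>G\<close>.
  Continuity of \<open>u\<close> gives uniform convergence of the values, the p-integrability of
  \<open>G\<close> convergence of the gradients in the p-th mean.\<close>

lemma W1p_loc_smooth_approximation:
  fixes u :: "'a::euclidean_space \<Rightarrow> real"
  assumes p: "1 < p" and \<Omega>: "open \<Omega>" and u: "continuous_on \<Omega> u" and W: "W1p_loc p \<Omega> u G"
    and K: "compact K" "K \<subseteq> \<Omega>"
  obtains v :: "nat \<Rightarrow> 'a \<Rightarrow> real" and Gh where
    "\<And>k x. v k differentiable (at x)" "\<And>k. continuous_on UNIV (grad (v k))"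
    "\<And>e. e > 0 \<Longrightarrow> \<forall>\<^sub>F k in sequentially. \<forall>x\<in>K. \<bar>v k x - u x\<bar> \<le> e"
    "Gh \<in> borel_measurable borel" "AE x in lebesgue. x \<in> K \<longrightarrow> G x = Gh x"
    "integrable lborel (\<lambda>x. indicator K x * norm (Gh x) powr p)"
    "(\<lambda>k. LINT x|lborel. indicator K x * norm (grad (v k) x - Gh x) powr p) \<longlonglongrightarrow> 0"
proof -
  obtain d where d: "d > 0" "(\<Union>x\<in>K. cball x d) \<subseteq> \<Omega>"
    using compact_subset_open_imp_cball_epsilon_subset[OF K(1) \<Omega> K(2)] by blast
  \<comment> \<open>The closed \<open>d\<close>-neighbourhood of \<open>K\<close>, still inside
    \<open>\<Omega>\<close>. As all radii \<open>\<epsilon> k\<close> are below \<open>d\<close>,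
    cutting \<open>u\<close> and \<open>G\<close> off outside \<open>K'\<close> does not affect the
    mollifications on \<open>K\<close>.\<close>
  define K' where "K' = {x + y |x y. x \<in> K \<and> y \<in> cball 0 d}"
  have K': "compact K'" unfolding K'_def using compact_sums[OF K(1) compact_cball] .
  have cbK': "cball x d \<subseteq> K'" if "x \<in> K" for x
  proof
    fix z assume "z \<in> cball x d"
    then have "z = x + (z - x)" "z - x \<in> cball 0 d" by (auto simp: dist_norm norm_minus_commute)
    then show "z \<in> K'" unfolding K'_def using that by blast
  qed
  have K'\<Omega>: "K' \<subseteq> \<Omega>"
  proof
    fix z assume "z \<in> K'"
    then obtain x y where "x \<in> K" "y \<in> cball 0 d" "z = x + y" by (auto simp: K'_def)
    then have "z \<in> cball x d" by (simp add: dist_norm)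
    then show "z \<in> \<Omega>" using d(2) \<open>x \<in> K\<close> by blast
  qed
  have [measurable]: "K \<in> sets borel" "K' \<in> sets borel" using K K' by (auto simp: borel_compact)
  have \<Omega>s: "\<Omega> \<in> sets lebesgue" using \<Omega> by (simp add: lebesgue_openin)
  have uK': "continuous_on K' u" using u K'\<Omega> continuous_on_subset by blast
  define uh where "uh y = indicator K' y *\<^sub>R u y" for y
  have iu: "integrable lborel uh" unfolding uh_def by (rule borel_integrable_compact[OF K' uK'])
  have [measurable]: "uh \<in> borel_measurable borel" using borel_measurable_integrable[OF iu] by simp
  have GL: "Lp_loc p \<Omega> G" "has_weak_gradient \<Omega> u G" using W by (auto simp: W1p_loc_def)
  have "(\<lambda>x. if x \<in> \<Omega> then G x else 0) \<in> borel_measurable lebesgue"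
    using GL(1) \<Omega>s by (intro borel_measurable_if_I) (auto simp: Lp_loc_def)
  then obtain G0 where G0: "G0 \<in> borel_measurable borel" "AE x in lebesgue. (if x \<in> \<Omega> then G x else 0) = G0 x"
    using borel_representative by blast
  \<comment> \<open>A Borel representative of \<open>G\<close> on \<open>K'\<close>, extended by 0:
    \<open>G\<close> is only Lebesgue measurable, whereas the convolution estimates are stated for
    Borel functions.\<close>
  define Gh where "Gh x = indicator K' x *\<^sub>R G0 x" for x
  have Ghm[measurable]: "Gh \<in> borel_measurable borel" unfolding Gh_def[abs_def] using G0(1) by measurable
  have Gheq: "AE x in lebesgue. x \<in> K' \<longrightarrow> G x = Gh x"
    using G0(2) by eventually_elim (use K'\<Omega> in \<open>auto simp: Gh_def split: if_splits\<close>)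
  have Gh0: "Gh x = 0" if "x \<notin> K'" for x using that by (simp add: Gh_def)
  have iGh: "integrable lborel (\<lambda>x. norm (Gh x) powr p)"
  proof -
    have "integrable lebesgue (\<lambda>x. indicator K' x *\<^sub>R norm (G x) powr p)"
      using GL(1) K' K'\<Omega> by (simp add: Lp_loc_def set_integrable_def)
    moreover have eq: "AE x in lebesgue. indicator K' x *\<^sub>R norm (G x) powr p = norm (Gh x) powr p"
      using Gheq by eventually_elim (use p in \<open>auto simp: indicator_def Gh0\<close>)
    ultimately have "integrable lebesgue (\<lambda>x. norm (Gh x) powr p)"
      by (intro integrable_cong_AE_imp[OF _ _ eq]) (auto intro!: measurable_completion)
    then show ?thesis by (simp add: integrable_completion)
  qed
  have iG: "integrable lborel Gh"
    by (rule powr_integrable_imp_integrable[OF p K' Ghm Gh0 iGh])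
  define \<epsilon> where "\<epsilon> = (\<lambda>k. d / 2 * inverse (real (Suc k)))"
  have \<epsilon>: "0 < \<epsilon> k" "\<epsilon> k < d" for k
  proof -
    show "0 < \<epsilon> k" using d(1) by (simp add: \<epsilon>_def)
    have "d / 2 * inverse (real (Suc k)) \<le> d / 2 * 1" using d(1) by (intro mult_left_mono) (auto simp: inverse_le_1_iff)
    then show "\<epsilon> k < d" unfolding \<epsilon>_def using d(1) by linarith
  qed
  have \<epsilon>0: "\<epsilon> \<longlonglongrightarrow> 0" unfolding \<epsilon>_def
    by (rule tendsto_mult_right_zero[OF LIMSEQ_inverse_real_of_nat])
  define v where "v k x = (LINT y|lborel. uh y * mollifier (\<epsilon> k) (x - y))" for k x
  have vd: "(v k has_derivative (\<lambda>h. (LINT y|lborel. uh y *\<^sub>R mollifier_grad (\<epsilon> k) (x - y)) \<bullet> h)) (at x)" for k x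
    unfolding v_def by (rule mollification_has_derivative[OF \<epsilon>(1) iu])
  have gv: "grad (v k) = (\<lambda>x. LINT y|lborel. uh y *\<^sub>R mollifier_grad (\<epsilon> k) (x - y))" for k
    using grad_unique(2)[OF vd] by (simp add: fun_eq_iff)
  have gvG: "grad (v k) x = (LINT y|lborel. mollifier (\<epsilon> k) (x - y) *\<^sub>R Gh y)" if x: "x \<in> K" for k x
  proof -
    have [measurable]: "mollifier (\<epsilon> k) \<in> borel_measurable borel" "mollifier_grad (\<epsilon> k) \<in> borel_measurable borel"
      by (rule mollifier_measurable[OF \<epsilon>(1)])+
    define \<zeta> where "\<zeta> y = mollifier (\<epsilon> k) (x - y)" for y
    have \<zeta>d: "(\<zeta> has_derivative (\<lambda>h. - mollifier_grad (\<epsilon> k) (x - y) \<bullet> h)) (at y)" for y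
    proof -
      have "((\<lambda>y. x - y) has_derivative (\<lambda>h. - h)) (at y)" by (auto intro!: derivative_eq_intros)
      from has_derivative_compose[OF this mollifier_has_derivative[OF \<epsilon>(1)]] show ?thesis
        unfolding \<zeta>_def by simp
    qed
    have g\<zeta>: "grad \<zeta> = (\<lambda>y. - mollifier_grad (\<epsilon> k) (x - y))"
      using grad_unique(2)[OF \<zeta>d] by (simp add: fun_eq_iff)
    have \<zeta>0: "\<zeta> y = 0" "grad \<zeta> y = 0" if "y \<notin> cball x (\<epsilon> k)" for y
      using that mollifier_eq_0[OF \<epsilon>(1), of k "x - y"] mollifier_grad_eq_0[OF \<epsilon>(1), of k "x - y"]
      by (auto simp: \<zeta>_def g\<zeta> dist_norm)
    have sub: "cball x (\<epsilon> k) \<subseteq> K'" using cbK'[OF x] \<epsilon>(2)[of k] by (auto simp: subset_eq)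
    have "continuous_on UNIV (grad \<zeta>)"
      unfolding g\<zeta> by (intro continuous_on_minus continuous_on_compose2[OF continuous_on_mollifier_grad[OF \<epsilon>(1)], of UNIV] continuous_intros) auto
    then have \<zeta>: "\<zeta> \<in> C1c \<Omega>"
      using \<zeta>d \<zeta>0(1) sub K'\<Omega> by (intro C1c_I[of UNIV "cball x (\<epsilon> k)"]) (auto simp: differentiable_def)
    have "grad (v k) x = (LINT y|lebesgue. uh y *\<^sub>R mollifier_grad (\<epsilon> k) (x - y))"
      unfolding gv by (rule integral_completion[symmetric]) measurable
    \<comment> \<open>The kernel is differentiated in \<open>y\<close> instead of \<open>x\<close>;
      this sign cancels the one in the definition of the weak gradient.\<close>
    also have "\<dots> = (LINT y|lebesgue. - (indicator \<Omega> y *\<^sub>R (u y *\<^sub>R grad \<zeta> y)))"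
    proof (rule Bochner_Integration.integral_cong[OF refl])
      fix y
      show "uh y *\<^sub>R mollifier_grad (\<epsilon> k) (x - y) = - (indicator \<Omega> y *\<^sub>R (u y *\<^sub>R grad \<zeta> y))"
        using \<zeta>0(2)[of y] sub K'\<Omega> by (cases "y \<in> cball x (\<epsilon> k)") (auto simp: uh_def g\<zeta> indicator_def)
    qed
    also have "\<dots> = - (LINT y:\<Omega>|lebesgue. u y *\<^sub>R grad \<zeta> y)"
      by (simp add: set_lebesgue_integral_def)
    also have "\<dots> = (LINT y:\<Omega>|lebesgue. \<zeta> y *\<^sub>R G y)"
      using GL(2) \<zeta> by (simp add: has_weak_gradient_def)
    also have "\<dots> = (LINT y|lebesgue. mollifier (\<epsilon> k) (x - y) *\<^sub>R Gh y)"
      unfolding set_lebesgue_integral_def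
    proof (rule integral_cong_AE)
      have *: "AE y in lebesgue. indicator \<Omega> y *\<^sub>R \<zeta> y *\<^sub>R G y = mollifier (\<epsilon> k) (x - y) *\<^sub>R Gh y"
        using Gheq
      proof eventually_elim
        case (elim y)
        then show ?case using \<zeta>0(1)[of y] sub K'\<Omega>
          by (cases "y \<in> cball x (\<epsilon> k)") (auto simp: \<zeta>_def indicator_def)
      qed
      then show "AE y in lebesgue. indicator \<Omega> y *\<^sub>R \<zeta> y *\<^sub>R G y = mollifier (\<epsilon> k) (x - y) *\<^sub>R Gh y" .
      show m: "(\<lambda>y. mollifier (\<epsilon> k) (x - y) *\<^sub>R Gh y) \<in> borel_measurable lebesgue"
        by (rule measurable_completion) measurable
      have "(\<lambda>y. \<zeta> y *\<^sub>R (if y \<in> \<Omega> then G y else 0)) \<in> borel_measurable lebesgue"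
        using GL(1) \<Omega>s unfolding \<zeta>_def
        by (intro borel_measurable_scaleR borel_measurable_if_I measurable_completion) (auto simp: Lp_loc_def)
      also have "(\<lambda>y. \<zeta> y *\<^sub>R (if y \<in> \<Omega> then G y else 0)) = (\<lambda>y. indicator \<Omega> y *\<^sub>R \<zeta> y *\<^sub>R G y)"
        by (auto simp: fun_eq_iff indicator_def)
      finally show "(\<lambda>y. indicator \<Omega> y *\<^sub>R \<zeta> y *\<^sub>R G y) \<in> borel_measurable lebesgue" .
    qed
    also have "\<dots> = (LINT y|lborel. mollifier (\<epsilon> k) (x - y) *\<^sub>R Gh y)"
      by (rule integral_completion) measurable
    finally show ?thesis .
  qed
  show ?thesis
  proof (rule that[of v Gh])
    show "v k differentiable (at x)" for k x using vd by (auto simp: differentiable_def)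
    show "continuous_on UNIV (grad (v k))" for k
      unfolding gv by (rule continuous_mollification_grad[OF \<epsilon>(1) iu])
    show "Gh \<in> borel_measurable borel" by fact
    have KK': "K \<subseteq> K'"
    proof
      fix x assume "x \<in> K"
      then show "x \<in> K'" using cbK'[of x] d(1) by auto
    qed
    show "AE x in lebesgue. x \<in> K \<longrightarrow> G x = Gh x"
      using Gheq by eventually_elim (use KK' in auto)
    show "integrable lborel (\<lambda>x. indicator K x * norm (Gh x) powr p)"
      using integrable_scaleR_bounded[OF iGh, of "indicator K" 1] by (simp add: indicator_def)
    show "\<forall>\<^sub>F k in sequentially. \<forall>x\<in>K. \<bar>v k x - u x\<bar> \<le> e" if e: "e > 0" for e
    proof -
      obtain d' where d': "0 < d'" "\<And>\<epsilon> x. 0 < \<epsilon> \<Longrightarrow> \<epsilon> < d' \<Longrightarrow> cball x \<epsilon> \<subseteq> K' \<Longrightarrow>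
        norm ((LINT y|lborel. mollifier \<epsilon> (x - y) *\<^sub>R (indicator K' y *\<^sub>R u y)) - u x) \<le> e"
        using mollification_uniform[OF K' uK' e] by blast
      from order_tendstoD(2)[OF \<epsilon>0 d'(1)] show ?thesis
      proof eventually_elim
        case (elim k)
        show ?case
        proof
          fix x assume "x \<in> K"
          then have "cball x (\<epsilon> k) \<subseteq> K'" using cbK'[of x] \<epsilon>(2)[of k] by (auto simp: subset_eq)
          from d'(2)[OF \<epsilon>(1) elim this] show "\<bar>v k x - u x\<bar> \<le> e"
            by (simp add: v_def uh_def mult.commute)
        qed
      qed
    qed
    show "(\<lambda>k. LINT x|lborel. indicator K x * norm (grad (v k) x - Gh x) powr p) \<longlonglongrightarrow> 0"
    proof (rule tendstoI)
      fix e :: real assume e: "0 < e"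
      obtain d' where d': "0 < d'" "\<And>\<epsilon>. 0 < \<epsilon> \<Longrightarrow> \<epsilon> < d' \<Longrightarrow>
        (LINT x|lborel. indicator K x * norm ((LINT y|lborel. mollifier \<epsilon> (x - y) *\<^sub>R Gh y) - Gh x) powr p) \<le> e / 2"
        using mollification_powr_converges[OF p K(1) K' d(1) cbK' Ghm Gh0 iGh, of "e / 2"] e by auto
      from order_tendstoD(2)[OF \<epsilon>0 d'(1)]
      show "\<forall>\<^sub>F k in sequentially. dist (LINT x|lborel. indicator K x * norm (grad (v k) x - Gh x) powr p) 0 < e"
      proof eventually_elim
        case (elim k)
        have "(LINT x|lborel. indicator K x * norm (grad (v k) x - Gh x) powr p) =
          (LINT x|lborel. indicator K x * norm ((LINT y|lborel. mollifier (\<epsilon> k) (x - y) *\<^sub>R Gh y) - Gh x) powr p)"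
          by (rule Bochner_Integration.integral_cong[OF refl]) (auto simp: indicator_def gvG)
        also have "\<dots> \<le> e / 2" by (rule d'(2)[OF \<epsilon>(1) elim])
        finally have "(LINT x|lborel. indicator K x * norm (grad (v k) x - Gh x) powr p) \<le> e / 2" .
        moreover have "0 \<le> (LINT x|lborel. indicator K x * norm (grad (v k) x - Gh x) powr p)"
          by (intro Bochner_Integration.integral_nonneg) auto
        ultimately show ?case using e by (simp add: dist_norm)
      qed
    qed
  qed
qed

section \<open>Weak comparison principle\<close>

lemma norm_p_flux: "1 < p \<Longrightarrow> norm (p_flux p v) = norm v powr (p - 1)"
  by (cases "v = 0") (auto simp: p_flux_def powr_diff power2_eq_square)

text \<open>The pairing splits into a radial part, nonnegative because \<open>t powr (p - 1)\<close>
  increases, and an angular part, nonnegative by the Cauchy-Schwarz inequality. This treats all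
  \<open>p > 1\<close> alike. If both parts vanish, the vectors have equal length and equal
  direction.\<close>

lemma p_flux_monotone:
  fixes a b :: "'a::euclidean_space"
  assumes p: "1 < p"
  shows "0 \<le> (p_flux p a - p_flux p b) \<bullet> (a - b)"
    and "(p_flux p a - p_flux p b) \<bullet> (a - b) = 0 \<Longrightarrow> a = b"
proof -
  define s t where "s = norm a powr (p - 2)" and "t = norm b powr (p - 2)"
  have st: "0 \<le> s" "0 \<le> t" by (auto simp: s_def t_def)
  have flux: "s * norm a = norm a powr (p - 1)" "t * norm b = norm b powr (p - 1)"
    using norm_p_flux[OF p, of a] norm_p_flux[OF p, of b] by (auto simp: p_flux_def s_def t_def)
  have eq: "(p_flux p a - p_flux p b) \<bullet> (a - b) =
    (norm a powr (p - 1) - norm b powr (p - 1)) * (norm a - norm b) + (s + t) * (norm a * norm b - a \<bullet> b)"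
    unfolding flux[symmetric] p_flux_def s_def[symmetric] t_def[symmetric]
    by (simp add: inner_diff_left inner_diff_right dot_square_norm power2_eq_square inner_commute algebra_simps)
  have mono: "0 \<le> (norm a powr (p - 1) - norm b powr (p - 1)) * (norm a - norm b)"
  proof (cases "norm a \<le> norm b")
    case True
    then have "norm a powr (p - 1) \<le> norm b powr (p - 1)" using p by (intro powr_mono2) auto
    then show ?thesis using True by (intro mult_nonpos_nonpos) auto
  next
    case False
    then have "norm b powr (p - 1) \<le> norm a powr (p - 1)" using p by (intro powr_mono2) auto
    then show ?thesis using False by (intro mult_nonneg_nonneg) auto
  qed
  have cs: "0 \<le> (s + t) * (norm a * norm b - a \<bullet> b)"
    using st norm_cauchy_schwarz[of a b] by (intro mult_nonneg_nonneg) auto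
  show "0 \<le> (p_flux p a - p_flux p b) \<bullet> (a - b)" using eq mono cs by simp
  assume "(p_flux p a - p_flux p b) \<bullet> (a - b) = 0"
  then have z: "(norm a powr (p - 1) - norm b powr (p - 1)) * (norm a - norm b) = 0" "(s + t) * (norm a * norm b - a \<bullet> b) = 0"
    using eq mono cs by linarith+
  have nab: "norm a = norm b"
  proof (rule ccontr)
    assume ne: "norm a \<noteq> norm b"
    then have "norm a powr (p - 1) = norm b powr (p - 1)" using z(1) by simp
    moreover have "norm a powr (p - 1) < norm b powr (p - 1) \<or> norm b powr (p - 1) < norm a powr (p - 1)"
      using ne p powr_less_mono2[of "p - 1" "norm a" "norm b"] powr_less_mono2[of "p - 1" "norm b" "norm a"] by fastforce
    ultimately show False by simp
  qed
  show "a = b"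
  proof (cases "a = 0")
    case True
    then show ?thesis using nab by simp
  next
    case False
    then have "s > 0" by (simp add: s_def)
    then have "norm a * norm b = a \<bullet> b" using z(2) st by simp
    then have "norm a *\<^sub>R b = norm b *\<^sub>R a" by (metis norm_cauchy_schwarz_eq)
    then show ?thesis using nab False by auto
  qed
qed

text \<open>Split according to whether \<open>b <= \<theta> * a\<close>; each case uses one of the
  two terms. This weighted Young inequality, with constants that are not sharp, does the work of
  Hoelder's inequality in the limits below.\<close>

lemma powr_young:
  fixes a b \<theta> p :: real
  assumes "1 < p" "0 \<le> a" "0 \<le> b" "0 < \<theta>"
  shows "a powr (p - 1) * b \<le> \<theta> * a powr p + \<theta> powr (1 - p) * b powr p"
proof (cases "b \<le> \<theta> * a")
  case True
  have "a powr (p - 1) * b \<le> a powr (p - 1) * (\<theta> * a)" using True by (intro mult_left_mono) auto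
  also have "\<dots> = \<theta> * a powr p" using assms by (cases "a = 0") (auto simp: powr_diff)
  finally show ?thesis by (simp add: add_increasing2)
next
  case False
  then have b: "b > 0" using assms by (smt (verit) mult_nonneg_nonneg)
  have "a \<le> b / \<theta>" using False assms by (simp add: field_simps)
  then have "a powr (p - 1) \<le> (b / \<theta>) powr (p - 1)" using assms by (intro powr_mono2) auto
  then have "a powr (p - 1) * b \<le> (b / \<theta>) powr (p - 1) * b" using b by (intro mult_right_mono) auto
  also have "\<dots> = \<theta> powr (1 - p) * b powr p"
    using b assms by (simp add: powr_divide powr_diff)
  finally show ?thesis using assms by (simp add: add_increasing)
qed

lemma integrable_powr_mult:
  fixes A B :: "'a::euclidean_space \<Rightarrow> real"
  assumes p: "1 < p" and A: "A \<in> borel_measurable borel" "\<And>x. 0 \<le> A x" "integrable lborel (\<lambda>x. A x powr p)"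
    and B: "B \<in> borel_measurable borel" "\<And>x. 0 \<le> B x" "integrable lborel (\<lambda>x. B x powr p)"
  shows "integrable lborel (\<lambda>x. A x powr (p - 1) * B x)"
proof (rule Bochner_Integration.integrable_bound)
  note [measurable] = A(1) B(1)
  show "integrable lborel (\<lambda>x. 1 * A x powr p + 1 powr (1 - p) * B x powr p)" using A B by simp
  show "(\<lambda>x. A x powr (p - 1) * B x) \<in> borel_measurable lborel" by measurable
  show "AE x in lborel. norm (A x powr (p - 1) * B x) \<le> norm (1 * A x powr p + 1 powr (1 - p) * B x powr p)"
    using powr_young[OF p A(2) B(2), of 1] A(2) B(2) by (intro AE_I2) simp
qed

text \<open>The weight \<open>\<theta>\<close> is chosen so that the fixed integral of
  \<open>A powr p\<close> contributes less than \<open>e / 2\<close>; the other term then tends to 0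
  with \<open>k\<close>.\<close>

lemma integral_powr_mult_tendsto_0:
  fixes A :: "'a::euclidean_space \<Rightarrow> real" and B :: "nat \<Rightarrow> 'a \<Rightarrow> real"
  assumes p: "1 < p" and A: "A \<in> borel_measurable borel" "\<And>x. 0 \<le> A x" "integrable lborel (\<lambda>x. A x powr p)"
    and B: "\<And>k. B k \<in> borel_measurable borel" "\<And>k x. 0 \<le> B k x" "\<And>k. integrable lborel (\<lambda>x. B k x powr p)"
    and lim: "(\<lambda>k. LINT x|lborel. B k x powr p) \<longlonglongrightarrow> 0"
  shows "(\<lambda>k. LINT x|lborel. A x powr (p - 1) * B k x) \<longlonglongrightarrow> 0"
proof (rule tendstoI)
  fix e :: real assume e: "0 < e"
  define I where "I = (LINT x|lborel. A x powr p)"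
  have I: "0 \<le> I" unfolding I_def by (intro Bochner_Integration.integral_nonneg) auto
  define \<theta> where "\<theta> = e / (2 * (I + 1))"
  have \<theta>: "0 < \<theta>" using e I by (simp add: \<theta>_def add_nonneg_pos)
  have "\<theta> * I < e / 2"
  proof -
    have "\<theta> * I < \<theta> * (I + 1)" using \<theta> by simp
    also have "\<dots> = e / 2" using I by (simp add: \<theta>_def field_simps add_nonneg_eq_0_iff)
    finally show ?thesis .
  qed
  have "(\<lambda>k. \<theta> powr (1 - p) * (LINT x|lborel. B k x powr p)) \<longlonglongrightarrow> 0"
    by (rule tendsto_mult_right_zero[OF lim])
  then have "\<forall>\<^sub>F k in sequentially. \<theta> powr (1 - p) * (LINT x|lborel. B k x powr p) < e / 2"
    using e by (intro order_tendstoD(2)[of _ 0]) auto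
  then show "\<forall>\<^sub>F k in sequentially. dist (LINT x|lborel. A x powr (p - 1) * B k x) 0 < e"
  proof eventually_elim
    case (elim k)
    have "(LINT x|lborel. A x powr (p - 1) * B k x) \<le> (LINT x|lborel. \<theta> * A x powr p + \<theta> powr (1 - p) * B k x powr p)"
      using powr_young[OF p A(2) B(2) \<theta>] integrable_powr_mult[OF p A B(1,2,3)] A(3) B(3)
      by (intro integral_mono) auto
    also have "\<dots> = \<theta> * I + \<theta> powr (1 - p) * (LINT x|lborel. B k x powr p)"
      using A(3) B(3) by (simp add: I_def)
    finally have "(LINT x|lborel. A x powr (p - 1) * B k x) < e"
      using elim \<open>\<theta> * I < e / 2\<close> by linarith
    moreover have "0 \<le> (LINT x|lborel. A x powr (p - 1) * B k x)"
      using A B by (intro Bochner_Integration.integral_nonneg) auto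
    ultimately show ?case by (simp add: dist_norm)
  qed
qed

text \<open>A Poincare inequality in L1, obtained by integrating the derivative of
  \<open>\<zeta> x * (x \<bullet> e)\<close> along a basis vector \<open>e\<close>. In the
  comparison argument it turns vanishing gradients of the test functions into vanishing
  integrals.\<close>

lemma integral_le_moment_grad:
  fixes \<zeta> :: "'a::euclidean_space \<Rightarrow> real"
  assumes \<zeta>: "\<zeta> \<in> C1c UNIV" and supp: "\<And>x. \<zeta> x \<noteq> 0 \<Longrightarrow> norm x \<le> R"
  shows "(LINT x|lborel. \<zeta> x) \<le> R * (LINT x|lborel. norm (grad \<zeta> x))"
proof -
  obtain e :: 'a where e: "e \<in> Basis" using nonempty_Basis by blast
  define K where "K = closure {x. \<zeta> x \<noteq> 0}"
  have K: "compact K" using C1cD(3)[OF \<zeta>] by (simp add: K_def)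
  have KR: "K \<subseteq> cball 0 R" unfolding K_def using supp by (intro closure_minimal) auto
  have zero: "\<zeta> x = 0" "grad \<zeta> x = 0" if "x \<notin> K" for x
    by (rule C1c_grad_eq_0[OF \<zeta> that[unfolded K_def]])+
  have cont: "continuous_on S \<zeta>" "continuous_on S (grad \<zeta>)" for S
    using C1cD(2,5)[OF \<zeta>] continuous_on_subset by blast+
  define f where "f x = \<zeta> x * (x \<bullet> e)" for x
  have fd: "(f has_derivative (\<lambda>h. (\<zeta> x *\<^sub>R e + (x \<bullet> e) *\<^sub>R grad \<zeta> x) \<bullet> h)) (at x)" for x
  proof -
    have "((\<lambda>x. x \<bullet> e) has_derivative (\<lambda>h. h \<bullet> e)) (at x)" by (auto intro!: derivative_eq_intros)
    from has_derivative_mult[OF has_derivative_grad[OF C1cD(1)[OF \<zeta>]] this]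
    show ?thesis unfolding f_def
      by (rule has_derivative_eq_rhs) (auto simp: fun_eq_iff inner_add_left inner_add_right inner_commute mult.commute)
  qed
  have gf: "grad f = (\<lambda>x. \<zeta> x *\<^sub>R e + (x \<bullet> e) *\<^sub>R grad \<zeta> x)"
    using grad_unique(2)[OF fd] by (simp add: fun_eq_iff)
  have "f \<in> C1c UNIV"
  proof (rule C1c_I[OF open_UNIV K])
    show "continuous_on UNIV (grad f)" unfolding gf by (intro continuous_intros cont)
  qed (use fd zero in \<open>auto simp: differentiable_def f_def\<close>)
  then have "0 = (LINT x|lborel. grad f x \<bullet> e)" by (simp add: integral_grad_eq_0)
  also have "\<dots> = (LINT x|lborel. \<zeta> x + (x \<bullet> e) * (grad \<zeta> x \<bullet> e))"
    using e by (simp add: gf inner_add_left)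
  also have "\<dots> = (LINT x|lborel. \<zeta> x) + (LINT x|lborel. (x \<bullet> e) * (grad \<zeta> x \<bullet> e))"
    using K zero by (intro Bochner_Integration.integral_add integrable_compact_support[of K] continuous_intros cont) auto
  finally have "(LINT x|lborel. \<zeta> x) = - (LINT x|lborel. (x \<bullet> e) * (grad \<zeta> x \<bullet> e))" by simp
  also have "\<dots> = (LINT x|lborel. - ((x \<bullet> e) * (grad \<zeta> x \<bullet> e)))" by simp
  also have "\<dots> \<le> (LINT x|lborel. R * norm (grad \<zeta> x))"
  proof (rule integral_mono)
    show "integrable lborel (\<lambda>x. - ((x \<bullet> e) * (grad \<zeta> x \<bullet> e)))" "integrable lborel (\<lambda>x. R * norm (grad \<zeta> x))"
      using K zero by (auto intro!: integrable_compact_support[of K] continuous_intros cont)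
    show "- ((x \<bullet> e) * (grad \<zeta> x \<bullet> e)) \<le> R * norm (grad \<zeta> x)" for x
    proof (cases "x \<in> K")
      case True
      have "\<bar>(x \<bullet> e) * (grad \<zeta> x \<bullet> e)\<bar> \<le> R * norm (grad \<zeta> x)"
        unfolding abs_mult using True KR Basis_le_norm[OF e, of x] Basis_le_norm[OF e, of "grad \<zeta> x"]
        by (intro mult_mono) auto
      then show ?thesis by linarith
    qed (simp add: zero)
  qed
  also have "\<dots> = R * (LINT x|lborel. norm (grad \<zeta> x))" by simp
  finally show ?thesis .
qed

text \<open>The natural test function, the positive part of \<open>u - w - \<eta>\<close>, need not
  be C1. It is replaced by \<open>(max 0 (v k - w - \<eta>))\<^sup>2\<close> with \<open>v k\<close>
  a mollification of \<open>u\<close>; the square makes it C1, and its gradient is a nonnegative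
  factor times the difference of the gradients. Subtracting the two weak inequalities and passing to
  the limit bounds the integral of \<open>X0 * (F \<bullet> H)\<close> by 0. Monotonicity of the
  flux makes that integrand nonnegative, so the gradients agree almost everywhere on
  \<open>{u > w + \<eta>}\<close> in \<open>K\<close>, and the Poincare inequality contradicts
  \<open>u y > w y\<close>.\<close>

lemma weak_comparison:
  fixes u w :: "'a::euclidean_space \<Rightarrow> real"
  assumes p: "1 < p" and \<Omega>: "open \<Omega>" and D: "open D" "D \<subseteq> \<Omega>"
    and u: "continuous_on \<Omega> u" and W: "W1p_loc p \<Omega> u G"
    and sub: "\<And>\<zeta>. \<zeta> \<in> C1c D \<Longrightarrow> (\<And>x. 0 \<le> \<zeta> x) \<Longrightarrow> (LINT x:D|lebesgue. p_flux p (G x) \<bullet> grad \<zeta> x) \<le> 0"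
    and w: "\<And>x. x \<in> D \<Longrightarrow> w differentiable (at x)" "continuous_on D (grad w)"
    and super: "\<And>\<zeta>. \<zeta> \<in> C1c D \<Longrightarrow> (\<And>x. 0 \<le> \<zeta> x) \<Longrightarrow> 0 \<le> (LINT x|lborel. p_flux p (grad w x) \<bullet> grad \<zeta> x)"
    and K: "compact K" "K \<subseteq> D" and out: "\<And>x. x \<in> D \<Longrightarrow> x \<notin> K \<Longrightarrow> u x \<le> w x" and y: "y \<in> D"
  shows "u y \<le> w y"
proof (rule ccontr)
  assume "\<not> u y \<le> w y"
  \<comment> \<open>Half of the excess at \<open>y\<close>, so that \<open>u - w\<close> still
    exceeds \<open>\<eta>\<close> near \<open>y\<close>. The levels \<open>\<eta> / 3\<close> and
    \<open>\<eta> / 2\<close> below leave room for an error \<open>\<eta> / 4\<close> in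
    \<open>v k\<close>.\<close>
  define \<eta> where "\<eta> = (u y - w y) / 2"
  have \<eta>: "\<eta> > 0" "u y = w y + 2 * \<eta>" using \<open>\<not> u y \<le> w y\<close> by (auto simp: \<eta>_def field_simps)
  have contuD: "continuous_on D u" using u D(2) continuous_on_subset by blast
  have contwD: "continuous_on D w"
    using w(1) by (meson continuous_at_imp_continuous_on differentiable_imp_continuous_within)
  \<comment> \<open>The open set on which the test function is given by its formula. For large
    \<open>k\<close> it vanishes off the smaller compact set \<open>E\<close>, so cutting it off by
    the indicator of \<open>O1\<close> keeps it C1.\<close>
  define O1 where "O1 = {x\<in>D. \<eta> / 3 < u x - w x}"
  have O1: "open O1"
  proof -
    have "open (D \<inter> (\<lambda>x. u x - w x) -` {\<eta> / 3<..})"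
      using D(1) contuD contwD by (intro continuous_open_preimage continuous_intros) auto
    moreover have "D \<inter> (\<lambda>x. u x - w x) -` {\<eta> / 3<..} = O1" by (auto simp: O1_def)
    ultimately show ?thesis by simp
  qed
  have O1K: "O1 \<subseteq> K" using out \<eta> by (force simp: O1_def)
  have O1D: "O1 \<subseteq> D" by (auto simp: O1_def)
  define E where "E = {x\<in>K. \<eta> / 2 \<le> u x - w x}"
  have E: "compact E"
  proof -
    have "closedin (top_of_set K) (K \<inter> (\<lambda>x. u x - w x) -` {\<eta> / 2..})"
      using K by (intro continuous_closedin_preimage continuous_intros continuous_on_subset[OF contuD] continuous_on_subset[OF contwD]) auto
    then have "compact (K \<inter> (\<lambda>x. u x - w x) -` {\<eta> / 2..})" using K(1) closedin_compact by blast
    moreover have "K \<inter> (\<lambda>x. u x - w x) -` {\<eta> / 2..} = E" by (auto simp: E_def)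
    ultimately show ?thesis by simp
  qed
  have EK: "E \<subseteq> K" by (auto simp: E_def)
  have EO1: "E \<subseteq> O1" using K(2) \<eta> by (auto simp: E_def O1_def)
  have K\<Omega>: "K \<subseteq> \<Omega>" using K(2) D(2) by blast
  obtain v Gh where vd: "\<And>k x. v k differentiable (at x)" and vc: "\<And>k. continuous_on UNIV (grad (v k))"
    and vu: "\<And>e. e > 0 \<Longrightarrow> \<forall>\<^sub>F k in sequentially. \<forall>x\<in>K. \<bar>v k x - u x\<bar> \<le> e"
    and Gh[measurable]: "Gh \<in> borel_measurable borel" and GGh: "AE x in lebesgue. x \<in> K \<longrightarrow> G x = Gh x"
    and iGh: "integrable lborel (\<lambda>x. indicator K x * norm (Gh x) powr p)"
    and lim: "(\<lambda>k. LINT x|lborel. indicator K x * norm (grad (v k) x - Gh x) powr p) \<longlonglongrightarrow> 0"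
    using W1p_loc_smooth_approximation[OF p \<Omega> u W K(1) K\<Omega>] by blast
  have [measurable]: "K \<in> sets borel" "E \<in> sets borel" using K E by (auto simp: borel_compact)
  have gvm[measurable]: "grad (v k) \<in> borel_measurable borel" for k
    using vc by (intro borel_measurable_continuous_onI)
  have vcont: "continuous_on S (v k)" for S k
    using vd by (meson continuous_at_imp_continuous_on differentiable_imp_continuous_within)
  have gvcont: "continuous_on S (grad (v k))" for S k using vc continuous_on_subset by blast
  \<comment> \<open>All fields are cut off to \<open>K\<close> to be integrable on the whole space.
    \<open>Dk k\<close> is the error of the mollified gradient.\<close>
  define GK where "GK x = indicator K x *\<^sub>R Gh x" for x
  define gK where "gK x = indicator K x *\<^sub>R grad w x" for x
  define Dk where "Dk k x = indicator K x *\<^sub>R (grad (v k) x - Gh x)" for k x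
  have contgK: "continuous_on K (grad w)" using w(2) K(2) continuous_on_subset by blast
  have GKm[measurable]: "GK \<in> borel_measurable borel" unfolding GK_def[abs_def] by measurable
  have gKm[measurable]: "gK \<in> borel_measurable borel"
    unfolding gK_def[abs_def] using contgK by (intro borel_measurable_continuous_on_indicator) auto
  have Dkm[measurable]: "Dk k \<in> borel_measurable borel" for k unfolding Dk_def[abs_def] by measurable
  have iGK: "integrable lborel (\<lambda>x. norm (GK x) powr p)"
    using iGh by (rule Bochner_Integration.integrable_cong[THEN iffD1, OF refl, rotated]) (auto simp: GK_def indicator_def)
  have iconst: "integrable lborel (\<lambda>x. (indicator K x * c) powr p)" for c
    using borel_integrable_compact[OF K(1), of "\<lambda>_. c powr p"]
    by (rule Bochner_Integration.integrable_cong[THEN iffD1, OF refl, rotated]) (auto simp: indicator_def)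
  have "bounded (grad w ` K)" using contgK K(1) by (intro compact_imp_bounded compact_continuous_image)
  then obtain M where M: "M > 0" "\<And>x. x \<in> K \<Longrightarrow> norm (grad w x) \<le> M" unfolding bounded_pos by auto
  have gKM: "norm (gK x) \<le> indicator K x * M" for x using M by (auto simp: gK_def indicator_def)
  have iD: "integrable lborel (\<lambda>x. norm (Dk k x) powr p)" for k
  proof (rule Bochner_Integration.integrable_bound)
    have "continuous_on K (\<lambda>x. norm (grad (v k) x) powr p)"
      using p by (intro continuous_on_powr' continuous_intros gvcont) auto
    from borel_integrable_compact[OF K(1) this]
    have "integrable lborel (\<lambda>x. indicator K x *\<^sub>R norm (grad (v k) x) powr p)" .
    then show "integrable lborel (\<lambda>x. 2 powr p * (indicator K x *\<^sub>R norm (grad (v k) x) powr p + norm (GK x) powr p))"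
      using iGK by simp
    show "AE x in lborel. norm (norm (Dk k x) powr p) \<le> norm (2 powr p * (indicator K x *\<^sub>R norm (grad (v k) x) powr p + norm (GK x) powr p))"
    proof (intro AE_I2)
      fix x
      have "norm (Dk k x) powr p \<le> 2 powr p * (indicator K x *\<^sub>R norm (grad (v k) x) powr p + norm (GK x) powr p)"
      proof (cases "x \<in> K")
        case True
        have "norm (Dk k x) powr p \<le> (norm (grad (v k) x) + norm (Gh x)) powr p"
          using True p by (intro powr_mono2) (auto simp: Dk_def norm_triangle_ineq4)
        also have "\<dots> \<le> 2 powr p * (norm (grad (v k) x) powr p + norm (Gh x) powr p)"
          using p by (intro powr_add_le) auto
        finally show ?thesis using True by (simp add: GK_def)
      qed (simp add: Dk_def)
      then show "norm (norm (Dk k x) powr p) \<le> norm (2 powr p * (indicator K x *\<^sub>R norm (grad (v k) x) powr p + norm (GK x) powr p))"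
        by simp
    qed
  qed measurable
  have limD: "(\<lambda>k. LINT x|lborel. norm (Dk k x) powr p) \<longlonglongrightarrow> 0"
  proof -
    have "(LINT x|lborel. norm (Dk k x) powr p) = (LINT x|lborel. indicator K x * norm (grad (v k) x - Gh x) powr p)" for k
      by (rule Bochner_Integration.integral_cong) (auto simp: Dk_def indicator_def)
    then show ?thesis using lim by simp
  qed
  define H where "H x = GK x - gK x" for x
  have Hm[measurable]: "H \<in> borel_measurable borel" unfolding H_def[abs_def] by measurable
  define F where "F x = p_flux p (GK x) - p_flux p (gK x)" for x
  have pfm[measurable]: "p_flux p \<in> borel_measurable borel"
    using continuous_on_p_flux[OF p] by (rule borel_measurable_continuous_onI)
  have Fm[measurable]: "F \<in> borel_measurable borel" unfolding F_def[abs_def] by measurable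
  have FH: "0 \<le> F x \<bullet> H x" for x unfolding F_def H_def by (rule p_flux_monotone(1)[OF p])
  have Fle: "norm (F x) \<le> norm (GK x) powr (p - 1) + (indicator K x * M) powr (p - 1)" for x
  proof -
    have "norm (gK x) powr (p - 1) \<le> (indicator K x * M) powr (p - 1)"
      using gKM[of x] p by (intro powr_mono2) auto
    then show ?thesis unfolding F_def
      using norm_triangle_ineq4[of "p_flux p (GK x)" "p_flux p (gK x)"] by (simp add: norm_p_flux[OF p])
  qed
  have Fmul: "norm (F x) * norm z \<le> norm (GK x) powr (p - 1) * norm z + (indicator K x * M) powr (p - 1) * norm z" for x and z :: 'a
    using mult_right_mono[OF Fle[of x] norm_ge_zero[of z]] by (simp only: distrib_right)
  have iH: "integrable lborel (\<lambda>x. norm (H x) powr p)"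
  proof (rule Bochner_Integration.integrable_bound)
    show "integrable lborel (\<lambda>x. 2 powr p * (norm (GK x) powr p + (indicator K x * M) powr p))"
      using iGK iconst by simp
    show "AE x in lborel. norm (norm (H x) powr p) \<le> norm (2 powr p * (norm (GK x) powr p + (indicator K x * M) powr p))"
    proof (intro AE_I2)
      fix x
      have "norm (H x) powr p \<le> (norm (GK x) + indicator K x * M) powr p"
        using gKM[of x] norm_triangle_ineq4[of "GK x" "gK x"] p by (intro powr_mono2) (auto simp: H_def)
      also have "\<dots> \<le> 2 powr p * (norm (GK x) powr p + (indicator K x * M) powr p)"
        using p M by (intro powr_add_le) auto
      finally show "norm (norm (H x) powr p) \<le> norm (2 powr p * (norm (GK x) powr p + (indicator K x * M) powr p))" by simp
    qed
  qed measurable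
  have pmi: "integrable lborel (\<lambda>x. norm (GK x) powr (p - 1) * norm (V x))" "integrable lborel (\<lambda>x. (indicator K x * c) powr (p - 1) * norm (V x))"
    "integrable lborel (\<lambda>x. norm (F x) * norm (V x))"
    if [measurable]: "V \<in> borel_measurable borel" and V: "integrable lborel (\<lambda>x. norm (V x) powr p)" and c: "0 \<le> c" for V :: "'a \<Rightarrow> 'a" and c
  proof -
    show 1: "integrable lborel (\<lambda>x. norm (GK x) powr (p - 1) * norm (V x))"
      using V iGK by (intro integrable_powr_mult[OF p]) auto
    show "integrable lborel (\<lambda>x. (indicator K x * c) powr (p - 1) * norm (V x))"
      using V iconst c by (intro integrable_powr_mult[OF p]) auto
    have 2: "integrable lborel (\<lambda>x. (indicator K x * M) powr (p - 1) * norm (V x))"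
      using V iconst M by (intro integrable_powr_mult[OF p]) auto
    show "integrable lborel (\<lambda>x. norm (F x) * norm (V x))"
      by (rule Bochner_Integration.integrable_bound[OF Bochner_Integration.integrable_add[OF 1 2]], measurable)
        (intro AE_I2, use Fmul in simp)
  qed
  \<comment> \<open>\<open>F\<close> grows like \<open>GK\<close> to the power \<open>p - 1\<close>,
    up to a bounded part, and is paired with a sequence that tends to 0 in the p-th mean.\<close>
  have limFD: "(\<lambda>k. LINT x|lborel. norm (F x) * norm (Dk k x)) \<longlonglongrightarrow> 0"
  proof (rule tendsto_sandwich[of "\<lambda>_. 0"])
    have "(\<lambda>k. (LINT x|lborel. norm (GK x) powr (p - 1) * norm (Dk k x)) + (LINT x|lborel. (indicator K x * M) powr (p - 1) * norm (Dk k x))) \<longlonglongrightarrow> 0 + 0"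
      using M iGK iconst iD limD by (intro tendsto_add integral_powr_mult_tendsto_0[OF p]) auto
    then show "(\<lambda>k. (LINT x|lborel. norm (GK x) powr (p - 1) * norm (Dk k x)) + (LINT x|lborel. (indicator K x * M) powr (p - 1) * norm (Dk k x))) \<longlonglongrightarrow> 0"
      by simp
    show "\<forall>\<^sub>F k in sequentially. (LINT x|lborel. norm (F x) * norm (Dk k x)) \<le>
       (LINT x|lborel. norm (GK x) powr (p - 1) * norm (Dk k x)) + (LINT x|lborel. (indicator K x * M) powr (p - 1) * norm (Dk k x))"
    proof (intro always_eventually allI)
      fix k
      have "(LINT x|lborel. norm (F x) * norm (Dk k x)) \<le> (LINT x|lborel. norm (GK x) powr (p - 1) * norm (Dk k x) + (indicator K x * M) powr (p - 1) * norm (Dk k x))"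
        using pmi[OF Dkm iD, of M] M Fmul by (intro integral_mono) auto
      also have "\<dots> = (LINT x|lborel. norm (GK x) powr (p - 1) * norm (Dk k x)) + (LINT x|lborel. (indicator K x * M) powr (p - 1) * norm (Dk k x))"
        using pmi[OF Dkm iD, of M] M by (intro Bochner_Integration.integral_add) auto
      finally show "(LINT x|lborel. norm (F x) * norm (Dk k x)) \<le>
       (LINT x|lborel. norm (GK x) powr (p - 1) * norm (Dk k x)) + (LINT x|lborel. (indicator K x * M) powr (p - 1) * norm (Dk k x))" .
    qed
  qed (auto intro!: always_eventually Bochner_Integration.integral_nonneg)
  have iD1: "integrable lborel (\<lambda>x. norm (Dk k x))" for k
    using pmi(2)[OF Dkm iD, of 1 k]
    by (rule Bochner_Integration.integrable_cong[THEN iffD1, OF refl, rotated]) (auto simp: Dk_def indicator_def)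
  have limD1: "(\<lambda>k. LINT x|lborel. norm (Dk k x)) \<longlonglongrightarrow> 0"
  proof -
    have "(\<lambda>k. LINT x|lborel. (indicator K x * 1) powr (p - 1) * norm (Dk k x)) \<longlonglongrightarrow> 0"
      using iconst[of 1] iD limD by (intro integral_powr_mult_tendsto_0[OF p]) auto
    moreover have "(LINT x|lborel. (indicator K x * 1) powr (p - 1) * norm (Dk k x)) = (LINT x|lborel. norm (Dk k x))" for k
      by (rule Bochner_Integration.integral_cong) (auto simp: Dk_def indicator_def)
    ultimately show ?thesis by simp
  qed
  have iH1: "integrable lborel (\<lambda>x. norm (H x))"
    using pmi(2)[OF Hm iH, of 1]
    by (rule Bochner_Integration.integrable_cong[THEN iffD1, OF refl, rotated]) (auto simp: H_def GK_def gK_def indicator_def)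
  define X where "X k x = indicator E x * (2 * max 0 (v k x - w x - \<eta>))" for k x
  define X0 where "X0 x = indicator E x * (2 * max 0 (u x - w x - \<eta>))" for x
  have contE: "continuous_on E u" "continuous_on E w"
    using EO1 O1D contuD contwD continuous_on_subset by blast+
  have Xm[measurable]: "X k \<in> borel_measurable borel" for k
  proof -
    have "(\<lambda>x. indicator E x *\<^sub>R (2 * max 0 (v k x - w x - \<eta>))) \<in> borel_measurable borel"
      by (intro borel_measurable_continuous_on_indicator continuous_intros vcont contE) auto
    then show ?thesis by (simp add: X_def[abs_def])
  qed
  have X0m[measurable]: "X0 \<in> borel_measurable borel"
  proof -
    have "(\<lambda>x. indicator E x *\<^sub>R (2 * max 0 (u x - w x - \<eta>))) \<in> borel_measurable borel"
      by (intro borel_measurable_continuous_on_indicator continuous_intros contE) auto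
    then show ?thesis by (simp add: X0_def[abs_def])
  qed
  have Xpos: "0 \<le> X k x" "0 \<le> X0 x" for k x by (auto simp: X_def X0_def)
  have "continuous_on E (\<lambda>x. u x - w x)" using contE by (intro continuous_intros)
  then have "bounded ((\<lambda>x. u x - w x) ` E)" using E by (intro compact_imp_bounded compact_continuous_image)
  then obtain B0 where B0: "B0 > 0" "\<And>x. x \<in> E \<Longrightarrow> \<bar>u x - w x\<bar> \<le> B0" unfolding bounded_pos by auto
  define B where "B = 2 * (B0 + 1)"
  have B: "B > 0" using B0 by (simp add: B_def)
  \<comment> \<open>An error of at most \<open>\<eta> / 4\<close> confines the support of
    \<open>\<zeta> k\<close> to \<open>E\<close>; an error of at most 1 bounds \<open>X k\<close> by
    \<open>B\<close>.\<close>
  define good where "good k \<longleftrightarrow> (\<forall>x\<in>K. \<bar>v k x - u x\<bar> \<le> min 1 (\<eta> / 4))" for k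
  have ev_good: "\<forall>\<^sub>F k in sequentially. good k"
    unfolding good_def using \<eta> by (intro vu) auto
  have XB: "X k x \<le> B" if "good k" for k x
  proof (cases "x \<in> E")
    case True
    then have "\<bar>v k x - u x\<bar> \<le> 1" "\<bar>u x - w x\<bar> \<le> B0" using that EK B0 by (auto simp: good_def)
    then have "v k x - w x - \<eta> \<le> B0 + 1" using \<eta>(1) by linarith
    then have le: "max 0 (v k x - w x - \<eta>) \<le> B0 + 1" using B0(1) by simp
    have "X k x = 2 * max 0 (v k x - w x - \<eta>)" using True by (simp add: X_def)
    also have "\<dots> \<le> 2 * (B0 + 1)" using le by (rule mult_left_mono) simp
    finally show ?thesis unfolding B_def .
  qed (use B in \<open>simp add: X_def\<close>)
  define \<zeta> where "\<zeta> k x = indicator O1 x * (max 0 (v k x - w x - \<eta>))\<^sup>2" for k x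
  have \<zeta>0: "\<zeta> k x = 0" if k: "good k" and x: "x \<notin> E" for k x
  proof (cases "x \<in> O1")
    case True
    then have "x \<in> K" using O1K by blast
    then have a: "\<bar>v k x - u x\<bar> \<le> min 1 (\<eta> / 4)" and "u x - w x < \<eta> / 2" using k x by (auto simp: good_def E_def)
    moreover have "v k x \<le> u x + \<eta> / 4" using order_trans[OF a min.cobounded2] by linarith
    ultimately have "v k x \<le> u x + \<eta> / 4" "u x - w x < \<eta> / 2" by simp_all
    then show ?thesis using \<eta> by (simp add: \<zeta>_def)
  qed (simp add: \<zeta>_def)
  have \<zeta>d: "\<zeta> k differentiable (at x)" "grad (\<zeta> k) x = (2 * max 0 (v k x - w x - \<eta>)) *\<^sub>R (grad (v k) x - grad w x)"
    if x: "x \<in> O1" for k x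
  proof -
    let ?f = "\<lambda>x. v k x - w x - \<eta>"
    have 1: "(?f has_derivative (\<lambda>h. (grad (v k) x - grad w x) \<bullet> h)) (at x)"
    proof -
      have "w differentiable (at x)" using x O1D w(1) by blast
      from has_derivative_diff[OF has_derivative_diff[OF has_derivative_grad[OF vd] has_derivative_grad[OF this]] has_derivative_const]
      show ?thesis by (rule has_derivative_eq_rhs) (simp add: fun_eq_iff inner_diff_left)
    qed
    have "((\<lambda>t::real. (max 0 t)\<^sup>2) has_derivative (\<lambda>h. 2 * max 0 (?f x) * h)) (at (?f x))"
      unfolding has_derivative_at_alt
    proof (intro conjI allI impI)
      show "bounded_linear ((*) (2 * max 0 (?f x)))" by (rule bounded_linear_mult_right)
      fix e :: real assume e: "0 < e"
      have "norm ((max 0 z)\<^sup>2 - (max 0 (?f x))\<^sup>2 - 2 * max 0 (?f x) * (z - ?f x)) \<le> e * norm (z - ?f x)"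
        if "norm (z - ?f x) < e" for z
      proof -
        have "norm ((max 0 z)\<^sup>2 - (max 0 (?f x))\<^sup>2 - 2 * max 0 (?f x) * (z - ?f x)) \<le> (z - ?f x)\<^sup>2"
          using max_square_expansion[of "?f x" "z - ?f x"] by (simp only: real_norm_def add_diff_cancel_left' diff_add_cancel add.commute[of "?f x" "z - ?f x"])
        also have "\<dots> = \<bar>z - ?f x\<bar> * \<bar>z - ?f x\<bar>" by (simp add: power2_eq_square abs_mult_self_eq)
        also have "\<dots> \<le> e * \<bar>z - ?f x\<bar>" using that by (intro mult_right_mono) auto
        finally show ?thesis by simp
      qed
      then show "\<exists>d>0. \<forall>z. norm (z - ?f x) < d \<longrightarrow> norm ((max 0 z)\<^sup>2 - (max 0 (?f x))\<^sup>2 - 2 * max 0 (?f x) * (z - ?f x)) \<le> e * norm (z - ?f x)"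
        using e by blast
    qed
    from has_derivative_compose[OF 1 this]
    have D2: "((\<lambda>x. (max 0 (?f x))\<^sup>2) has_derivative (\<lambda>h. ((2 * max 0 (?f x)) *\<^sub>R (grad (v k) x - grad w x)) \<bullet> h)) (at x)"
      by simp
    have eq: "\<zeta> k z = (max 0 (?f z))\<^sup>2" if "z \<in> O1" for z using that by (simp add: \<zeta>_def)
    show "\<zeta> k differentiable (at x)"
      by (rule grad_eqI_open(1)[OF O1 x eq grad_unique(1)[OF D2]])
    show "grad (\<zeta> k) x = (2 * max 0 (v k x - w x - \<eta>)) *\<^sub>R (grad (v k) x - grad w x)"
      using grad_eqI_open(2)[OF O1 x eq grad_unique(1)[OF D2]] grad_unique(2)[OF D2] by simp
  qed
  have \<zeta>C: "\<zeta> k \<in> C1c D" if k: "good k" for k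
  proof (rule C1c_I[OF O1 E EO1])
    show "E \<subseteq> D" using EO1 O1D by blast
    show "continuous_on O1 (grad (\<zeta> k))"
      by (subst continuous_on_cong[OF refl \<zeta>d(2)], assumption)
        (intro continuous_intros vcont gvcont continuous_on_subset[OF contwD O1D] continuous_on_subset[OF w(2) O1D])
  qed (use \<zeta>d \<zeta>0[OF k] in auto)
  have g\<zeta>: "grad (\<zeta> k) x = X k x *\<^sub>R (Dk k x + H x)" if k: "good k" for k x
  proof (cases "x \<in> E")
    case True
    then have "x \<in> K" "x \<in> O1" using EK EO1 by blast+
    then show ?thesis using True \<zeta>d(2)[of x k] by (simp add: X_def Dk_def H_def GK_def gK_def)
  next
    case False
    have "grad (\<zeta> k) x = grad (\<lambda>_. 0) x"
      using E False \<zeta>0[OF k] by (intro grad_eqI_open(2)[of "- E"]) (auto simp: compact_imp_closed open_Compl)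
    also have "\<dots> = 0" by (rule grad_unique) simp
    finally show ?thesis using False by (simp add: X_def)
  qed
  have XK: "X k x = 0" if "x \<notin> K" for k x using that EK by (auto simp: X_def indicator_def)
  have iFV: "integrable lborel (\<lambda>x. X k x * (F x \<bullet> V x))" "\<bar>LINT x|lborel. X k x * (F x \<bullet> V x)\<bar> \<le> B * (LINT x|lborel. norm (F x) * norm (V x))"
    if [measurable]: "V \<in> borel_measurable borel" and V: "integrable lborel (\<lambda>x. norm (V x) powr p)" and k: "good k" for V :: "'a \<Rightarrow> 'a" and k
  proof -
    have le: "norm (X k x * (F x \<bullet> V x)) \<le> B * (norm (F x) * norm (V x))" for x
      unfolding norm_mult using XB[OF k, of x] Xpos(1)[of k x] Cauchy_Schwarz_ineq2[of "F x" "V x"] B by (intro mult_mono) auto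
    have i: "integrable lborel (\<lambda>x. B * (norm (F x) * norm (V x)))" using pmi(3)[OF that(1) V, of 0] by simp
    show 1: "integrable lborel (\<lambda>x. X k x * (F x \<bullet> V x))"
      by (rule Bochner_Integration.integrable_bound[OF i], measurable) (intro AE_I2 order_trans[OF le], simp)
    have "norm (LINT x|lborel. X k x * (F x \<bullet> V x)) \<le> (LINT x|lborel. B * (norm (F x) * norm (V x)))"
      by (rule Bochner_Integration.integral_norm_bound_integral[OF 1 i le])
    then show "\<bar>LINT x|lborel. X k x * (F x \<bullet> V x)\<bar> \<le> B * (LINT x|lborel. norm (F x) * norm (V x))" by simp
  qed
  \<comment> \<open>The gradient of the test function is \<open>X k\<close> times
    \<open>Dk k + H\<close>. Subtracting the two weak inequalities leaves the monotone term in
    \<open>H\<close> on the left and moves the approximation error \<open>Dk k\<close> to the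
    right.\<close>
  have key: "(LINT x|lborel. X k x * (F x \<bullet> H x)) \<le> B * (LINT x|lborel. norm (F x) * norm (Dk k x))" if k: "good k" for k
  proof -
    have \<zeta>nn: "0 \<le> \<zeta> k x" for x by (simp add: \<zeta>_def)
    have gm[measurable]: "grad (\<zeta> k) \<in> borel_measurable borel"
      using C1cD(2)[OF \<zeta>C[OF k]] by (rule borel_measurable_continuous_onI)
    have "(LINT x:D|lebesgue. p_flux p (G x) \<bullet> grad (\<zeta> k) x) = (LINT x|lebesgue. p_flux p (GK x) \<bullet> grad (\<zeta> k) x)"
      unfolding set_lebesgue_integral_def
    proof (rule integral_cong_AE)
      show "(\<lambda>x. p_flux p (GK x) \<bullet> grad (\<zeta> k) x) \<in> borel_measurable lebesgue"
        by (rule measurable_completion) measurable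
      have "(\<lambda>x. if x \<in> \<Omega> then G x else 0) \<in> borel_measurable lebesgue"
        using W \<Omega> by (intro borel_measurable_if_I) (auto simp: W1p_loc_def Lp_loc_def lebesgue_openin)
      then have "(\<lambda>x. p_flux p (if x \<in> \<Omega> then G x else 0)) \<in> borel_measurable lebesgue"
        by (rule measurable_compose[OF _ pfm])
      then have "(\<lambda>x. p_flux p (if x \<in> \<Omega> then G x else 0) \<bullet> grad (\<zeta> k) x) \<in> borel_measurable lebesgue"
        by (rule borel_measurable_inner) (rule measurable_completion, simp add: gm)
      also have "(\<lambda>x. p_flux p (if x \<in> \<Omega> then G x else 0) \<bullet> grad (\<zeta> k) x) = (\<lambda>x. indicator D x *\<^sub>R (p_flux p (G x) \<bullet> grad (\<zeta> k) x))"
      proof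
        fix x
        show "p_flux p (if x \<in> \<Omega> then G x else 0) \<bullet> grad (\<zeta> k) x = indicator D x *\<^sub>R (p_flux p (G x) \<bullet> grad (\<zeta> k) x)"
        proof (cases "x \<in> D")
          case False
          then have "x \<notin> K" using K(2) by blast
          then show ?thesis using False by (simp add: g\<zeta>[OF k] XK)
        qed (use D(2) in auto)
      qed
      finally show "(\<lambda>x. indicator D x *\<^sub>R (p_flux p (G x) \<bullet> grad (\<zeta> k) x)) \<in> borel_measurable lebesgue" .
      show "AE x in lebesgue. indicator D x *\<^sub>R (p_flux p (G x) \<bullet> grad (\<zeta> k) x) = p_flux p (GK x) \<bullet> grad (\<zeta> k) x"
        using GGh
      proof eventually_elim
        case (elim x)
        then show ?case using K(2) by (cases "x \<in> K") (auto simp: GK_def g\<zeta>[OF k] XK)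
      qed
    qed
    also have "\<dots> = (LINT x|lborel. p_flux p (GK x) \<bullet> grad (\<zeta> k) x)"
      by (rule integral_completion) measurable
    finally have 1: "(LINT x|lborel. p_flux p (GK x) \<bullet> grad (\<zeta> k) x) \<le> 0"
      using sub[OF \<zeta>C[OF k] \<zeta>nn] by simp
    have "(LINT x|lborel. p_flux p (grad w x) \<bullet> grad (\<zeta> k) x) = (LINT x|lborel. p_flux p (gK x) \<bullet> grad (\<zeta> k) x)"
      by (rule Bochner_Integration.integral_cong[OF refl]) (auto simp: gK_def indicator_def g\<zeta>[OF k] XK)
    then have 2: "0 \<le> (LINT x|lborel. p_flux p (gK x) \<bullet> grad (\<zeta> k) x)"
      using super[OF \<zeta>C[OF k] \<zeta>nn] by simp
    have ip: "integrable lborel (\<lambda>x. p_flux p (V x) \<bullet> grad (\<zeta> k) x)"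
      if [measurable]: "V \<in> borel_measurable borel" and le: "\<And>x. norm (V x) \<le> norm (GK x) + indicator K x * M" for V
    proof (rule Bochner_Integration.integrable_bound)
      have 1: "integrable lborel (\<lambda>x. (norm (GK x) + indicator K x * M) powr p)"
      proof (rule Bochner_Integration.integrable_bound)
        show "integrable lborel (\<lambda>x. 2 powr p * (norm (GK x) powr p + (indicator K x * M) powr p))" using iGK iconst by simp
        show "AE x in lborel. norm ((norm (GK x) + indicator K x * M) powr p) \<le> norm (2 powr p * (norm (GK x) powr p + (indicator K x * M) powr p))"
        proof (intro AE_I2)
          fix x
          have "(norm (GK x) + indicator K x * M) powr p \<le> 2 powr p * (norm (GK x) powr p + (indicator K x * M) powr p)"
            using p M(1) by (intro powr_add_le) auto
          then show "norm ((norm (GK x) + indicator K x * M) powr p) \<le> norm (2 powr p * (norm (GK x) powr p + (indicator K x * M) powr p))"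
            by simp
        qed
      qed measurable
      have 2: "integrable lborel (\<lambda>x. norm (grad (\<zeta> k) x) powr p)"
      proof (rule integrable_compact_support[OF E])
        show "continuous_on E (\<lambda>x. norm (grad (\<zeta> k) x) powr p)"
          using p by (intro continuous_on_powr' continuous_on_norm continuous_on_const
            continuous_on_subset[OF C1cD(2)[OF \<zeta>C[OF k]] subset_UNIV]) auto
        show "norm (grad (\<zeta> k) x) powr p = 0" if "x \<notin> E" for x using that by (simp add: g\<zeta>[OF k] X_def)
      qed
      show "integrable lborel (\<lambda>x. (norm (GK x) + indicator K x * M) powr (p - 1) * norm (grad (\<zeta> k) x))"
        using M 1 2 by (intro integrable_powr_mult[OF p]) auto
      show "AE x in lborel. norm (p_flux p (V x) \<bullet> grad (\<zeta> k) x) \<le> norm ((norm (GK x) + indicator K x * M) powr (p - 1) * norm (grad (\<zeta> k) x))"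
      proof (intro AE_I2)
        fix x
        have "norm (p_flux p (V x) \<bullet> grad (\<zeta> k) x) \<le> norm (V x) powr (p - 1) * norm (grad (\<zeta> k) x)"
          using Cauchy_Schwarz_ineq2[of "p_flux p (V x)" "grad (\<zeta> k) x"] by (simp add: norm_p_flux[OF p])
        also have "\<dots> \<le> (norm (GK x) + indicator K x * M) powr (p - 1) * norm (grad (\<zeta> k) x)"
          using le[of x] p by (intro mult_right_mono powr_mono2) auto
        finally show "norm (p_flux p (V x) \<bullet> grad (\<zeta> k) x) \<le> norm ((norm (GK x) + indicator K x * M) powr (p - 1) * norm (grad (\<zeta> k) x))" by simp
      qed
    qed measurable
    have ip1: "integrable lborel (\<lambda>x. p_flux p (GK x) \<bullet> grad (\<zeta> k) x)"
      by (rule ip[OF GKm]) (use M(1) in simp)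
    have ip2: "integrable lborel (\<lambda>x. p_flux p (gK x) \<bullet> grad (\<zeta> k) x)"
      by (rule ip[OF gKm order_trans[OF gKM]]) simp
    have "(LINT x|lborel. X k x * (F x \<bullet> Dk k x)) + (LINT x|lborel. X k x * (F x \<bullet> H x)) = (LINT x|lborel. X k x * (F x \<bullet> Dk k x) + X k x * (F x \<bullet> H x))"
      using iFV(1)[OF Dkm[of k] iD[of k] k] iFV(1)[OF Hm iH k] by simp
    also have "\<dots> = (LINT x|lborel. p_flux p (GK x) \<bullet> grad (\<zeta> k) x - p_flux p (gK x) \<bullet> grad (\<zeta> k) x)"
      by (rule Bochner_Integration.integral_cong[OF refl])
        (simp add: g\<zeta>[OF k] F_def inner_diff_left inner_add_right algebra_simps)
    also have "\<dots> \<le> 0" using 1 2 ip1 ip2 by simp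
    finally show ?thesis using iFV(2)[OF Dkm[of k] iD[of k] k] by linarith
  qed
  have pt: "(\<lambda>k. X k x) \<longlonglongrightarrow> X0 x" for x
  proof (cases "x \<in> E")
    case True
    have "(\<lambda>k. v k x) \<longlonglongrightarrow> u x"
    proof (rule tendstoI)
      fix e :: real assume "0 < e"
      then have "\<forall>\<^sub>F k in sequentially. \<forall>x\<in>K. \<bar>v k x - u x\<bar> \<le> e / 2" by (intro vu) auto
      then show "\<forall>\<^sub>F k in sequentially. dist (v k x) (u x) < e"
        by eventually_elim (use True EK \<open>0 < e\<close> in \<open>force simp: dist_real_def\<close>)
    qed
    then show ?thesis unfolding X_def X0_def by (intro tendsto_intros)
  qed (simp add: X_def X0_def)
  \<comment> \<open>Shifting the index by \<open>k0\<close> makes every member \<open>good\<close>,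
    so the bound \<open>B\<close> and with it the dominating functions are available for all
    indices.\<close>
  obtain k0 where k0: "\<And>k. k \<ge> k0 \<Longrightarrow> good k" using ev_good unfolding eventually_sequentially by blast
  have limFH: "(\<lambda>k. LINT x|lborel. X (k + k0) x * (F x \<bullet> H x)) \<longlonglongrightarrow> (LINT x|lborel. X0 x * (F x \<bullet> H x))"
  proof (rule integral_dominated_convergence[where w = "\<lambda>x. B * (norm (F x) * norm (H x))"])
    show "integrable lborel (\<lambda>x. B * (norm (F x) * norm (H x)))" using pmi(3)[OF Hm iH, of 0] by simp
    show "AE x in lborel. (\<lambda>k. X (k + k0) x * (F x \<bullet> H x)) \<longlonglongrightarrow> X0 x * (F x \<bullet> H x)"
      by (intro AE_I2 tendsto_mult tendsto_const LIMSEQ_ignore_initial_segment pt)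
    show "AE x in lborel. norm (X (k + k0) x * (F x \<bullet> H x)) \<le> B * (norm (F x) * norm (H x))" for k
      unfolding norm_mult using XB[OF k0] Xpos Cauchy_Schwarz_ineq2 B by (intro AE_I2 mult_mono) auto
  qed measurable
  have limr: "(\<lambda>k. B * (LINT x|lborel. norm (F x) * norm (Dk (k + k0) x))) \<longlonglongrightarrow> 0"
    by (intro tendsto_mult_right_zero LIMSEQ_ignore_initial_segment[OF limFD])
  have le0: "(LINT x|lborel. X0 x * (F x \<bullet> H x)) \<le> 0"
    by (rule LIMSEQ_le[OF limFH limr]) (use key k0 in auto)
  have i0: "integrable lborel (\<lambda>x. X0 x * (F x \<bullet> H x))"
  proof (rule Bochner_Integration.integrable_bound)
    show "integrable lborel (\<lambda>x. B * (norm (F x) * norm (H x)))" using pmi(3)[OF Hm iH, of 0] by simp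
    have "X0 x \<le> B" for x
      using LIMSEQ_le_const2[OF pt] XB ev_good unfolding eventually_sequentially by blast
    then have "norm (X0 x * (F x \<bullet> H x)) \<le> B * (norm (F x) * norm (H x))" for x
      unfolding norm_mult using Xpos Cauchy_Schwarz_ineq2 B by (intro mult_mono) auto
    then show "AE x in lborel. norm (X0 x * (F x \<bullet> H x)) \<le> norm (B * (norm (F x) * norm (H x)))"
      using B by (intro AE_I2) simp
  qed measurable
  have nn0: "0 \<le> X0 x * (F x \<bullet> H x)" for x using Xpos FH by simp
  have "(LINT x|lborel. X0 x * (F x \<bullet> H x)) = 0"
    using le0 nn0 by (intro antisym Bochner_Integration.integral_nonneg) auto
  then have ae: "AE x in lborel. X0 x * (F x \<bullet> H x) = 0"
    using integral_nonneg_eq_0_iff_AE[OF i0] nn0 by simp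
  \<comment> \<open>Where \<open>X0\<close> does not vanish, the equality case of monotonicity
    forces \<open>H = 0\<close>.\<close>
  have ae': "AE x in lborel. X0 x * norm (H x) = 0"
    using ae
  proof eventually_elim
    case (elim x)
    then show ?case using p_flux_monotone(2)[OF p, of "GK x" "gK x"] by (auto simp: F_def H_def)
  qed
  have limH: "(\<lambda>k. LINT x|lborel. X (k + k0) x * norm (H x)) \<longlonglongrightarrow> (LINT x|lborel. X0 x * norm (H x))"
  proof (rule integral_dominated_convergence[where w = "\<lambda>x. B * norm (H x)"])
    show "integrable lborel (\<lambda>x. B * norm (H x))" using iH1 by simp
    show "AE x in lborel. (\<lambda>k. X (k + k0) x * norm (H x)) \<longlonglongrightarrow> X0 x * norm (H x)"
      by (intro AE_I2 tendsto_mult tendsto_const LIMSEQ_ignore_initial_segment pt)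
    show "AE x in lborel. norm (X (k + k0) x * norm (H x)) \<le> B * norm (H x)" for k
      unfolding norm_mult using XB[OF k0] Xpos B by (intro AE_I2 mult_mono) auto
  qed measurable
  have "(LINT x|lborel. X0 x * norm (H x)) = (LINT x|(lborel :: 'a measure). 0)"
    using ae' by (intro integral_cong_AE) auto
  then have limH0: "(\<lambda>k. LINT x|lborel. X (k + k0) x * norm (H x)) \<longlonglongrightarrow> 0" using limH by simp
  obtain R where R: "R > 0" "\<And>x. x \<in> K \<Longrightarrow> norm x \<le> R"
    using compact_imp_bounded[OF K(1)] unfolding bounded_pos by auto
  have bound: "(LINT x|lborel. \<zeta> (k + k0) x) \<le> R * (B * (LINT x|lborel. norm (Dk (k + k0) x)) + (LINT x|lborel. X (k + k0) x * norm (H x)))" for k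
  proof -
    let ?k = "k + k0"
    have k: "good ?k" by (rule k0) simp
    have iCH: "integrable lborel (\<lambda>x. X ?k x * norm (H x))"
      using integrable_scaleR_bounded[OF iH1 Xm[of ?k], of B] XB[OF k] Xpos by simp
    have "(LINT x|lborel. \<zeta> ?k x) \<le> R * (LINT x|lborel. norm (grad (\<zeta> ?k) x))"
      by (rule integral_le_moment_grad[OF C1c_mono[OF \<zeta>C[OF k] subset_UNIV]]) (use \<zeta>0[OF k] EK R in blast)
    also have "(LINT x|lborel. norm (grad (\<zeta> ?k) x)) \<le> (LINT x|lborel. B * norm (Dk ?k x) + X ?k x * norm (H x))"
    proof (rule integral_mono)
      show "integrable lborel (\<lambda>x. norm (grad (\<zeta> ?k) x))"
        by (intro integrable_norm integrable_compact_support[OF E] continuous_on_subset[OF C1cD(2)[OF \<zeta>C[OF k]] subset_UNIV])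
          (simp add: g\<zeta>[OF k] X_def)
      show "integrable lborel (\<lambda>x. B * norm (Dk ?k x) + X ?k x * norm (H x))" using iD1 iCH by simp
      show "norm (grad (\<zeta> ?k) x) \<le> B * norm (Dk ?k x) + X ?k x * norm (H x)" for x
      proof -
        have "norm (grad (\<zeta> ?k) x) \<le> X ?k x * norm (Dk ?k x) + X ?k x * norm (H x)"
          unfolding g\<zeta>[OF k] using Xpos(1)[of ?k x] norm_triangle_ineq[of "Dk ?k x" "H x"]
          by (simp add: distrib_left[symmetric] mult_left_mono)
        also have "\<dots> \<le> B * norm (Dk ?k x) + X ?k x * norm (H x)"
          using XB[OF k, of x] by (intro add_right_mono mult_right_mono) auto
        finally show ?thesis .
      qed
    qed
    also have "\<dots> = B * (LINT x|lborel. norm (Dk ?k x)) + (LINT x|lborel. X ?k x * norm (H x))"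
      using iD1 iCH by simp
    finally show ?thesis using R by simp
  qed
  have limR: "(\<lambda>k. R * (B * (LINT x|lborel. norm (Dk (k + k0) x)) + (LINT x|lborel. X (k + k0) x * norm (H x)))) \<longlonglongrightarrow> R * (B * 0 + 0)"
    by (intro tendsto_mult tendsto_add tendsto_const LIMSEQ_ignore_initial_segment[OF limD1] limH0)
  have "open (D \<inter> (\<lambda>x. u x - w x) -` {3 * \<eta> / 2<..})"
    using D(1) contuD contwD by (intro continuous_open_preimage continuous_intros) auto
  moreover have "y \<in> D \<inter> (\<lambda>x. u x - w x) -` {3 * \<eta> / 2<..}" using y \<eta> by auto
  ultimately obtain \<delta> where \<delta>: "\<delta> > 0" "ball y \<delta> \<subseteq> D \<inter> (\<lambda>x. u x - w x) -` {3 * \<eta> / 2<..}"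
    using openE by blast
  \<comment> \<open>Near \<open>y\<close> one has \<open>u - w > 3 * \<eta> / 2\<close>, hence
    \<open>v k - w - \<eta> \<ge> \<eta> / 4\<close> in spite of the error
    \<open>\<eta> / 4\<close>. The integrals of the test functions thus stay away from 0.\<close>
  have low: "(\<eta> / 4)\<^sup>2 * measure lborel (ball y \<delta>) \<le> (LINT x|lborel. \<zeta> (k + k0) x)" for k
  proof -
    let ?k = "k + k0"
    have k: "good ?k" by (rule k0) simp
    have "(\<eta> / 4)\<^sup>2 * measure lborel (ball y \<delta>) = (LINT x|lborel. indicator (ball y \<delta>) x * (\<eta> / 4)\<^sup>2)" by simp
    also have "\<dots> \<le> (LINT x|lborel. \<zeta> ?k x)"
    proof (rule integral_mono)
      show "integrable lborel (\<lambda>x. indicator (ball y \<delta>) x * (\<eta> / 4)\<^sup>2)"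
        by (intro integrable_mult_left integrable_real_indicator) (use emeasure_lborel_ball_finite[of y \<delta>] in auto)
      show "integrable lborel (\<zeta> ?k)"
        by (intro integrable_compact_support[OF E] \<zeta>0[OF k] continuous_on_subset[OF C1cD(5)[OF \<zeta>C[OF k]] subset_UNIV])
      fix x
      show "indicator (ball y \<delta>) x * (\<eta> / 4)\<^sup>2 \<le> \<zeta> ?k x"
      proof (cases "x \<in> ball y \<delta>")
        case True
        then have x: "x \<in> D" "3 * \<eta> / 2 < u x - w x" using \<delta> by auto
        then have xO: "x \<in> O1" using \<eta> by (simp add: O1_def)
        then have "\<bar>v ?k x - u x\<bar> \<le> \<eta> / 4" using k O1K by (auto simp: good_def)
        then have "\<eta> / 4 \<le> v ?k x - w x - \<eta>" using x by linarith
        then have "\<eta> / 4 \<le> max 0 (v ?k x - w x - \<eta>)" by (simp add: le_max_iff_disj)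
        then have "(\<eta> / 4)\<^sup>2 \<le> (max 0 (v ?k x - w x - \<eta>))\<^sup>2" by (rule power_mono) (use \<eta>(1) in simp)
        then show ?thesis using True xO by (simp add: \<zeta>_def)
      qed (simp add: \<zeta>_def)
    qed
    finally show ?thesis .
  qed
  have "(\<eta> / 4)\<^sup>2 * measure lborel (ball y \<delta>) \<le> R * (B * 0 + 0)"
    by (rule LIMSEQ_le_const[OF limR]) (use low bound order_trans in blast)
  moreover have "0 < (\<eta> / 4)\<^sup>2 * measure lborel (ball y \<delta>)"
    using \<eta>(1) \<delta>(1) content_ball_pos[of \<delta> y] by (intro mult_pos_pos) auto
  ultimately show False by simp
qed

section \<open>Critical points of the obstacle and barriers\<close>

text \<open>It serves two purposes: estimating the cost of freezing the Hessian, and showing that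
  the hypothesis on the obstacle bounds the norm of the Hessian from below at noncritical
  points.\<close>

lemma abs_normalized_pl_le:
  fixes A :: "'a::euclidean_space \<Rightarrow>\<^sub>L 'a" and q :: real
  assumes "v \<noteq> 0"
  shows "\<bar>normalized_pl q A v\<bar> \<le> (DIM('a) + \<bar>q\<bar>) * norm A"
proof -
  have "\<bar>trace_blinfun A\<bar> \<le> (\<Sum>b\<in>(Basis :: 'a set). norm A)"
    unfolding trace_blinfun_def
  proof (rule order_trans[OF sum_abs], rule sum_mono)
    fix b :: 'a assume b: "b \<in> Basis"
    then show "\<bar>A b \<bullet> b\<bar> \<le> norm A"
      using Cauchy_Schwarz_ineq2[of "A b" b] norm_blinfun[of A b] by simp
  qed
  moreover have "\<bar>v \<bullet> A v\<bar> \<le> norm A * (v \<bullet> v)"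
    using Cauchy_Schwarz_ineq2[of v "A v"] mult_left_mono[OF norm_blinfun[of A v] norm_ge_zero[of v]]
    by (simp add: dot_square_norm power2_eq_square mult_ac)
  then have "\<bar>v \<bullet> A v\<bar> / (v \<bullet> v) \<le> norm A" using assms by (simp add: divide_le_eq)
  then have "\<bar>q\<bar> * (\<bar>v \<bullet> A v\<bar> / (v \<bullet> v)) \<le> \<bar>q\<bar> * norm A" by (intro mult_left_mono) auto
  then have "\<bar>q * (v \<bullet> A v) / (v \<bullet> v)\<bar> \<le> \<bar>q\<bar> * norm A" by (simp add: abs_mult)
  ultimately have "\<bar>trace_blinfun A + q * (v \<bullet> A v) / (v \<bullet> v)\<bar> \<le> (\<Sum>b\<in>(Basis :: 'a set). norm A) + \<bar>q\<bar> * norm A"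
    by (rule order_trans[OF abs_triangle_ineq add_mono])
  then show ?thesis by (simp add: normalized_pl_def distrib_right)
qed

lemma trace_blinfun_diff: "trace_blinfun (A - B) = trace_blinfun A - trace_blinfun B"
  by (simp add: trace_blinfun_def blinfun.diff_left inner_diff_left sum_subtractf)

lemma trace_blinfun_add: "trace_blinfun (A + B) = trace_blinfun A + trace_blinfun B"
  by (simp add: trace_blinfun_def blinfun.add_left inner_add_left sum.distrib)

lemma trace_blinfun_scaleR_id: "trace_blinfun (c *\<^sub>R id_blinfun :: 'a::euclidean_space \<Rightarrow>\<^sub>L 'a) = c * DIM('a)"
  by (simp add: trace_blinfun_def blinfun.scaleR_left)

lemma normalized_pl_diff: "normalized_pl q (A - B) v = normalized_pl q A v - normalized_pl q B v"
  by (simp add: normalized_pl_def trace_blinfun_diff blinfun.diff_left inner_diff_right right_diff_distrib diff_divide_distrib)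

lemma normalized_pl_add_scaleR_id:
  fixes A :: "'a::euclidean_space \<Rightarrow>\<^sub>L 'a" and q :: real
  assumes "v \<noteq> 0"
  shows "normalized_pl q (A + c *\<^sub>R id_blinfun) v = normalized_pl q A v + c * (DIM('a) + q)"
  using assms by (simp add: normalized_pl_def trace_blinfun_add trace_blinfun_scaleR_id blinfun.add_left
      blinfun.scaleR_left inner_add_right distrib_left distrib_right add_divide_distrib)

text \<open>On the interior \<open>Z\<close> of the critical set the Hessian vanishes. Every other
  point of \<open>S\<close> is a limit of noncritical points, where the hypothesis bounds the
  Hessian away from 0, and continuity carries this bound to the limit. So \<open>Z\<close> and
  \<open>S - Z\<close> are both open, and connectedness together with one noncritical point makes
  \<open>Z\<close> empty.\<close>

lemma critical_points_nowhere_dense: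
  fixes \<phi> :: "'a::euclidean_space \<Rightarrow> real" and c d q :: real
  assumes S: "open S" "connected S" and \<phi>: "C2_on S \<phi>" and c: "0 < c"
    and npl: "\<And>x. x \<in> S \<Longrightarrow> grad \<phi> x \<noteq> 0 \<Longrightarrow> normalized_pl q (hess \<phi> x) (grad \<phi> x) \<le> - c"
    and ne: "x1 \<in> S" "grad \<phi> x1 \<noteq> 0" and x: "x \<in> S" and d: "0 < d"
  obtains x' where "x' \<in> S" "dist x' x < d" "grad \<phi> x' \<noteq> 0"
proof -
  define Z where "Z = {x\<in>S. \<exists>\<delta>>0. \<forall>y\<in>ball x \<delta>. y \<in> S \<longrightarrow> grad \<phi> y = 0}"
  define m where "m = real DIM('a) + \<bar>q\<bar>"
  have m: "m > 0" unfolding m_def using DIM_positive[where 'a='a] by (simp add: add_pos_nonneg)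
  have ZS: "Z \<subseteq> S" by (auto simp: Z_def)
  have openZ: "open Z"
    unfolding open_contains_ball
  proof
    fix x assume "x \<in> Z"
    then obtain \<delta> where \<delta>: "x \<in> S" "\<delta> > 0" "\<And>y. y \<in> ball x \<delta> \<Longrightarrow> y \<in> S \<Longrightarrow> grad \<phi> y = 0" by (auto simp: Z_def)
    obtain \<epsilon> where \<epsilon>: "\<epsilon> > 0" "ball x \<epsilon> \<subseteq> S" using S(1) \<delta>(1) openE by blast
    have "ball x (min \<delta> \<epsilon>) \<subseteq> Z"
    proof
      fix y assume y: "y \<in> ball x (min \<delta> \<epsilon>)"
      have "\<forall>z\<in>ball y (\<delta> - dist x y). z \<in> S \<longrightarrow> grad \<phi> z = 0"
      proof (intro ballI impI)
        fix z assume "z \<in> ball y (\<delta> - dist x y)" "z \<in> S"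
        then show "grad \<phi> z = 0" using \<delta>(3)[of z] dist_triangle[of x z y] by auto
      qed
      moreover have "\<delta> - dist x y > 0" "y \<in> S" using y \<epsilon> by auto
      ultimately show "y \<in> Z" unfolding Z_def by blast
    qed
    then show "\<exists>e>0. ball x e \<subseteq> Z" using \<delta> \<epsilon> by (intro exI[of _ "min \<delta> \<epsilon>"]) auto
  qed
  have hess0: "hess \<phi> z = 0" if z: "z \<in> Z" for z
  proof (rule hess_unique)
    have "((\<lambda>_. 0) has_derivative (\<lambda>_. 0)) (at z)" by simp
    moreover have "grad \<phi> y = 0" if "y \<in> Z" for y using that by (force simp: Z_def)
    ultimately show "(grad \<phi> has_derivative blinfun_apply 0) (at z)"
      using has_derivative_transform_within_open[OF _ openZ z, of "\<lambda>_. 0" "\<lambda>_. 0" UNIV "grad \<phi>"] by (simp add: zero_blinfun.rep_eq)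
  qed
  have conth: "continuous_on S (\<lambda>x. norm (hess \<phi> x))"
    using C2_on_continuous(3)[OF \<phi>] by (intro continuous_intros)
  have "open (S - Z)"
  proof -
    have eq: "S - Z = S \<inter> (\<lambda>x. norm (hess \<phi> x)) -` {0<..}"
    proof (intro equalityI subsetI)
      fix x assume x: "x \<in> S - Z"
      have "norm (hess \<phi> x) \<ge> c / m"
      proof (rule ccontr)
        assume "\<not> ?thesis"
        moreover have "open (S \<inter> (\<lambda>x. norm (hess \<phi> x)) -` {..<c / m})"
          using conth S(1) by (intro continuous_open_preimage) auto
        ultimately obtain \<delta> where \<delta>: "\<delta> > 0" "ball x \<delta> \<subseteq> S \<inter> (\<lambda>x. norm (hess \<phi> x)) -` {..<c / m}"
          using x openE[of "S \<inter> (\<lambda>x. norm (hess \<phi> x)) -` {..<c / m}" x] by auto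
        have "grad \<phi> y = 0" if y: "y \<in> ball x \<delta>" for y
        proof (rule ccontr)
          assume g: "grad \<phi> y \<noteq> 0"
          have "y \<in> S" "norm (hess \<phi> y) < c / m" using \<delta> y by auto
          then have "m * norm (hess \<phi> y) < c" using m by (simp add: less_divide_eq mult.commute)
          then show False using npl[OF \<open>y \<in> S\<close> g] abs_normalized_pl_le[OF g, of q "hess \<phi> y"] by (simp add: m_def)
        qed
        then have "x \<in> Z" using x \<delta>(1) by (auto simp: Z_def)
        then show False using x by simp
      qed
      moreover have "c / m > 0" using c m by simp
      ultimately show "x \<in> S \<inter> (\<lambda>x. norm (hess \<phi> x)) -` {0<..}" using x by auto
    next
      fix x assume "x \<in> S \<inter> (\<lambda>x. norm (hess \<phi> x)) -` {0<..}"
      then show "x \<in> S - Z" using hess0[of x] by auto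
    qed
    show ?thesis unfolding eq using conth S(1) by (intro continuous_open_preimage) auto
  qed
  then have "Z = {} \<or> S - Z = {}"
    using connectedD[OF S(2) openZ, of "S - Z"] ZS by blast
  moreover have "x1 \<notin> Z" using ne by (auto simp: Z_def intro: centre_in_ball[THEN iffD2])
  ultimately have "Z = {}" using ne by auto
  then have "x \<notin> Z" by simp
  then show ?thesis using x d that unfolding Z_def by (auto simp: dist_commute)
qed

section \<open>The strong minimum principle\<close>

lemma W1p_loc_uminus:
  assumes "W1p_loc p \<Omega> u G"
  shows "W1p_loc p \<Omega> (\<lambda>x. - u x) (\<lambda>x. - G x)"
  using assms by (auto simp: W1p_loc_def Lp_loc_def has_weak_gradient_def set_lebesgue_integral_def)

lemma p_flux_uminus: "p_flux p (- v) = - p_flux p v"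
  by (simp add: p_flux_def)

lemma C1c_integral_subset:
  assumes "\<zeta> \<in> C1c D" "D \<subseteq> \<Omega>"
  shows "(LINT x:D|lebesgue. f x \<bullet> grad \<zeta> x) = (LINT x:\<Omega>|lebesgue. f x \<bullet> grad \<zeta> x)"
  unfolding set_lebesgue_integral_def
proof (rule Bochner_Integration.integral_cong[OF refl])
  fix x
  show "indicat_real D x *\<^sub>R (f x \<bullet> grad \<zeta> x) = indicat_real \<Omega> x *\<^sub>R (f x \<bullet> grad \<zeta> x)"
  proof (cases "x \<in> closure {x. \<zeta> x \<noteq> 0}")
    case True
    then show ?thesis using C1cD(4)[OF assms(1)] assms(2) by (auto simp: indicator_def)
  next
    case False
    then show ?thesis using C1c_grad_eq_0(2)[OF assms(1) False] by simp
  qed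
qed

text \<open>The barrier of Hopf's lemma, with the sign of a supersolution because it is compared
  with \<open>- u\<close>. Its operator is a positive factor times
  \<open>n + q - 2 * \<alpha> * |x - y|^2 * (1 + q)\<close>; for \<open>1 + q > 0\<close> a large
  \<open>\<alpha>\<close> makes this negative away from \<open>y\<close>.\<close>

lemma exp_barrier:
  fixes y :: "'a::euclidean_space" and c \<epsilon> \<alpha> q :: real
  assumes \<alpha>: "0 < \<alpha>" and \<epsilon>: "0 < \<epsilon>"
  defines "w \<equiv> \<lambda>x. c - \<epsilon> * exp (- \<alpha> * ((x - y) \<bullet> (x - y)))"
  shows "C2_on UNIV w"
    and "x \<noteq> y \<Longrightarrow> grad w x \<noteq> 0"
    and "x \<noteq> y \<Longrightarrow> real DIM('a) + q < 2 * \<alpha> * ((x - y) \<bullet> (x - y)) * (1 + q) \<Longrightarrow> normalized_pl q (hess w x) (grad w x) < 0"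
proof -
  define E where "E x = exp (- \<alpha> * ((x - y) \<bullet> (x - y)))" for x
  have dE: "(E has_derivative (\<lambda>h. - 2 * \<alpha> * E x * ((x - y) \<bullet> h))) (at x)" for x
    unfolding E_def by (auto intro!: derivative_eq_intros simp: fun_eq_iff inner_commute algebra_simps)
  have dw: "(w has_derivative (\<lambda>h. ((2 * \<alpha> * \<epsilon> * E x) *\<^sub>R (x - y)) \<bullet> h)) (at x)" for x
    unfolding w_def E_def[symmetric]
    by (rule has_derivative_eq_rhs[OF has_derivative_diff[OF has_derivative_const has_derivative_mult_right[OF dE]]])
      (simp add: fun_eq_iff)
  have gw: "grad w = (\<lambda>x. (2 * \<alpha> * \<epsilon> * E x) *\<^sub>R (x - y))"
    using grad_unique(2)[OF dw] by (simp add: fun_eq_iff)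
  define A where "A x = Blinfun (\<lambda>h. (2 * \<alpha> * \<epsilon> * E x) *\<^sub>R (h - (2 * \<alpha> * ((x - y) \<bullet> h)) *\<^sub>R (x - y)))" for x
  have bl: "bounded_linear (\<lambda>h. (2 * \<alpha> * \<epsilon> * E x) *\<^sub>R (h - (2 * \<alpha> * ((x - y) \<bullet> h)) *\<^sub>R (x - y)))" for x
    by (intro bounded_linear_intros)
  have Ab: "blinfun_apply (A x) = (\<lambda>h. (2 * \<alpha> * \<epsilon> * E x) *\<^sub>R (h - (2 * \<alpha> * ((x - y) \<bullet> h)) *\<^sub>R (x - y)))" for x
    unfolding A_def using bl by (rule bounded_linear_Blinfun_apply)
  have dg: "(grad w has_derivative blinfun_apply (A x)) (at x)" for x
  proof -
    have "((\<lambda>x. (2 * \<alpha> * \<epsilon> * E x) *\<^sub>R (x - y)) has_derivative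
      (\<lambda>h. (2 * \<alpha> * \<epsilon> * E x) *\<^sub>R (h - 0) + (2 * \<alpha> * \<epsilon> * (- 2 * \<alpha> * E x * ((x - y) \<bullet> h))) *\<^sub>R (x - y))) (at x)"
      by (intro has_derivative_scaleR has_derivative_mult_right dE has_derivative_diff has_derivative_ident has_derivative_const)
    then show ?thesis unfolding gw Ab
      by (rule has_derivative_eq_rhs) (simp add: fun_eq_iff algebra_simps)
  qed
  have hw: "hess w x = A x" for x by (rule hess_unique[OF dg])
  have contE: "continuous_on UNIV E" unfolding E_def[abs_def] by (intro continuous_intros)
  have "continuous_on UNIV A"
    by (rule continuous_on_blinfun_componentwise) (unfold Ab, intro continuous_intros contE)
  then show "C2_on UNIV w" unfolding C2_on_def using dw dg hw by (auto simp: differentiable_def hw[abs_def])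
  have E0: "E x > 0" for x by (simp add: E_def)
  show gne: "grad w x \<noteq> 0" if "x \<noteq> y" using that \<alpha> \<epsilon> E0[of x] by (simp add: gw)
  assume x: "x \<noteq> y" and big: "real DIM('a) + q < 2 * \<alpha> * ((x - y) \<bullet> (x - y)) * (1 + q)"
  define d where "d = x - y"
  define s where "s = 2 * \<alpha> * \<epsilon> * E x"
  have s: "s > 0" using \<alpha> \<epsilon> E0 by (simp add: s_def)
  have d: "d \<bullet> d > 0" using x by (simp add: d_def)
  have tr: "trace_blinfun (A x) = s * (DIM('a) - 2 * \<alpha> * (d \<bullet> d))"
  proof -
    have "trace_blinfun (A x) = (\<Sum>b\<in>Basis. s * (1 - 2 * \<alpha> * ((d \<bullet> b) * (d \<bullet> b))))"
      unfolding trace_blinfun_def Ab d_def[symmetric] s_def[symmetric]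
      by (intro sum.cong refl) (simp add: inner_diff_left algebra_simps)
    also have "\<dots> = s * (DIM('a) - 2 * \<alpha> * (d \<bullet> d))"
      by (simp add: sum_distrib_left[symmetric] sum_subtractf euclidean_inner[of d d])
    finally show ?thesis .
  qed
  have Ad: "(s *\<^sub>R d) \<bullet> A x (s *\<^sub>R d) = (s * s * (d \<bullet> d)) * (s * (1 - 2 * \<alpha> * (d \<bullet> d)))"
    unfolding Ab d_def[symmetric] s_def[symmetric] by (simp add: inner_diff_right algebra_simps)
  have gxs: "grad w x = s *\<^sub>R d" by (simp add: gw d_def s_def)
  have "(s *\<^sub>R d) \<bullet> (s *\<^sub>R d) = s * s * (d \<bullet> d)" by simp
  then have "normalized_pl q (hess w x) (grad w x) = s * (DIM('a) - 2 * \<alpha> * (d \<bullet> d)) + q * (s * (1 - 2 * \<alpha> * (d \<bullet> d)))"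
    unfolding normalized_pl_def hw gxs tr Ad using s d by simp
  also have "\<dots> = s * (DIM('a) + q - 2 * \<alpha> * (d \<bullet> d) * (1 + q))" by (simp add: algebra_simps)
  finally have "normalized_pl q (hess w x) (grad w x) = s * (DIM('a) + q - 2 * \<alpha> * (d \<bullet> d) * (1 + q))" .
  then show "normalized_pl q (hess w x) (grad w x) < 0"
    using s big by (simp add: mult_less_0_iff d_def)
qed

text \<open>Take the point \<open>z\<close> of the level set nearest to \<open>y1\<close> and a ball
  of half the radius, internally tangent at \<open>z\<close>, so that \<open>z\<close> is its only
  point on the level. On a small ball around \<open>z\<close>, weak comparison of \<open>- u\<close>
  with a lowered Hopf barrier yields \<open>u z > k\<close>. No derivative of \<open>u\<close> at
  \<open>z\<close> is involved, unlike in the boundary point lemma.\<close>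

lemma strong_minimum_principle:
  fixes u :: "'a::euclidean_space \<Rightarrow> real" and k :: real
  assumes p: "1 < p" and \<Omega>: "open \<Omega>" and u: "continuous_on \<Omega> u" and W: "W1p_loc p \<Omega> u G"
    and sh: "weakly_p_superharmonic p \<Omega> G" and k: "\<And>x. x \<in> \<Omega> \<Longrightarrow> k \<le> u x"
    and x0: "u x0 = k" and y1: "cball y1 (dist y1 x0) \<subseteq> \<Omega>"
  shows "u y1 = k"
proof (rule ccontr)
  assume ne: "u y1 \<noteq> k"
  define B where "B = cball y1 (dist y1 x0)"
  have B\<Omega>: "B \<subseteq> \<Omega>" using y1 by (simp add: B_def)
  have "closedin (top_of_set B) (B \<inter> u -` {k})"
    by (rule continuous_closedin_preimage[OF continuous_on_subset[OF u B\<Omega>]]) simp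
  then have "compact (B \<inter> u -` {k})" by (rule closedin_compact[rotated]) (simp add: B_def)
  then have "closed (B \<inter> u -` {k})" by (rule compact_imp_closed)
  moreover have "x0 \<in> B \<inter> u -` {k}" using x0 by (simp add: B_def)
  then have "B \<inter> u -` {k} \<noteq> {}" by blast
  ultimately obtain z where zC: "z \<in> B \<inter> u -` {k}" "\<And>x. x \<in> B \<inter> u -` {k} \<Longrightarrow> dist y1 z \<le> dist y1 x"
    by (rule distance_attains_inf[where a = y1]) blast
  have z: "z \<in> B" "u z = k" using zC(1) by simp_all
  have near: "dist y1 z \<le> dist y1 x" if "x \<in> B" "u x = k" for x using zC(2)[of x] that by simp
  \<comment> \<open>The centre \<open>y\<close> lies half way between \<open>y1\<close> and
    \<open>z\<close>. The ball around \<open>y1\<close> through \<open>z\<close> has no interior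
    point on the level, and the ball of radius \<open>R\<close> around \<open>y\<close> touches its
    boundary at \<open>z\<close> alone.\<close>
  define m where "m = (1/2) *\<^sub>R (z - y1)"
  define y where "y = y1 + m"
  define R where "R = norm m"
  have "m + m = z - y1" unfolding m_def scaleR_add_right[symmetric] by simp
  then have zy: "z = y + m" by (simp add: y_def add.assoc)
  have R: "R > 0" using z ne by (auto simp: R_def m_def)
  have dz: "dist y1 z = 2 * R" by (simp add: R_def m_def dist_norm norm_minus_commute)
  have inside: "k < u x" if x: "x \<in> cball y R" "x \<noteq> z" for x
  proof -
    define h where "h = x - y"
    have nh: "norm h \<le> R" using x by (simp add: h_def dist_norm norm_minus_commute)
    have xm: "x - y1 = m + h" by (simp add: h_def y_def)
    have "dist y1 x < 2 * R"
    proof (rule ccontr)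
      assume "\<not> ?thesis"
      then have "norm (m + h) \<ge> 2 * R" unfolding xm[symmetric] by (simp add: dist_norm norm_minus_commute)
      \<comment> \<open>Equality in the triangle inequality makes \<open>h\<close> a nonnegative
        multiple of \<open>m\<close>, and equal norms give \<open>h = m\<close>, that is, the
        excluded point \<open>z\<close>.\<close>
      then have eq: "norm (m + h) = norm m + norm h" "norm h = norm m"
        using nh norm_triangle_ineq[of m h] by (auto simp: R_def)
      then have "norm m *\<^sub>R h = norm h *\<^sub>R m" using norm_triangle_eq[of m h] by simp
      then have "h = m" using eq(2) R by (simp add: R_def)
      moreover have "x = y + h" by (simp add: h_def)
      ultimately show False using x(2) zy by simp
    qed
    then have "dist y1 x < dist y1 z" by (simp add: dz)
    moreover have "dist y1 z \<le> dist y1 x0" using z(1) by (simp add: B_def)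
    ultimately have "x \<in> B" "u x \<noteq> k" using near[of x] by (auto simp: B_def)
    then show ?thesis using k[of x] B\<Omega> by force
  qed
  have "z \<in> \<Omega>" using z B\<Omega> by blast
  then obtain \<delta>1 where \<delta>1: "\<delta>1 > 0" "cball z \<delta>1 \<subseteq> \<Omega>" using \<Omega> open_contains_cball by blast
  define \<delta> where "\<delta> = min \<delta>1 (R / 2)"
  have \<delta>: "\<delta> > 0" "\<delta> \<le> R / 2" "cball z \<delta> \<subseteq> \<Omega>" using \<delta>1 R by (auto simp: \<delta>_def)
  define n where "n = real DIM('a)"
  define q where "q = p - 2"
  have n: "n \<ge> 1" unfolding n_def using DIM_positive[where 'a='a] by linarith
  have q: "1 + q > 0" using p by (simp add: q_def)
  \<comment> \<open>On the small ball around \<open>z\<close> one has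
    \<open>|x - y| > R / 2\<close>, and this choice turns that into
    \<open>2 * \<alpha> * |x - y|^2 * (1 + q) > 2 * (n + q)\<close>.\<close>
  define \<alpha> where "\<alpha> = 4 * (n + q) / (R\<^sup>2 * (1 + q))"
  have \<alpha>: "\<alpha> > 0" using n q R by (simp add: \<alpha>_def)
  define h0 where "h0 x = exp (- \<alpha> * ((x - y) \<bullet> (x - y))) - exp (- \<alpha> * R\<^sup>2)" for x
  have h0le: "h0 x < 1" for x
  proof -
    have "exp (- \<alpha> * ((x - y) \<bullet> (x - y))) \<le> 1" using \<alpha> by simp
    then show ?thesis unfolding h0_def using exp_gt_zero[of "- \<alpha> * R\<^sup>2"] by linarith
  qed
  have h0out: "h0 x < 0" if "x \<notin> cball y R" for x
  proof -
    have "R < norm (x - y)" using that by (simp add: dist_norm norm_minus_commute)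
    then have "R\<^sup>2 < (norm (x - y))\<^sup>2" using R by (intro power_strict_mono) auto
    then show ?thesis using \<alpha> by (simp add: h0_def dot_square_norm)
  qed
  have h0z: "h0 z = 0" by (simp add: h0_def zy R_def dot_square_norm)
  define S where "S = sphere z \<delta>"
  have S\<Omega>: "S \<subseteq> \<Omega>" using \<delta>(3) by (auto simp: S_def subset_eq)
  have contS: "continuous_on S u" using u S\<Omega> continuous_on_subset by blast
  \<comment> \<open>On the part of the sphere in the tangent ball \<open>u\<close> exceeds
    \<open>k\<close> by a fixed \<open>\<epsilon>\<close>, and \<open>h0 < 1\<close>; on the rest
    \<open>h0\<close> is negative. Hence \<open>u > k + \<epsilon> * h0\<close> on the whole sphere,
    with a margin \<open>2 * \<eta>\<close> by compactness.\<close>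
  have "\<exists>\<epsilon>>0. \<forall>x\<in>S \<inter> cball y R. k + \<epsilon> \<le> u x"
  proof (cases "S \<inter> cball y R = {}")
    case False
    have "compact (S \<inter> cball y R)" by (auto simp: S_def)
    moreover have "continuous_on (S \<inter> cball y R) u" using contS continuous_on_subset by blast
    ultimately obtain x1 where x1: "x1 \<in> S \<inter> cball y R" "\<And>x. x \<in> S \<inter> cball y R \<Longrightarrow> u x1 \<le> u x"
      using continuous_attains_inf[of "S \<inter> cball y R" u] False by blast
    have "x1 \<noteq> z" using x1 \<delta>(1) by (auto simp: S_def)
    then have "k < u x1" using inside x1 by blast
    then show ?thesis using x1(2) by (intro exI[of _ "u x1 - k"]) auto
  qed (auto intro: exI[of _ 1])
  then obtain \<epsilon> where \<epsilon>: "\<epsilon> > 0" "\<And>x. x \<in> S \<Longrightarrow> x \<in> cball y R \<Longrightarrow> k + \<epsilon> \<le> u x" by blast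
  have strict: "0 < u x - k - \<epsilon> * h0 x" if x: "x \<in> S" for x
  proof (cases "x \<in> cball y R")
    case True
    have "\<epsilon> * h0 x < \<epsilon> * 1" using h0le \<epsilon>(1) by (intro mult_strict_left_mono) auto
    then show ?thesis using \<epsilon>(2)[OF x True] by simp
  next
    case False
    have "\<epsilon> * h0 x < 0" using h0out[OF False] \<epsilon>(1) by (simp add: mult_pos_neg)
    then show ?thesis using k[of x] x S\<Omega> by force
  qed
  have "S \<noteq> {}" unfolding S_def using \<delta>(1) by (metis less_imp_le sphere_eq_empty not_less)
  moreover have "compact S" by (simp add: S_def)
  moreover have conth0: "continuous_on T h0" for T unfolding h0_def[abs_def] by (intro continuous_intros)
  then have "continuous_on S (\<lambda>x. u x - k - \<epsilon> * h0 x)" by (intro continuous_intros contS)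
  ultimately obtain x1 where x1: "x1 \<in> S" "\<And>x. x \<in> S \<Longrightarrow> u x1 - k - \<epsilon> * h0 x1 \<le> u x - k - \<epsilon> * h0 x"
    using continuous_attains_inf[of S "\<lambda>x. u x - k - \<epsilon> * h0 x"] by blast
  define \<eta> where "\<eta> = (u x1 - k - \<epsilon> * h0 x1) / 2"
  have \<eta>2: "2 * \<eta> = u x1 - k - \<epsilon> * h0 x1" by (simp add: \<eta>_def)
  have \<eta>: "\<eta> > 0" using strict[OF x1(1)] unfolding \<eta>2[symmetric] by simp
  have \<eta>S: "2 * \<eta> \<le> u x - k - \<epsilon> * h0 x" if "x \<in> S" for x
    unfolding \<eta>2 by (rule x1(2)[OF that])
  define c where "c = - k - \<eta> + \<epsilon> * exp (- \<alpha> * R\<^sup>2)"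
  define w where "w = (\<lambda>x. c - \<epsilon> * exp (- \<alpha> * ((x - y) \<bullet> (x - y))))"
  have w_eq: "w x = - k - \<eta> - \<epsilon> * h0 x" for x by (simp add: w_def c_def h0_def algebra_simps)
  define D where "D = ball z \<delta>"
  have D: "open D" "D \<subseteq> \<Omega>" using \<delta>(3) by (auto simp: D_def subset_eq)
  have far: "x \<noteq> y \<and> n + q < 2 * \<alpha> * ((x - y) \<bullet> (x - y)) * (1 + q)" if x: "x \<in> D" for x
  proof -
    have "norm (z - y) = R" by (simp add: zy R_def)
    moreover have "norm (z - x) < R / 2" using x \<delta>(2) by (simp add: D_def dist_norm)
    ultimately have far: "R / 2 < norm (x - y)" using norm_triangle_ineq[of "z - x" "x - y"] by simp
    then have "(R / 2)\<^sup>2 < (norm (x - y))\<^sup>2" using R by (intro power_strict_mono) auto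
    then have "R\<^sup>2 / 4 < (x - y) \<bullet> (x - y)" by (simp add: dot_square_norm power_divide)
    then have "2 * \<alpha> * (R\<^sup>2 / 4) * (1 + q) < 2 * \<alpha> * ((x - y) \<bullet> (x - y)) * (1 + q)"
      using \<alpha> q by (intro mult_strict_right_mono mult_strict_left_mono) auto
    moreover have "2 * (4 * N / (X * Q)) * (X / 4) * Q = 2 * N" if "0 < X" "0 < Q" for N X Q :: real
      using that by simp
    from this[of "R\<^sup>2" "1 + q" "n + q"] have "2 * \<alpha> * (R\<^sup>2 / 4) * (1 + q) = 2 * (n + q)"
      using R q by (simp only: \<alpha>_def zero_less_power)
    ultimately have "2 * (n + q) < 2 * \<alpha> * ((x - y) \<bullet> (x - y)) * (1 + q)" by simp
    moreover have "n + q \<le> 2 * (n + q)" using n q by simp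
    moreover have "x \<noteq> y" using far R by auto
    ultimately show ?thesis by linarith
  qed
  note barrier = exp_barrier[OF \<alpha> \<epsilon>(1), where c = c and y = y, folded w_def]
  have C2w: "C2_on D w" using barrier(1) by (auto simp: C2_on_def elim: continuous_on_subset)
  have "- u z \<le> w z"
  proof (rule weak_comparison[OF p \<Omega> D _ W1p_loc_uminus[OF W]])
    show "continuous_on \<Omega> (\<lambda>x. - u x)" using u by (intro continuous_intros)
    show "(LINT x:D|lebesgue. p_flux p (- G x) \<bullet> grad \<zeta> x) \<le> 0" if \<zeta>: "\<zeta> \<in> C1c D" "\<And>x. 0 \<le> \<zeta> x" for \<zeta>
    proof -
      have "0 \<le> (LINT x:\<Omega>|lebesgue. p_flux p (G x) \<bullet> grad \<zeta> x)"
        using sh C1c_mono[OF \<zeta>(1) D(2)] \<zeta>(2) by (simp add: weakly_p_superharmonic_def)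
      also have "\<dots> = (LINT x:D|lebesgue. p_flux p (G x) \<bullet> grad \<zeta> x)"
        by (rule C1c_integral_subset[OF \<zeta>(1) D(2), symmetric])
      also have "\<dots> = - (LINT x:D|lebesgue. p_flux p (- G x) \<bullet> grad \<zeta> x)"
        by (simp add: p_flux_uminus set_lebesgue_integral_def)
      finally show ?thesis by simp
    qed
    show "w differentiable (at x)" for x using barrier(1) by (simp add: C2_on_def)
    show "continuous_on D (grad w)" using C2_on_continuous(2)[OF C2w] .
    show "0 \<le> (LINT x|lborel. p_flux p (grad w x) \<bullet> grad \<zeta> x)" if \<zeta>: "\<zeta> \<in> C1c D" "\<And>x. 0 \<le> \<zeta> x" for \<zeta>
    proof (rule weak_supersolution_C2[OF p D(1) C2w _ _ \<zeta>])
      show "normalized_pl (p - 2) (hess w x) (grad w x) < 0" if "x \<in> D" for x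
        using barrier(3)[where x = x and q = q] far[OF that] by (simp add: n_def q_def)
      show "trace_blinfun (hess w x) < 0" if "x \<in> D" "grad w x = 0" for x
        using barrier(2)[where x = x] far[OF that(1)] that(2) by simp
    qed
    define K where "K = {x\<in>cball z \<delta>. w x \<le> - u x}"
    have contw: "continuous_on T w" for T unfolding w_def by (intro continuous_intros)
    have "closedin (top_of_set (cball z \<delta>)) (cball z \<delta> \<inter> (\<lambda>x. - u x - w x) -` {0..})"
      using continuous_on_subset[OF u \<delta>(3)] contw by (intro continuous_closedin_preimage continuous_intros) auto
    then have "compact (cball z \<delta> \<inter> (\<lambda>x. - u x - w x) -` {0..})" using closedin_compact[of "cball z \<delta>"] by auto
    moreover have "cball z \<delta> \<inter> (\<lambda>x. - u x - w x) -` {0..} = K" by (auto simp: K_def)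
    ultimately show "compact K" by simp
    show "K \<subseteq> D"
    proof
      fix x assume x: "x \<in> K"
      have "x \<notin> S"
      proof
        assume "x \<in> S"
        from \<eta>S[OF this] \<eta> x show False by (simp add: K_def w_eq)
      qed
      then show "x \<in> D" using x by (auto simp: K_def S_def D_def)
    qed
    show "- u x \<le> w x" if "x \<in> D" "x \<notin> K" for x using that by (auto simp: K_def D_def)
    show "z \<in> D" using \<delta>(1) by (simp add: D_def)
  qed
  then show False using \<eta> by (simp add: w_eq h0z z(2))
qed

text \<open>The mean value inequality for \<open>grad \<phi>\<close> minus its frozen linearization,
  whose derivative is the oscillation of the Hessian. The size of the Hessian itself does not
  enter.\<close>

lemma grad_perturbation_linear:
  fixes \<phi> :: "'a::euclidean_space \<Rightarrow> real"
  assumes diff: "\<And>y. y \<in> cball x r \<Longrightarrow> grad \<phi> differentiable (at y)"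
    and osc: "\<And>y. y \<in> cball x r \<Longrightarrow> norm (hess \<phi> y - hess \<phi> x) \<le> b" and h: "norm h \<le> r"
  shows "norm (grad \<phi> (x + h) - grad \<phi> x - hess \<phi> x h) \<le> b * r"
proof -
  have r: "0 \<le> r" using h norm_ge_zero[of h] by linarith
  have b: "0 \<le> b" using osc[of x] r by simp
  define g where "g y = grad \<phi> y - hess \<phi> x y" for y
  have "norm (g (x + h) - g x) \<le> b * norm (x + h - x)"
  proof (rule differentiable_bound[of "cball x r" g "\<lambda>y. blinfun_apply (hess \<phi> y - hess \<phi> x)"])
    show "(g has_derivative blinfun_apply (hess \<phi> y - hess \<phi> x)) (at y within cball x r)" if "y \<in> cball x r" for y
    proof -
      have "(g has_derivative (\<lambda>v. hess \<phi> y v - hess \<phi> x v)) (at y)"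
        unfolding g_def using hess_has_derivative[OF diff[OF that]]
        by (intro has_derivative_diff bounded_linear_imp_has_derivative blinfun.bounded_linear_right)
      then have "(g has_derivative blinfun_apply (hess \<phi> y - hess \<phi> x)) (at y)"
        by (simp add: blinfun.diff_left[abs_def])
      then show ?thesis by (rule has_derivative_at_withinI)
    qed
    show "onorm (blinfun_apply (hess \<phi> y - hess \<phi> x)) \<le> b" if "y \<in> cball x r" for y
      using osc[OF that] by (simp add: norm_blinfun.rep_eq)
  qed (use h r in \<open>auto simp: dist_norm\<close>)
  also have "\<dots> \<le> b * r" using h b by (simp add: mult_left_mono)
  also have "g (x + h) - g x = grad \<phi> (x + h) - grad \<phi> x - hess \<phi> x h"
    by (simp add: g_def blinfun.add_right)
  finally show ?thesis .
qed

lemma paraboloid_derivatives: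
  fixes \<phi> :: "'a::euclidean_space \<Rightarrow> real" and b c :: real and y :: 'a
  assumes D: "open D" and \<phi>: "C2_on D \<phi>"
  defines "w \<equiv> \<lambda>x. \<phi> x + b * ((x - y) \<bullet> (x - y)) + c"
  shows "C2_on D w" and "x \<in> D \<Longrightarrow> grad w x = grad \<phi> x + (2 * b) *\<^sub>R (x - y)"
    and "x \<in> D \<Longrightarrow> hess w x = hess \<phi> x + (2 * b) *\<^sub>R id_blinfun"
proof -
  have dw: "(w has_derivative (\<lambda>h. (grad \<phi> x + (2 * b) *\<^sub>R (x - y)) \<bullet> h)) (at x)" if "x \<in> D" for x
  proof -
    have "\<phi> differentiable (at x)" using \<phi> that by (simp add: C2_on_def)
    moreover have "((\<lambda>x. (x - y) \<bullet> (x - y)) has_derivative (\<lambda>h. 2 * ((x - y) \<bullet> h))) (at x)"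
      by (auto intro!: derivative_eq_intros simp: fun_eq_iff inner_commute)
    ultimately have "(w has_derivative (\<lambda>h. grad \<phi> x \<bullet> h + b * (2 * ((x - y) \<bullet> h)) + 0)) (at x)"
      unfolding w_def by (intro has_derivative_add has_derivative_mult_right has_derivative_grad has_derivative_const)
    then show ?thesis by (rule has_derivative_eq_rhs) (simp add: fun_eq_iff inner_add_left)
  qed
  have gw: "grad w x = grad \<phi> x + (2 * b) *\<^sub>R (x - y)" if "x \<in> D" for x using grad_unique(2)[OF dw[OF that]] .
  then show "x \<in> D \<Longrightarrow> grad w x = grad \<phi> x + (2 * b) *\<^sub>R (x - y)" .
  have dgw: "(grad w has_derivative blinfun_apply (hess \<phi> x + (2 * b) *\<^sub>R id_blinfun)) (at x)" if x: "x \<in> D" for x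
  proof -
    have "grad \<phi> differentiable (at x)" using \<phi> x by (simp add: C2_on_def)
    then have "((\<lambda>x. grad \<phi> x + (2 * b) *\<^sub>R (x - y)) has_derivative (\<lambda>h. hess \<phi> x h + (2 * b) *\<^sub>R (h - 0))) (at x)"
      by (intro has_derivative_add has_derivative_scaleR_right has_derivative_diff hess_has_derivative has_derivative_ident has_derivative_const)
    then have "((\<lambda>x. grad \<phi> x + (2 * b) *\<^sub>R (x - y)) has_derivative blinfun_apply (hess \<phi> x + (2 * b) *\<^sub>R id_blinfun)) (at x)"
      by (rule has_derivative_eq_rhs) (simp add: fun_eq_iff blinfun.add_left blinfun.scaleR_left)
    then show ?thesis by (rule has_derivative_transform_within_open[OF _ D x]) (simp add: gw)
  qed
  have hw: "hess w x = hess \<phi> x + (2 * b) *\<^sub>R id_blinfun" if "x \<in> D" for x using hess_unique[OF dgw[OF that]] .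
  then show "x \<in> D \<Longrightarrow> hess w x = hess \<phi> x + (2 * b) *\<^sub>R id_blinfun" .
  have "continuous_on D (hess w)"
    by (subst continuous_on_cong[OF refl hw], assumption) (intro continuous_intros C2_on_continuous(3)[OF \<phi>])
  then show "C2_on D w" unfolding C2_on_def using dw dgw by (auto simp: differentiable_def)
qed

section \<open>Nondegeneracy at the free boundary\<close>

lemma open_noncontact_set:
  assumes "open \<Omega>" "continuous_on \<Omega> u" "continuous_on \<Omega> \<phi>"
  shows "open (noncontact_set \<Omega> \<phi> u)"
proof -
  have "open (\<Omega> \<inter> (\<lambda>x. u x - \<phi> x) -` {0<..})"
    using assms by (intro continuous_open_preimage continuous_intros) auto
  moreover have "\<Omega> \<inter> (\<lambda>x. u x - \<phi> x) -` {0<..} = noncontact_set \<Omega> \<phi> u"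
    by (auto simp: noncontact_set_def)
  ultimately show ?thesis by simp
qed

text \<open>The noncontact set is open relative to \<open>\<Omega>\<close>, so its relative frontier
  is disjoint from it and lies on the contact set.\<close>

lemma free_boundaryD:
  assumes \<Omega>: "open \<Omega>" "continuous_on \<Omega> u" "continuous_on \<Omega> \<phi>" and le: "\<And>x. x \<in> \<Omega> \<Longrightarrow> \<phi> x \<le> u x"
    and x0: "x0 \<in> free_boundary \<Omega> \<phi> u"
  shows "x0 \<in> \<Omega>" "u x0 = \<phi> x0" "\<And>\<delta>. 0 < \<delta> \<Longrightarrow> \<exists>y\<in>noncontact_set \<Omega> \<phi> u. dist y x0 < \<delta>"
proof -
  let ?N = "noncontact_set \<Omega> \<phi> u"
  have "?N \<subseteq> \<Omega>" by (auto simp: noncontact_set_def)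
  then have "openin (top_of_set \<Omega>) ?N" using open_noncontact_set[OF \<Omega>] by (simp add: open_subset)
  then have "x0 \<notin> ?N" and cl: "x0 \<in> top_of_set \<Omega> closure_of ?N"
    using x0 by (auto simp: free_boundary_def frontier_of_def interior_of_openin)
  show "x0 \<in> \<Omega>" using cl by (simp add: in_closure_of)
  then show "u x0 = \<phi> x0" using \<open>x0 \<notin> ?N\<close> le[of x0] by (auto simp: noncontact_set_def)
  fix \<delta> :: real assume "0 < \<delta>"
  then have "x0 \<in> \<Omega> \<inter> ball x0 \<delta> \<and> openin (top_of_set \<Omega>) (\<Omega> \<inter> ball x0 \<delta>)"
    using \<open>x0 \<in> \<Omega>\<close> by (simp add: openin_open_Int)
  then obtain y where "y \<in> ?N" "y \<in> \<Omega> \<inter> ball x0 \<delta>" using cl unfolding in_closure_of by blast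
  then show "\<exists>y\<in>?N. dist y x0 < \<delta>" by (auto simp: dist_commute)
qed

text \<open>Let \<open>w\<close> be the paraboloid above the obstacle, lifted by half the gap at
  \<open>y\<close>. If \<open>u - \<phi>\<close> stayed below \<open>b * s^2\<close> on the sphere,
  then \<open>u < w\<close> there, and \<open>{w \<le> u}\<close> would be compact inside the
  noncontact set because \<open>w > \<phi>\<close>. Comparison there would give
  \<open>u y \<le> w y = \<phi> y + \<eta>\<close>, which is less than \<open>u y\<close>.\<close>

lemma obstacle_growth_from_noncontact:
  fixes \<phi> u :: "'a::euclidean_space \<Rightarrow> real" and b p s :: real and y :: 'a
  assumes p: "1 < p" and \<Omega>: "open \<Omega>" and \<phi>: "C2_on \<Omega> \<phi>" and sol: "obstacle_solution p \<Omega> \<phi> u"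
    and b: "0 < b" and y: "y \<in> noncontact_set \<Omega> \<phi> u" and s: "0 < s" "cball y s \<subseteq> \<Omega>"
    and npl: "\<And>x. x \<in> ball y s \<Longrightarrow> grad \<phi> x + (2 * b) *\<^sub>R (x - y) \<noteq> 0 \<Longrightarrow>
       normalized_pl (p - 2) (hess \<phi> x) (grad \<phi> x + (2 * b) *\<^sub>R (x - y)) + 2 * b * (DIM('a) + (p - 2)) < 0"
    and tr: "\<And>x. x \<in> ball y s \<Longrightarrow> grad \<phi> x + (2 * b) *\<^sub>R (x - y) = 0 \<Longrightarrow> trace_blinfun (hess \<phi> x) + 2 * b * DIM('a) < 0"
  shows "\<exists>x\<in>sphere y s. b * s\<^sup>2 \<le> u x - \<phi> x"
proof (rule ccontr)
  assume "\<not> ?thesis"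
  then have small: "\<And>x. x \<in> sphere y s \<Longrightarrow> u x - \<phi> x < b * s\<^sup>2" by (auto simp: not_le)
  obtain G where u: "continuous_on \<Omega> u" "\<And>x. x \<in> \<Omega> \<Longrightarrow> \<phi> x \<le> u x" and G: "W1p_loc p \<Omega> u G"
    and harm: "weakly_p_harmonic p (noncontact_set \<Omega> \<phi> u) G"
    using sol by (auto simp: obstacle_solution_def)
  define N where "N = noncontact_set \<Omega> \<phi> u"
  have cont\<phi>: "continuous_on \<Omega> \<phi>" by (rule C2_on_continuous(1)[OF \<phi>])
  have N: "open N" "N \<subseteq> \<Omega>" unfolding N_def using open_noncontact_set[OF \<Omega> u(1) cont\<phi>] by (auto simp: noncontact_set_def)
  have uy: "\<phi> y < u y" using y by (simp add: noncontact_set_def)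
  define \<eta> where "\<eta> = (u y - \<phi> y) / 2"
  have \<eta>: "\<eta> > 0" using uy by (simp add: \<eta>_def)
  define w where "w = (\<lambda>x. \<phi> x + b * ((x - y) \<bullet> (x - y)) + \<eta>)"
  define D where "D = N \<inter> ball y s"
  have D: "open D" "D \<subseteq> \<Omega>" "D \<subseteq> N" using N by (auto simp: D_def)
  have \<phi>D: "C2_on D \<phi>" using \<phi> D(2) by (auto simp: C2_on_def elim: continuous_on_subset)
  note wD = paraboloid_derivatives[OF D(1) \<phi>D, where b = b and y = y and c = \<eta>, folded w_def]
  have "u y \<le> w y"
  proof (rule weak_comparison[OF p \<Omega> D(1,2) u(1) G])
    show "(LINT x:D|lebesgue. p_flux p (G x) \<bullet> grad \<zeta> x) \<le> 0" if \<zeta>: "\<zeta> \<in> C1c D" for \<zeta>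
    proof -
      have "(LINT x:D|lebesgue. p_flux p (G x) \<bullet> grad \<zeta> x) = (LINT x:N|lebesgue. p_flux p (G x) \<bullet> grad \<zeta> x)"
        by (rule C1c_integral_subset[OF \<zeta> D(3)])
      also have "\<dots> = 0" using harm C1c_mono[OF \<zeta> D(3)] by (simp add: weakly_p_harmonic_def N_def)
      finally show ?thesis by simp
    qed
    show "w differentiable (at x)" if "x \<in> D" for x using wD(1) that by (simp add: C2_on_def)
    show "continuous_on D (grad w)" by (rule C2_on_continuous(2)[OF wD(1)])
    show "0 \<le> (LINT x|lborel. p_flux p (grad w x) \<bullet> grad \<zeta> x)" if \<zeta>: "\<zeta> \<in> C1c D" "\<And>x. 0 \<le> \<zeta> x" for \<zeta>
    proof (rule weak_supersolution_C2[OF p D(1) wD(1) _ _ \<zeta>])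
      fix x assume x: "x \<in> D"
      then have xb: "x \<in> ball y s" by (simp add: D_def)
      show "normalized_pl (p - 2) (hess w x) (grad w x) < 0" if "grad w x \<noteq> 0"
        using npl[OF xb] that wD(2,3)[OF x] by (simp add: normalized_pl_add_scaleR_id)
      show "trace_blinfun (hess w x) < 0" if "grad w x = 0"
        using tr[OF xb] that wD(2,3)[OF x] by (simp add: trace_blinfun_add trace_blinfun_scaleR_id)
    qed
    define K where "K = {x\<in>cball y s. w x \<le> u x}"
    have contw: "continuous_on (cball y s) w"
      unfolding w_def by (intro continuous_intros continuous_on_subset[OF cont\<phi> s(2)])
    have "closedin (top_of_set (cball y s)) (cball y s \<inter> (\<lambda>x. u x - w x) -` {0..})"
      using contw by (intro continuous_closedin_preimage continuous_intros continuous_on_subset[OF u(1) s(2)]) auto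
    then have "compact (cball y s \<inter> (\<lambda>x. u x - w x) -` {0..})" using closedin_compact[of "cball y s"] by auto
    moreover have "cball y s \<inter> (\<lambda>x. u x - w x) -` {0..} = K" by (auto simp: K_def)
    ultimately show "compact K" by simp
    show "K \<subseteq> D"
    proof
      fix x assume x: "x \<in> K"
      then have xs: "x \<in> cball y s" "w x \<le> u x" by (auto simp: K_def)
      have "x \<notin> sphere y s"
      proof
        assume xs': "x \<in> sphere y s"
        then have "(x - y) \<bullet> (x - y) = s\<^sup>2" by (simp add: dist_norm dot_square_norm norm_minus_commute)
        then show False using small[OF xs'] xs(2) \<eta> by (simp add: w_def)
      qed
      then have "x \<in> ball y s" using xs by auto
      moreover have "\<phi> x < w x" using b \<eta> by (simp add: w_def add_nonneg_pos)
      then have "x \<in> N" using xs s(2) by (auto simp: N_def noncontact_set_def)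
      ultimately show "x \<in> D" by (simp add: D_def)
    qed
    show "u x \<le> w x" if "x \<in> D" "x \<notin> K" for x using that by (auto simp: K_def D_def)
    show "y \<in> D" using y s by (simp add: D_def N_def)
  qed
  moreover have "w y = \<phi> y + \<eta>" by (simp add: w_def)
  moreover have "2 * \<eta> = u y - \<phi> y" by (simp add: \<eta>_def)
  ultimately show False using \<eta> by linarith
qed

text \<open>The radius has to be named before the obstacle, hence also when
  \<open>\<omega> (3/4)\<close> does not tend to 0; then no obstacle has this modulus and any radius
  will do. The bound \<open>1 / 8\<close> ensures that points within \<open>r0\<close> of the ball
  of radius \<open>5 / 8\<close> stay in the ball of radius \<open>3 / 4\<close>.\<close>

lemma hess_modulus_radius:
  fixes \<omega> :: "real \<Rightarrow> real \<Rightarrow> real"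
  assumes \<epsilon>: "0 < \<epsilon>"
  obtains r0 where "0 < r0" "r0 \<le> 1 / 8" "\<And>(\<phi> :: 'a::euclidean_space \<Rightarrow> real) x x'. hess_modulus \<omega> \<phi> \<Longrightarrow>
     x \<in> ball 0 (3/4) \<Longrightarrow> x' \<in> ball 0 (3/4) \<Longrightarrow> dist x' x \<le> r0 \<Longrightarrow> norm (hess \<phi> x' - hess \<phi> x) \<le> \<epsilon>"
proof (cases "(\<omega> (3/4) \<longlongrightarrow> 0) (at_right 0)")
  case True
  then have "\<forall>\<^sub>F t in at_right 0. \<omega> (3/4) t < \<epsilon>" using order_tendstoD(2) \<epsilon> by blast
  then obtain d where d: "d > 0" "\<And>t. 0 < t \<Longrightarrow> t < d \<Longrightarrow> \<omega> (3/4) t < \<epsilon>"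
    by (auto simp: eventually_at_right_field)
  show ?thesis
  proof (rule that[of "min (d / 2) (1 / 8)"])
    fix \<phi> :: "'a \<Rightarrow> real" and x x' :: 'a
    assume m: "hess_modulus \<omega> \<phi>" and x: "x \<in> ball 0 (3/4)" "x' \<in> ball 0 (3/4)" and dx: "dist x' x \<le> min (d / 2) (1 / 8)"
    have mod: "dist (hess \<phi> x') (hess \<phi> x) \<le> \<omega> (3/4) (dist x' x)"
      using m[unfolded hess_modulus_def, rule_format, of "3/4"] x by (simp add: modulus_of_continuity_on_def)
    show "norm (hess \<phi> x' - hess \<phi> x) \<le> \<epsilon>"
    \<comment> \<open>The limit at 0 from the right says nothing about
      \<open>\<omega> (3/4) 0\<close>.\<close>
    proof (cases "x' = x")
      case False
      then have "\<omega> (3/4) (dist x' x) < \<epsilon>" using dx d(1) by (intro d(2)) auto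
      then show ?thesis using mod by (simp add: dist_norm)
    qed (use \<epsilon> in simp)
  qed (use d in auto)
next
  case False
  then have "\<not> hess_modulus \<omega> \<phi>" for \<phi> :: "'a \<Rightarrow> real"
    by (auto simp: hess_modulus_def modulus_of_continuity_on_def intro!: bexI[of _ "3/4"])
  then show ?thesis using that[of "1/8"] by auto
qed

text \<open>The obstacle is a constant \<open>k\<close>, so \<open>u\<close> is weakly
  p-superharmonic and attains its minimum \<open>k\<close> at a free boundary point. The strong
  minimum principle spreads the value \<open>k\<close> to all nearby points, noncontact points among
  them.\<close>

lemma obstacle_constant_no_free_boundary:
  fixes \<phi> u :: "'a::euclidean_space \<Rightarrow> real"
  assumes p: "1 < p" and \<phi>: "C2_on (ball 0 1) \<phi>" and sol: "obstacle_solution p (ball 0 1) \<phi> u"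
    and g0: "\<And>x. x \<in> ball 0 1 \<Longrightarrow> grad \<phi> x = 0"
  shows "free_boundary (ball 0 1) \<phi> u = {}"
proof (rule ccontr)
  assume "\<not> ?thesis"
  then obtain x0 where x0: "x0 \<in> free_boundary (ball 0 1) \<phi> u" by blast
  obtain G where u: "continuous_on (ball 0 1) u" "\<And>x. x \<in> ball 0 1 \<Longrightarrow> \<phi> x \<le> u x" and G: "W1p_loc p (ball 0 1) u G"
    and sh: "weakly_p_superharmonic p (ball 0 1) G"
    using sol by (auto simp: obstacle_solution_def)
  note fb = free_boundaryD[OF open_ball u(1) C2_on_continuous(1)[OF \<phi>] u(2) x0]
  have "\<exists>k. \<forall>x\<in>ball 0 1. \<phi> x = k"
  proof (rule has_derivative_zero_constant)
    fix x :: 'a assume x: "x \<in> ball 0 1"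
    then have "(\<phi> has_derivative (\<lambda>h. grad \<phi> x \<bullet> h)) (at x)" using \<phi> by (intro has_derivative_grad) (simp add: C2_on_def)
    then show "(\<phi> has_derivative (\<lambda>h. 0)) (at x within ball 0 1)" using g0[OF x] by (simp add: has_derivative_at_withinI)
  qed simp
  then obtain k where k: "\<And>x. x \<in> ball 0 1 \<Longrightarrow> \<phi> x = k" by blast
  \<comment> \<open>With \<open>|y1 - x0|\<close> below half the distance from \<open>x0\<close> to
    the unit sphere, the closed ball around \<open>y1\<close> through \<open>x0\<close> stays inside
    the unit ball.\<close>
  have "(1 - norm x0) / 2 > 0" using fb(1) by simp
  then obtain y1 where y1: "y1 \<in> noncontact_set (ball 0 1) \<phi> u" "dist y1 x0 < (1 - norm x0) / 2"
    using fb(3) by blast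
  have sub: "cball y1 (dist y1 x0) \<subseteq> ball 0 1"
  proof
    fix z assume "z \<in> cball y1 (dist y1 x0)"
    then have "norm (z - y1) \<le> norm (y1 - x0)" by (simp add: dist_norm norm_minus_commute)
    then show "z \<in> ball 0 1"
      using y1(2) norm_triangle_ineq[of "z - y1" "y1 - x0"] norm_triangle_ineq[of "z - x0" x0] by (simp add: dist_norm)
  qed
  have "u y1 = k"
    using strong_minimum_principle[OF p open_ball u(1) G sh _ _ sub, of k] u(2) k fb(1,2) by simp
  then show False using y1(1) k by (auto simp: noncontact_set_def)
qed

text \<open>\<open>b\<close> comes from \<open>c\<^sub>0\<close>, \<open>p\<close> and the
  dimension, \<open>r0\<close> from these and the modulus; both are fixed before an obstacle is
  introduced, which is what makes the constant uniform.\<close>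

theorem obstacle_nondegeneracy:
  fixes p c\<^sub>0 :: real and \<omega> :: "real \<Rightarrow> real \<Rightarrow> real"
  assumes p: "1 < p" and c0: "0 < c\<^sub>0"
  shows "\<exists>c\<^sub>1>0. \<forall>(\<phi> :: 'a::euclidean_space \<Rightarrow> real) u.
    C2_on (ball 0 1) \<phi> \<longrightarrow> hess_modulus \<omega> \<phi> \<longrightarrow>
    obstacle_solution p (ball 0 1) \<phi> u \<longrightarrow>
    (\<forall>x\<in>ball 0 1. grad \<phi> x \<noteq> 0 \<longrightarrow>
       norm (grad \<phi> x) powr (2 - p) * p_laplacian p \<phi> x \<le> - c\<^sub>0) \<longrightarrow>
    (\<forall>x\<^sub>0 \<in> free_boundary (ball 0 1) \<phi> u \<inter> ball 0 (1/2). \<forall>r\<in>{0<..<1/2}.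
       c\<^sub>1 * r\<^sup>2 \<le> (SUP x\<in>ball x\<^sub>0 r. u x - \<phi> x))"
proof -
  define m where "m = real DIM('a) + \<bar>p - 2\<bar>"
  have m: "m > 0" unfolding m_def using DIM_positive[where 'a='a] by (simp add: add_pos_nonneg)
  show ?thesis
  proof (rule normalized_pl_stable[OF p half_gt_zero[OF c0], where 'a='a])
    fix b :: real
    assume b: "0 < b" and stable:
    "\<And>(A :: 'a \<Rightarrow>\<^sub>L 'a) P z r. \<lbrakk>\<And>u v. u \<bullet> blinfun_apply A v = v \<bullet> blinfun_apply A u; 0 < r; norm z \<le> r;
       \<And>h. norm h \<le> r \<Longrightarrow> norm (P h - P 0 - blinfun_apply A h) \<le> b * r;
       \<And>h. norm h \<le> r \<Longrightarrow> P h \<noteq> 0 \<Longrightarrow> normalized_pl (p - 2) A (P h) \<le> - (c\<^sub>0 / 2);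
       \<exists>h. norm h \<le> r \<and> P h \<noteq> 0\<rbrakk> \<Longrightarrow>
      (P 0 + (2 * b) *\<^sub>R z \<noteq> 0 \<longrightarrow> normalized_pl (p - 2) A (P 0 + (2 * b) *\<^sub>R z) + 2 * b * (DIM('a) + (p - 2)) < 0)
     \<and> (P 0 + (2 * b) *\<^sub>R z = 0 \<longrightarrow> trace_blinfun A + 2 * b * DIM('a) < 0)"
    \<comment> \<open>\<open>\<epsilon> \<le> b\<close> makes the gradient affine up to
      \<open>b * r0\<close>; \<open>m * \<epsilon> \<le> c\<^sub>0 / 2\<close> pays for evaluating
      the operator with the Hessian at \<open>x\<close> instead of \<open>x + h\<close>. Hence
      stability is used with \<open>c\<^sub>0 / 2\<close>.\<close>
    define \<epsilon> where "\<epsilon> = min b (c\<^sub>0 / (2 * m))"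
    have \<epsilon>: "0 < \<epsilon>" "\<epsilon> \<le> b" "m * \<epsilon> \<le> c\<^sub>0 / 2"
    proof -
      show "0 < \<epsilon>" "\<epsilon> \<le> b" using b c0 m by (auto simp: \<epsilon>_def)
      have "m * \<epsilon> \<le> m * (c\<^sub>0 / (2 * m))" using m by (intro mult_left_mono) (auto simp: \<epsilon>_def)
      then show "m * \<epsilon> \<le> c\<^sub>0 / 2" using m by simp
    qed
    obtain r0 where r0: "0 < r0" "r0 \<le> 1 / 8" and osc: "\<And>(\<phi> :: 'a \<Rightarrow> real) x x'. hess_modulus \<omega> \<phi> \<Longrightarrow>
       x \<in> ball 0 (3/4) \<Longrightarrow> x' \<in> ball 0 (3/4) \<Longrightarrow> dist x' x \<le> r0 \<Longrightarrow> norm (hess \<phi> x' - hess \<phi> x) \<le> \<epsilon>"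
      using hess_modulus_radius[OF \<epsilon>(1), of \<omega>, where 'a='a] by blast
    show ?thesis
    proof (intro exI[of _ "b * r0\<^sup>2"] conjI allI impI ballI)
      show "0 < b * r0\<^sup>2" using b r0 by simp
      fix \<phi> u :: "'a \<Rightarrow> real" and x0 :: 'a and r :: real
      assume \<phi>: "C2_on (ball 0 1) \<phi>" and mod: "hess_modulus \<omega> \<phi>" and sol: "obstacle_solution p (ball 0 1) \<phi> u"
        and neg: "\<forall>x\<in>ball 0 1. grad \<phi> x \<noteq> 0 \<longrightarrow> norm (grad \<phi> x) powr (2 - p) * p_laplacian p \<phi> x \<le> - c\<^sub>0"
        and x0: "x0 \<in> free_boundary (ball 0 1) \<phi> u \<inter> ball 0 (1/2)" and r: "r \<in> {0<..<1/2}"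
      have \<phi>d: "grad \<phi> differentiable (at x)" if "x \<in> ball 0 1" for x using \<phi> that by (simp add: C2_on_def)
      have npl: "normalized_pl (p - 2) (hess \<phi> x) (grad \<phi> x) \<le> - c\<^sub>0" if "x \<in> ball 0 1" "grad \<phi> x \<noteq> 0" for x
        using neg[rule_format, OF that] p_laplacian_eq[OF \<phi>d[OF that(1)] that(2), of p] by simp
      obtain x1 where x1: "x1 \<in> ball 0 1" "grad \<phi> x1 \<noteq> 0"
        using obstacle_constant_no_free_boundary[OF p \<phi> sol] x0 by blast
      have u: "continuous_on (ball 0 1) u" "\<And>x. x \<in> ball 0 1 \<Longrightarrow> \<phi> x \<le> u x"
        using sol by (auto simp: obstacle_solution_def)
      have cont\<phi>: "continuous_on (ball 0 1) \<phi>" by (rule C2_on_continuous(1)[OF \<phi>])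
      note fb = free_boundaryD[OF open_ball u(1) cont\<phi> u(2) IntD1[OF x0]]
      \<comment> \<open>For \<open>r\<close> above \<open>r0\<close> the growth is taken from the
        radius \<open>r0\<close>. Since \<open>r < 1 / 2\<close> and \<open>r0 \<le> 1 / 8\<close>,
        the comparison radius \<open>s\<close> is at least \<open>r0 * r\<close> in every case,
        whence the factor \<open>r0\<^sup>2\<close> in the constant.\<close>
      define \<rho> where "\<rho> = min r r0"
      have \<rho>: "0 < \<rho>" "\<rho> \<le> r" "\<rho> \<le> r0" "2 * r0 * r \<le> \<rho>"
      proof -
        show "0 < \<rho>" "\<rho> \<le> r" "\<rho> \<le> r0" using r r0 by (auto simp: \<rho>_def)
        have "2 * r0 * r \<le> 2 * (1 / 8) * r" using r0 r by (intro mult_right_mono mult_left_mono) auto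
        moreover have "2 * r0 * r \<le> 2 * r0 * (1 / 2)" using r0 r by (intro mult_left_mono) auto
        ultimately show "2 * r0 * r \<le> \<rho>" using r by (simp add: \<rho>_def)
      qed
      have nx0: "norm x0 < 1 / 2" using x0 by simp
      \<comment> \<open>A distance below \<open>\<rho> / 4\<close> together with
        \<open>s = \<rho> / 2\<close> keeps the closed ball around \<open>y\<close> inside the ball
        of radius \<open>\<rho>\<close> around \<open>x0\<close>.\<close>
      obtain y where y: "y \<in> noncontact_set (ball 0 1) \<phi> u" "dist y x0 < \<rho> / 4"
        using fb(3)[of "\<rho> / 4"] \<rho>(1) by auto
      define s where "s = \<rho> / 2"
      have s: "0 < s" using \<rho> by (simp add: s_def)
      have near: "norm (x - x0) < \<rho>" if "x \<in> cball y s" for x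
        using that y(2) \<rho>(1) norm_triangle_ineq[of "x - y" "y - x0"] by (simp add: s_def dist_norm norm_minus_commute)
      have nx: "norm x < 5 / 8" if "x \<in> cball y s" for x
        using near[OF that] \<rho>(3) r0(2) nx0 norm_triangle_ineq[of "x - x0" x0] by simp
      have sub: "cball y s \<subseteq> ball 0 1"
      proof
        fix x assume "x \<in> cball y s"
        from nx[OF this] show "x \<in> ball 0 1" by simp
      qed
      have key: "(grad \<phi> x + (2 * b) *\<^sub>R (x - y) \<noteq> 0 \<longrightarrow>
          normalized_pl (p - 2) (hess \<phi> x) (grad \<phi> x + (2 * b) *\<^sub>R (x - y)) + 2 * b * (DIM('a) + (p - 2)) < 0) \<and>
        (grad \<phi> x + (2 * b) *\<^sub>R (x - y) = 0 \<longrightarrow> trace_blinfun (hess \<phi> x) + 2 * b * DIM('a) < 0)"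
        if x: "x \<in> ball y s" for x
      proof -
        have nx5: "norm x < 5 / 8" using nx[of x] x by simp
        have near34: "norm x' < 3 / 4" if "norm (x' - x) \<le> r0" for x'
          using that nx5 r0(2) norm_triangle_ineq[of "x' - x" x] by simp
        have oscx: "norm (hess \<phi> x' - hess \<phi> x) \<le> \<epsilon>" if "norm (x' - x) \<le> r0" for x'
          using osc[OF mod, of x x'] near34[OF that] nx5 that by (simp add: dist_norm)
        \<comment> \<open>The hypothesis is exploited at the fixed scale \<open>r0\<close>, not at
          \<open>s\<close>: the step along the eigenvector may leave the ball around
          \<open>y\<close>. Writing \<open>x + 0\<close> matches \<open>P 0\<close>.\<close>
        have "(grad \<phi> (x + 0) + (2 * b) *\<^sub>R (x - y) \<noteq> 0 \<longrightarrow>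
          normalized_pl (p - 2) (hess \<phi> x) (grad \<phi> (x + 0) + (2 * b) *\<^sub>R (x - y)) + 2 * b * (DIM('a) + (p - 2)) < 0) \<and>
          (grad \<phi> (x + 0) + (2 * b) *\<^sub>R (x - y) = 0 \<longrightarrow> trace_blinfun (hess \<phi> x) + 2 * b * DIM('a) < 0)"
        proof (rule stable[where P = "\<lambda>h. grad \<phi> (x + h)" and r = r0])
          show "v \<bullet> blinfun_apply (hess \<phi> x) v' = v' \<bullet> blinfun_apply (hess \<phi> x) v" for v v'
            using \<phi> nx5 by (intro hess_symmetric[of "ball 0 1"]) (auto simp: C2_on_def)
          show "0 < r0" by fact
          show "norm (x - y) \<le> r0" using x \<rho>(1,3) by (simp add: s_def dist_norm norm_minus_commute)
          show "norm (grad \<phi> (x + h) - grad \<phi> (x + 0) - blinfun_apply (hess \<phi> x) h) \<le> b * r0" if "norm h \<le> r0" for h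
          proof -
            have "norm (grad \<phi> (x + h) - grad \<phi> x - blinfun_apply (hess \<phi> x) h) \<le> b * r0"
            proof (rule grad_perturbation_linear[OF _ _ that])
              fix z assume z: "z \<in> cball x r0"
              then have zx: "norm (z - x) \<le> r0" by (simp add: dist_norm norm_minus_commute)
              show "grad \<phi> differentiable (at z)" using near34[OF zx] by (intro \<phi>d) simp
              show "norm (hess \<phi> z - hess \<phi> x) \<le> b" using oscx[OF zx] \<epsilon>(2) by simp
            qed
            then show ?thesis by simp
          qed
          show "normalized_pl (p - 2) (hess \<phi> x) (grad \<phi> (x + h)) \<le> - (c\<^sub>0 / 2)"
            if h: "norm h \<le> r0" and ne: "grad \<phi> (x + h) \<noteq> 0" for h
          proof -
            have 1: "normalized_pl (p - 2) (hess \<phi> (x + h)) (grad \<phi> (x + h)) \<le> - c\<^sub>0"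
              using near34[of "x + h"] h ne by (intro npl) auto
            have "\<bar>normalized_pl (p - 2) (hess \<phi> (x + h) - hess \<phi> x) (grad \<phi> (x + h))\<bar> \<le> m * norm (hess \<phi> (x + h) - hess \<phi> x)"
              unfolding m_def by (rule abs_normalized_pl_le[OF ne])
            also have "\<dots> \<le> m * \<epsilon>" using oscx[of "x + h"] h m by (intro mult_left_mono) auto
            finally have "\<bar>normalized_pl (p - 2) (hess \<phi> (x + h)) (grad \<phi> (x + h)) - normalized_pl (p - 2) (hess \<phi> x) (grad \<phi> (x + h))\<bar> \<le> c\<^sub>0 / 2"
              unfolding normalized_pl_diff using \<epsilon>(3) by linarith
            then show ?thesis using 1 by linarith
          qed
          obtain x' where "x' \<in> ball 0 1" "dist x' x < r0" "grad \<phi> x' \<noteq> 0"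
          proof (rule critical_points_nowhere_dense[OF open_ball connected_ball \<phi> c0 npl x1])
            show "x \<in> ball 0 1" using nx5 by simp
          qed (use r0 in auto)
          then show "\<exists>h. norm h \<le> r0 \<and> grad \<phi> (x + h) \<noteq> 0"
            by (intro exI[of _ "x' - x"]) (auto simp: dist_norm)
        qed
        then show ?thesis by simp
      qed
      obtain x where x: "x \<in> sphere y s" "b * s\<^sup>2 \<le> u x - \<phi> x"
        using obstacle_growth_from_noncontact[OF p open_ball \<phi> sol b y(1) s sub] key by blast
      have "r0 * r \<le> s" using \<rho>(4) by (simp add: s_def)
      then have "(r0 * r)\<^sup>2 \<le> s\<^sup>2" using r0 r by (intro power_mono) auto
      then have "b * r0\<^sup>2 * r\<^sup>2 \<le> b * s\<^sup>2" using b by (simp add: power_mult_distrib)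
      also have "\<dots> \<le> u x - \<phi> x" by (rule x(2))
      also have "\<dots> \<le> (SUP x\<in>ball x0 r. u x - \<phi> x)"
      proof (rule cSUP_upper)
        show "x \<in> ball x0 r" using near[of x] x(1) \<rho>(2) by (simp add: dist_norm norm_minus_commute)
        \<comment> \<open>The supremum over the open ball is bounded because the closed ball is
          compact inside the unit ball, by \<open>|x0| + r < 1\<close>.\<close>
        have "cball x0 r \<subseteq> ball 0 1"
        proof
          fix z assume "z \<in> cball x0 r"
          then show "z \<in> ball 0 1" using nx0 r norm_triangle_ineq[of "z - x0" x0] by (simp add: dist_norm norm_minus_commute)
        qed
        then have "continuous_on (cball x0 r) (\<lambda>x. u x - \<phi> x)"
          by (intro continuous_intros continuous_on_subset[OF u(1)] continuous_on_subset[OF cont\<phi>])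
        then have "bounded ((\<lambda>x. u x - \<phi> x) ` cball x0 r)"
          by (intro compact_imp_bounded compact_continuous_image) auto
        then have "bdd_above ((\<lambda>x. u x - \<phi> x) ` cball x0 r)" by (rule bounded_imp_bdd_above)
        then show "bdd_above ((\<lambda>x. u x - \<phi> x) ` ball x0 r)"
          by (rule bdd_above_mono) (intro image_mono ball_subset_cball)
      qed
      finally show "b * r0\<^sup>2 * r\<^sup>2 \<le> (SUP x\<in>ball x0 r. u x - \<phi> x)" .
    qed
  qed
qed

theorem theorem1p5:
  fixes p c\<^sub>0 :: real and \<omega> :: "real \<Rightarrow> real \<Rightarrow> real"
  assumes "1 < p" and "0 < c\<^sub>0"
  shows "\<exists>c\<^sub>1>0. \<forall>(\<phi> :: real ^ 'n \<Rightarrow> real) u.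
    C2_on (ball 0 1) \<phi> \<longrightarrow> hess_modulus \<omega> \<phi> \<longrightarrow>
    obstacle_solution p (ball 0 1) \<phi> u \<longrightarrow>
    (\<forall>x\<in>ball 0 1. grad \<phi> x \<noteq> 0 \<longrightarrow>
       norm (grad \<phi> x) powr (2 - p) * p_laplacian p \<phi> x \<le> - c\<^sub>0) \<longrightarrow>
    (\<forall>x\<^sub>0 \<in> free_boundary (ball 0 1) \<phi> u \<inter> ball 0 (1/2). \<forall>r\<in>{0<..<1/2}.
       c\<^sub>1 * r\<^sup>2 \<le> (SUP x\<in>ball x\<^sub>0 r. u x - \<phi> x))"
  using assms by (rule obstacle_nondegeneracy)

end
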